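(* Let $X\in C([0,T],U)$ be a path admitting the continuous quadratic variation $[X]=([X_i,X_j])_{i,j=1,\dots,d}$ along $(\mathbb{T}_n)$, let $A\in \mathrm{CBV}([0,T],S)$, and let $F\in\mathbb{C}^{1,2}_b(U,S)$. For $n\in\mathbb N$ define the approximating path $X^n\in D([0,T],U)$ by $$X^n(t):=\sum_{s\in\mathbb{T}_n}X(s')\mathbf{1}_{[s,s')}(t)+X(T)\mathbf{1}_{\{T\}}(t),\qquad 0\le t\le T,$$ and let $X^{n,s-}:=\lim_{r\uparrow s}X^{n,r}$, where $X^{n,r}$ denotes $X^n$ stopped at $r$. Then the pathwise It\^o integral along $(\mathbb{T}_n)$, $$\int_0^T\nabla_XF(s,X,A)\,dX(s):=\lim_{n\uparrow\infty}\sum_{s\in\mathbb{T}_n}\nabla_XF(s,X^{n,s-},A)\cdot\big(X(s')-X(s)\big),$$ exists and, with $A_0(t)=t$, $$\begin{aligned}F(T,X,A)-F(0,X,A)&=\int_0^T\nabla_XF(s,X,A)\,dX(s)+\sum_{i=0}^m\int_0^T\mathscr{D}_iF(s,X,A)\,dA_i(s)\\&\quad+\frac12\sum_{i,j=1}^d\int_0^T\partial_{ij}F(s,X,A)\,d[X_i,X_j](s),\end{aligned}$$ where the two rightmost integrals are Lebesgue--Stieltjes integrals.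
   Context: Fix $T>0$ and open sets $U\subset\mathbb R^d$, $S\subset\mathbb R^m$. $\mathrm{CBV}([0,T],S)$ is the set of continuous $S$-valued functions on $[0,T]$ whose components are of bounded variation. $D([0,T],U)$ is the space of c\`adl\`ag functions $X:[0,T]\to U$ whose left limits $X(t-)$ also lie in $U$, with the norm $\|X\|_\infty=\sup_{u\in[0,T]}|X(u)|$. For a path $X$, $X^t:=(X(t\wedge s))_{s\in[0,T]}$ is the path stopped at $t$, and $X^{t-}:=\lim_{r\uparrow t}X^r$ for $t>0$ (equal to $X(u)$ for $u<t$ and to $X(t-)$ for $u\ge t$). $X^{n,0-}$ is understood as the constant path $X(0)$. A functional $F:[0,T]\times D([0,T],U)\times \mathrm{CBV}([0,T],S)\to\mathbb R$ is non-anticipative if $F(t,X,A)=F(t,X^t,A^t)$ for all $(t,X,A)$. A non-anticipative $F$ is called: - boundedness-preserving if for every $A\in\mathrm{CBV}([0,T],S)$ and compact $K\subset U$ there is a constant $C$ with $|F(t,X,A)|\le C$ for all $t\in[0,T]$, $X\in D([0,T],K)$; - continuous at fixed times if for all $\varepsilon>0$, $t\in[0,T]$, $X\in D([0,T],U)$, $A\in\mathrm{CBV}([0,T],S)$ there is $\eta>0$ such that $|F(t,X,A)-F(t,Y,A)|<\varepsilon$ for all $Y\in D([0,T],U)$ with $\|X^t-Y^t\|_\infty<\eta$; - left-continuous if for all $t\in(0,T]$, $\varepsilon>0$, $X\in D([0,T],U)$, $A\in \mathrm{CBV}([0,T],S)$ there is $\eta>0$ such that $|F(t,X,A)-F(t-h,Y,A)|<\varepsilon$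 for all $h\in[0,\eta)$ and $Y\in D([0,T],U)$ with $\|X^t-Y^{t-h}\|_\infty<\eta$. For vector-valued functionals these notions are understood componentwise. Horizontal derivative: $F$ is horizontally differentiable if there are non-anticipative, boundedness-preserving functionals $\mathscr D_0F,\dots,\mathscr D_mF$ on $[0,T]\times D([0,T],U)\times\mathrm{CBV}([0,T],S)$ such that for all $0\le s<t\le T$ and all $(X,A)$ the functions $[s,t]\ni r\mapsto\mathscr D_iF(r,X^s,A)$ are Borel measurable and $F(t,X^s,A)-F(s,X^s,A)=\sum_{i=0}^m\int_s^t\mathscr D_iF(r,X^s,A)\,A_i(dr)$, where $A_0(r):=r$. Then $\mathscr DF=(\mathscr D_0F,\dots,\mathscr D_mF)$ is the horizontal derivative. Vertical derivative: $F$ is vertically differentiable at $(t,X,A)$ if $v\mapsto F(t,X+v\mathbf 1_{[t,T]},A)$ ($v\in\mathbb R^d$ near $0$) is differentiable at $0$; its gradient at $v=0$ is $\nabla_XF(t,X,A)=(\partial_iF(t,X,A))_{i=1,\dots,d}$. Iterating, $\partial_{ij}F:=\partial_i(\partial_jF)$ and $\nabla_X^2F=(\partial_{ij}F)_{i,j}$. $\mathbb C^{1,2}_b(U,S)$ is the set of non-anticipative functionals $F$ such that: (i) $F$ is left-continuous, horizontally differentiable and twice vertically differentiable; (ii) $\mathscr DF$ is continuous at fixed times; (iii) $\nabla_XF$ and $\nabla_X^2F$ are left-continuous and boundedness-preserving. Partitions and quadratic variation: $(\mathbb T_n)_{n\in\mathbb N}$ is a fixed refining sequence of partitions of $[0,T]$: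 each $\mathbb T_n$ is a finite subset of $[0,T]$ containing $0$ and $T$, $\mathbb T_1\subset\mathbb T_2\subset\cdots$, and the mesh tends to $0$. For $t\in\mathbb T_n$, $t'$ is the successor of $t$ in $\mathbb T_n$, i.e. $t'=\min\{u\in\mathbb T_n: u>t\}$ if $t<T$ and $t'=T$ if $t=T$. A real-valued continuous path $X$ admits the continuous quadratic variation $[X]$ along $(\mathbb T_n)$ if for all $t\in(0,T]$ the sums $\sum_{s\in\mathbb T_n,\,s\le t}(X(s')-X(s))^2$ converge to a finite limit $[X](t)$ and $t\mapsto[X](t)$ is continuous with $[X](0):=0$. A path $X\in C([0,T],\mathbb R^d)$, $d>1$, admits the continuous quadratic variation if all $X_i+X_j$, $i,j=1,\dots,d$, do; then $[X_i,X_j]:=\frac12([X_i+X_j]-[X_i]-[X_j])$ and $[X]:=([X_i,X_j])_{i,j}$ (with $[X_i,X_i]=[X_i]$). *)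

theory Defs
  imports "HOL-Analysis.Analysis"
begin

text \<open>
  Paths on \<open>[0,T]\<close> are functions on the reals that are extensional on \<open>{0..T}\<close>, so that the sets
  below correspond one-to-one to the spaces of functions with domain \<open>[0,T]\<close>, and a functional
  cannot depend on values outside \<open>[0,T]\<close>. Functionals are total functions, but every notion
  below constrains them only on \<open>[0,T] \<times> D([0,T],U) \<times> CBV([0,T],S)\<close>.
\<close>

type_synonym ('d, 'm) path_functional =
  "real \<Rightarrow> (real \<Rightarrow> real ^ 'd) \<Rightarrow> (real \<Rightarrow> real ^ 'm) \<Rightarrow> real"


section \<open>Bounded variation and Lebesgue--Stieltjes integrals\<close>

definition variation_sums :: "(real \<Rightarrow> real) \<Rightarrow> real \<Rightarrow> real \<Rightarrow> real set" where
  "variation_sums g a b =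
     {(\<Sum>k<n. \<bar>g (p (Suc k)) - g (p k)\<bar>) | (n::nat) p. mono p \<and> range p \<subseteq> {a..b}}"

definition bounded_variation :: "(real \<Rightarrow> real) \<Rightarrow> real \<Rightarrow> real \<Rightarrow> bool" where
  "bounded_variation g a b \<longleftrightarrow> bdd_above (variation_sums g a b)"

definition variation :: "(real \<Rightarrow> real) \<Rightarrow> real \<Rightarrow> real \<Rightarrow> real" where
  "variation g a b = Sup (variation_sums g a b)"

text \<open>
  Positive and negative variation of \<open>g\<close> on \<open>[a,b]\<close>, extended constantly outside \<open>[a,b]\<close>.
  For continuous \<open>g\<close> of bounded variation they are continuous and nondecreasing on the whole
  line and satisfy \<open>g x - g a = pos_variation g a b x - neg_variation g a b x\<close> on \<open>[a,b]\<close>.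
\<close>

definition pos_variation :: "(real \<Rightarrow> real) \<Rightarrow> real \<Rightarrow> real \<Rightarrow> real \<Rightarrow> real" where
  "pos_variation g a b x =
     (let y = max a (min b x) in (variation g a y + (g y - g a)) / 2)"

definition neg_variation :: "(real \<Rightarrow> real) \<Rightarrow> real \<Rightarrow> real \<Rightarrow> real \<Rightarrow> real" where
  "neg_variation g a b x =
     (let y = max a (min b x) in (variation g a y - (g y - g a)) / 2)"

text \<open>
  Integrability and integral of \<open>f\<close> over \<open>[a,b]\<close> with respect to the signed measure of a
  continuous integrator \<open>g\<close> of bounded variation, through its Jordan decomposition.
\<close>

definition LS_integrable :: "real \<Rightarrow> real \<Rightarrow> (real \<Rightarrow> real) \<Rightarrow> (real \<Rightarrow> real) \<Rightarrow> bool" where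
  "LS_integrable a b f g \<longleftrightarrow>
     continuous_on {a..b} g \<and> bounded_variation g a b \<and>
     set_integrable (interval_measure (pos_variation g a b)) {a..b} f \<and>
     set_integrable (interval_measure (neg_variation g a b)) {a..b} f"

definition LS_integral :: "real \<Rightarrow> real \<Rightarrow> (real \<Rightarrow> real) \<Rightarrow> (real \<Rightarrow> real) \<Rightarrow> real" where
  "LS_integral a b f g =
     (LINT x:{a..b}|interval_measure (pos_variation g a b). f x) -
     (LINT x:{a..b}|interval_measure (neg_variation g a b). f x)"


section \<open>Path spaces\<close>

definition cont_paths :: "real \<Rightarrow> 'a::topological_space set \<Rightarrow> (real \<Rightarrow> 'a) set" where
  "cont_paths T U = {X \<in> {0..T} \<rightarrow>\<^sub>E U. continuous_on {0..T} X}"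

definition cadlag_paths :: "real \<Rightarrow> 'a::topological_space set \<Rightarrow> (real \<Rightarrow> 'a) set" where
  "cadlag_paths T U = {X \<in> {0..T} \<rightarrow>\<^sub>E U.
     (\<forall>t\<in>{0..<T}. (X \<longlongrightarrow> X t) (at_right t)) \<and>
     (\<forall>t\<in>{0<..T}. \<exists>l\<in>U. (X \<longlongrightarrow> l) (at_left t))}"

definition cbv_paths :: "real \<Rightarrow> (real ^ 'm::finite) set \<Rightarrow> (real \<Rightarrow> real ^ 'm::finite) set" where
  "cbv_paths T S = {A \<in> cont_paths T S. \<forall>i. bounded_variation (\<lambda>t. A t $ i) 0 T}"

definition sup_norm :: "real \<Rightarrow> (real \<Rightarrow> 'a::real_normed_vector) \<Rightarrow> real" where
  "sup_norm T X = (SUP u\<in>{0..T}. norm (X u))"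

definition stop :: "real \<Rightarrow> real \<Rightarrow> (real \<Rightarrow> 'a) \<Rightarrow> real \<Rightarrow> 'a" where
  "stop T t X = (\<lambda>s\<in>{0..T}. X (min t s))"

text \<open>The path \<open>X\<^bsup>t-\<^esup>\<close>, used for \<open>t > 0\<close> only.\<close>

definition stop_left :: "real \<Rightarrow> real \<Rightarrow> (real \<Rightarrow> 'a::t2_space) \<Rightarrow> real \<Rightarrow> 'a" where
  "stop_left T t X = (\<lambda>u\<in>{0..T}. if u < t then X u else Lim (at_left t) X)"

text \<open>The vertical perturbation \<open>X + v 1\<^bsub>[t,T]\<^esub>\<close>.\<close>

definition bump :: "real \<Rightarrow> real \<Rightarrow> 'a::real_vector \<Rightarrow> (real \<Rightarrow> 'a) \<Rightarrow> real \<Rightarrow> 'a" where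
  "bump T t v X = (\<lambda>s\<in>{0..T}. X s + indicator {t..T} s *\<^sub>R v)"


section \<open>Non-anticipative functionals\<close>

definition non_anticipative ::
  "real \<Rightarrow> (real ^ 'd::finite) set \<Rightarrow> (real ^ 'm::finite) set \<Rightarrow> ('d::finite, 'm::finite) path_functional \<Rightarrow> bool" where
  "non_anticipative T U S F \<longleftrightarrow>
     (\<forall>t\<in>{0..T}. \<forall>X\<in>cadlag_paths T U. \<forall>A\<in>cbv_paths T S. F t X A = F t (stop T t X) (stop T t A))"

definition boundedness_preserving ::
  "real \<Rightarrow> (real ^ 'd::finite) set \<Rightarrow> (real ^ 'm::finite) set \<Rightarrow> ('d::finite, 'm::finite) path_functional \<Rightarrow> bool" where
  "boundedness_preserving T U S F \<longleftrightarrow> non_anticipative T U S F \<and>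
     (\<forall>A\<in>cbv_paths T S. \<forall>K. compact K \<and> K \<subseteq> U \<longrightarrow>
        (\<exists>C. \<forall>t\<in>{0..T}. \<forall>X\<in>cadlag_paths T K. \<bar>F t X A\<bar> \<le> C))"

definition continuous_at_fixed_times ::
  "real \<Rightarrow> (real ^ 'd::finite) set \<Rightarrow> (real ^ 'm::finite) set \<Rightarrow> ('d::finite, 'm::finite) path_functional \<Rightarrow> bool" where
  "continuous_at_fixed_times T U S F \<longleftrightarrow> non_anticipative T U S F \<and>
     (\<forall>\<epsilon>>0. \<forall>t\<in>{0..T}. \<forall>X\<in>cadlag_paths T U. \<forall>A\<in>cbv_paths T S. \<exists>\<eta>>0. \<forall>Y\<in>cadlag_paths T U.
        sup_norm T (\<lambda>u. stop T t X u - stop T t Y u) < \<eta> \<longrightarrow> \<bar>F t X A - F t Y A\<bar> < \<epsilon>)"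

text \<open>The condition \<open>h \<le> t\<close> keeps \<open>t - h\<close> in the time domain \<open>[0,T]\<close> of the functional.\<close>

definition left_continuous ::
  "real \<Rightarrow> (real ^ 'd::finite) set \<Rightarrow> (real ^ 'm::finite) set \<Rightarrow> ('d::finite, 'm::finite) path_functional \<Rightarrow> bool" where
  "left_continuous T U S F \<longleftrightarrow> non_anticipative T U S F \<and>
     (\<forall>t\<in>{0<..T}. \<forall>\<epsilon>>0. \<forall>X\<in>cadlag_paths T U. \<forall>A\<in>cbv_paths T S. \<exists>\<eta>>0.
        \<forall>h. 0 \<le> h \<and> h < \<eta> \<and> h \<le> t \<longrightarrow> (\<forall>Y\<in>cadlag_paths T U.
          sup_norm T (\<lambda>u. stop T t X u - stop T (t - h) Y u) < \<eta> \<longrightarrow>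
          \<bar>F t X A - F (t - h) Y A\<bar> < \<epsilon>))"


section \<open>Horizontal and vertical derivatives\<close>

text \<open>
  The indices \<open>0,\<dots>,m\<close> are rendered by \<open>'m option\<close>: \<open>None\<close> is the index \<open>0\<close>, with \<open>A\<^sub>0(r) = r\<close>.
\<close>

fun integrator :: "(real \<Rightarrow> real ^ 'm::finite) \<Rightarrow> 'm option \<Rightarrow> real \<Rightarrow> real" where
  "integrator A None r = r"
| "integrator A (Some i) r = A r $ i"

text \<open>
  A functional may have several horizontal derivatives (for instance when a component of \<open>A\<close> is
  itself absolutely continuous, or by changes on null sets of times), hence a relation between
  \<open>F\<close> and the tuple \<open>DF\<close>. The integrands below are measurable by requirement and bounded because
  \<open>DF i\<close> is boundedness-preserving, so the integrals are proper ones.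
\<close>

definition is_horizontal_derivative ::
  "real \<Rightarrow> (real ^ 'd::finite) set \<Rightarrow> (real ^ 'm::finite) set \<Rightarrow> ('d::finite, 'm::finite) path_functional \<Rightarrow>
   ('m option \<Rightarrow> ('d::finite, 'm::finite) path_functional) \<Rightarrow> bool" where
  "is_horizontal_derivative T U S F DF \<longleftrightarrow>
     (\<forall>i. non_anticipative T U S (DF i) \<and> boundedness_preserving T U S (DF i)) \<and>
     (\<forall>s t. \<forall>X\<in>cadlag_paths T U. \<forall>A\<in>cbv_paths T S. 0 \<le> s \<and> s < t \<and> t \<le> T \<longrightarrow>
        (\<forall>i. (\<lambda>r. DF i r (stop T s X) A) \<in> borel_measurable (restrict_space borel {s..t})) \<and>
        F t (stop T s X) A - F s (stop T s X) A =
          (\<Sum>i\<in>UNIV. LS_integral s t (\<lambda>r. DF i r (stop T s X) A) (integrator A i)))"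

definition vertically_differentiable_at ::
  "real \<Rightarrow> ('d::finite, 'm::finite) path_functional \<Rightarrow> real \<Rightarrow> (real \<Rightarrow> real ^ 'd::finite) \<Rightarrow> (real \<Rightarrow> real ^ 'm::finite) \<Rightarrow> bool" where
  "vertically_differentiable_at T F t X A \<longleftrightarrow> (\<lambda>v. F t (bump T t v X) A) differentiable (at 0)"

definition vertically_differentiable ::
  "real \<Rightarrow> (real ^ 'd::finite) set \<Rightarrow> (real ^ 'm::finite) set \<Rightarrow> ('d::finite, 'm::finite) path_functional \<Rightarrow> bool" where
  "vertically_differentiable T U S F \<longleftrightarrow>
     (\<forall>t\<in>{0..T}. \<forall>X\<in>cadlag_paths T U. \<forall>A\<in>cbv_paths T S. vertically_differentiable_at T F t X A)"

definition vpartial :: "real \<Rightarrow> 'd \<Rightarrow> ('d::finite, 'm::finite) path_functional \<Rightarrow> ('d::finite, 'm::finite) path_functional" where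
  "vpartial T i F t X A = frechet_derivative (\<lambda>v. F t (bump T t v X) A) (at 0) (axis i 1)"

definition vgrad ::
  "real \<Rightarrow> ('d::finite, 'm::finite) path_functional \<Rightarrow> real \<Rightarrow> (real \<Rightarrow> real ^ 'd::finite) \<Rightarrow> (real \<Rightarrow> real ^ 'm::finite) \<Rightarrow> real ^ 'd::finite" where
  "vgrad T F t X A = (\<chi> i. vpartial T i F t X A)"

definition twice_vertically_differentiable ::
  "real \<Rightarrow> (real ^ 'd::finite) set \<Rightarrow> (real ^ 'm::finite) set \<Rightarrow> ('d::finite, 'm::finite) path_functional \<Rightarrow> bool" where
  "twice_vertically_differentiable T U S F \<longleftrightarrow>
     vertically_differentiable T U S F \<and> (\<forall>j. vertically_differentiable T U S (vpartial T j F))"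

definition C12b ::
  "real \<Rightarrow> (real ^ 'd::finite) set \<Rightarrow> (real ^ 'm::finite) set \<Rightarrow> ('d::finite, 'm::finite) path_functional set" where
  "C12b T U S = {F. non_anticipative T U S F \<and>
     left_continuous T U S F \<and>
     twice_vertically_differentiable T U S F \<and>
     (\<exists>DF. is_horizontal_derivative T U S F DF \<and> (\<forall>i. continuous_at_fixed_times T U S (DF i))) \<and>
     (\<forall>i. left_continuous T U S (vpartial T i F) \<and> boundedness_preserving T U S (vpartial T i F)) \<and>
     (\<forall>i j. left_continuous T U S (vpartial T i (vpartial T j F)) \<and>
            boundedness_preserving T U S (vpartial T i (vpartial T j F)))}"


section \<open>Partitions, quadratic variation and the pathwise It\^o integral\<close>

definition succ_in :: "real \<Rightarrow> real set \<Rightarrow> real \<Rightarrow> real" where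
  "succ_in T P t = (if t < T then Min {u \<in> P. u > t} else T)"

definition mesh :: "real \<Rightarrow> real set \<Rightarrow> real" where
  "mesh T P = Max ((\<lambda>t. succ_in T P t - t) ` P)"

definition refining_partitions :: "real \<Rightarrow> (nat \<Rightarrow> real set) \<Rightarrow> bool" where
  "refining_partitions T P \<longleftrightarrow>
     (\<forall>n. finite (P n) \<and> P n \<subseteq> {0..T} \<and> 0 \<in> P n \<and> T \<in> P n \<and> P n \<subseteq> P (Suc n)) \<and>
     (\<lambda>n. mesh T (P n)) \<longlonglongrightarrow> 0"

definition qv_sum :: "real \<Rightarrow> real set \<Rightarrow> (real \<Rightarrow> real) \<Rightarrow> real \<Rightarrow> real" where
  "qv_sum T P x t = (\<Sum>s | s \<in> P \<and> s \<le> t. (x (succ_in T P s) - x s)\<^sup>2)"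

definition qv :: "real \<Rightarrow> (nat \<Rightarrow> real set) \<Rightarrow> (real \<Rightarrow> real) \<Rightarrow> real \<Rightarrow> real" where
  "qv T P x t = (if t = 0 then 0 else lim (\<lambda>n. qv_sum T (P n) x t))"

definition admits_continuous_qv :: "real \<Rightarrow> (nat \<Rightarrow> real set) \<Rightarrow> (real \<Rightarrow> real) \<Rightarrow> bool" where
  "admits_continuous_qv T P x \<longleftrightarrow> continuous_on {0..T} x \<and>
     (\<forall>t\<in>{0<..T}. convergent (\<lambda>n. qv_sum T (P n) x t)) \<and>
     continuous_on {0..T} (qv T P x)"

text \<open>
  The pairs \<open>i = j\<close> are included, so that each \<open>2X\<^sub>i\<close>, equivalently each \<open>X\<^sub>i\<close>, admits the
  continuous quadratic variation. In dimension one this is the scalar notion, and on the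
  diagonal \<open>qcov\<close> is \<open>([2X\<^sub>i] - 2[X\<^sub>i]) / 2 = [X\<^sub>i]\<close>.
\<close>

definition admits_continuous_qv_vec :: "real \<Rightarrow> (nat \<Rightarrow> real set) \<Rightarrow> (real \<Rightarrow> real ^ 'd::finite) \<Rightarrow> bool" where
  "admits_continuous_qv_vec T P X \<longleftrightarrow>
     (\<forall>i j. admits_continuous_qv T P (\<lambda>t. X t $ i + X t $ j))"

definition qcov ::
  "real \<Rightarrow> (nat \<Rightarrow> real set) \<Rightarrow> (real \<Rightarrow> real ^ 'd::finite) \<Rightarrow> 'd \<Rightarrow> 'd \<Rightarrow> real \<Rightarrow> real" where
  "qcov T P X i j t =
     (qv T P (\<lambda>u. X u $ i + X u $ j) t - qv T P (\<lambda>u. X u $ i) t - qv T P (\<lambda>u. X u $ j) t) / 2"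

definition approx_path :: "real \<Rightarrow> real set \<Rightarrow> (real \<Rightarrow> 'a::real_vector) \<Rightarrow> real \<Rightarrow> 'a" where
  "approx_path T P X = (\<lambda>t\<in>{0..T}.
     (\<Sum>s\<in>P. indicator {s..<succ_in T P s} t *\<^sub>R X (succ_in T P s)) + indicator {T} t *\<^sub>R X T)"

text \<open>
  The path \<open>X\<^bsup>n,s-\<^esup>\<close>. By convention \<open>X\<^bsup>n,0-\<^esup>\<close> is the constant path with value \<open>X 0\<close>
  (not the value of the approximating path at \<open>0\<close>).
\<close>

definition approx_path_left ::
  "real \<Rightarrow> real set \<Rightarrow> (real \<Rightarrow> 'a::real_normed_vector) \<Rightarrow> real \<Rightarrow> real \<Rightarrow> 'a" where
  "approx_path_left T P X s =
     (if s = 0 then (\<lambda>u\<in>{0..T}. X 0) else stop_left T s (approx_path T P X))"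

definition ito_sum ::
  "real \<Rightarrow> real set \<Rightarrow> ('d::finite, 'm::finite) path_functional \<Rightarrow> (real \<Rightarrow> real ^ 'd::finite) \<Rightarrow> (real \<Rightarrow> real ^ 'm::finite) \<Rightarrow> real" where
  "ito_sum T P F X A =
     (\<Sum>s\<in>P. vgrad T F s (approx_path_left T P X s) A \<bullet> (X (succ_in T P s) - X s))"

definition pathwise_ito_integral ::
  "real \<Rightarrow> (nat \<Rightarrow> real set) \<Rightarrow> ('d::finite, 'm::finite) path_functional \<Rightarrow> (real \<Rightarrow> real ^ 'd::finite) \<Rightarrow>
   (real \<Rightarrow> real ^ 'm::finite) \<Rightarrow> real" where
  "pathwise_ito_integral T P F X A = lim (\<lambda>n. ito_sum T (P n) F X A)"

end

theory Submission
  imports Defs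
begin

text \<open>
  Write \<open>s'\<close> for the successor of a partition point \<open>s\<close>. The path \<open>X\<^bsup>n,s'-\<^esup>\<close> arises from
  \<open>X\<^bsup>n,s-\<^esup>\<close> by the bump \<open>X(s') - X(s)\<close> at \<open>s\<close> and is constant from \<open>s\<close> on
  (\<open>approx_path_left_next\<close>). Therefore \<open>F(T,X\<^bsup>n,T-\<^esup>,A) - F(0,X,A)\<close> telescopes into vertical
  increments, where only the path changes, at the fixed time \<open>s\<close>, and horizontal increments, where
  time runs from \<open>s\<close> to \<open>s'\<close> along a stopped path.

  A vertical increment is the increment of a twice differentiable function of the bump size. Its
  Taylor expansion (\<open>vertical_taylor\<close>) yields the summand of the Ito sum and one half of
  \<open>\<partial>\<^sub>i\<^sub>jF\<close>, taken at an intermediate bump, times the product of the increments of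
  \<open>X\<^sub>i\<close> and \<open>X\<^sub>j\<close>. A horizontal increment is a sum of integrals of horizontal derivatives over
  \<open>[s,s']\<close>. So the Ito sums converge, to the value that the formula asserts, once the horizontal and
  the second-order sums converge to the right integrals, because \<open>F(T,X\<^bsup>n,T-\<^esup>,A)\<close> tends to
  \<open>F(T,X,A)\<close> by left-continuity.

  For the horizontal part (\<open>horizontal_limit\<close>) the integrals over the cells are collected into one
  integral over \<open>[0,T]\<close>, whose integrand converges pointwise by continuity at fixed times and is bounded;
  dominated convergence applies. Collecting them is not immediate, since each integral is
  defined by the Jordan decomposition of the integrator on its own cell. It follows from
  \<open>LS_integral_combination\<close>: every representation by continuous monotone functions computes the
  same integral.

  For the second-order part (\<open>mixed_increment_limit\<close>) polarisation leaves sums of squared increments,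
  that is, integrals against discrete measures that converge weakly to \<open>d[x]\<close>. The integrands
  converge only in the left-sided sense given by left-continuity, at a rate that depends on the
  point, and their limit is only left-continuous, so neither uniform convergence nor continuity of
  the limit is at hand. What saves the argument is that \<open>[x]\<close> is continuous: by a Lindelof argument
  finitely many of the left neighbourhoods carry the limit measure up to \<open>\<epsilon>\<close>
  (\<open>finite_left_interval_cover\<close>), and on these everything is close to a step function, for which
  weak convergence to an atomless measure suffices (\<open>left_uniform_integral_limit\<close>).
\<close>

section \<open>Continuous functions of bounded variation\<close>

lemma variation_sumsI:
  "mono p \<Longrightarrow> range p \<subseteq> {a..b} \<Longrightarrow> (\<Sum>k<n. \<bar>g (p (Suc k)) - g (p k)\<bar>) \<in> variation_sums g a b"
  unfolding variation_sums_def by blast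

lemma variation_sums_mono:
  "a \<le> a' \<Longrightarrow> b' \<le> b \<Longrightarrow> variation_sums g a' b' \<subseteq> variation_sums g a b"
  unfolding variation_sums_def by force

lemma variation_sums_nonempty: "a \<le> b \<Longrightarrow> variation_sums g a b \<noteq> {}"
proof -
  assume "a \<le> b"
  then have "(\<Sum>k<0. \<bar>g ((\<lambda>_. a) (Suc k)) - g ((\<lambda>_. a) k)\<bar>) \<in> variation_sums g a b"
    by (intro variation_sumsI) (auto simp: mono_def)
  then show ?thesis by blast
qed

lemma bounded_variation_subinterval:
  "bounded_variation g a b \<Longrightarrow> a \<le> a' \<Longrightarrow> b' \<le> b \<Longrightarrow> bounded_variation g a' b'"
  unfolding bounded_variation_def by (rule bdd_above_mono[OF _ variation_sums_mono])

lemma variation_upper: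
  "bounded_variation g a b \<Longrightarrow> mono p \<Longrightarrow> range p \<subseteq> {a..b} \<Longrightarrow>
    (\<Sum>k<n. \<bar>g (p (Suc k)) - g (p k)\<bar>) \<le> variation g a b"
  unfolding bounded_variation_def variation_def by (intro cSup_upper variation_sumsI)

lemma variation_least:
  assumes "a \<le> b"
    and "\<And>p n. mono p \<Longrightarrow> range p \<subseteq> {a..b} \<Longrightarrow> (\<Sum>k<n. \<bar>g (p (Suc k)) - g (p k)\<bar>) \<le> C"
  shows "variation g a b \<le> C"
  unfolding variation_def
  by (intro cSup_least variation_sums_nonempty assms(1)) (auto simp: variation_sums_def intro: assms(2))

lemma less_variationE:
  assumes "a \<le> b" "y < variation g a b"
  obtains p n where "mono p" "range p \<subseteq> {a..b}" "y < (\<Sum>k<n. \<bar>g (p (Suc k)) - g (p (k::nat))\<bar>)"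
proof -
  obtain z where "z \<in> variation_sums g a b" "y < z"
    using less_cSupE[OF assms(2)[unfolded variation_def] variation_sums_nonempty[OF assms(1)]] .
  then show thesis unfolding variation_sums_def using that by blast
qed

lemma sum_lessThan_add:
  fixes f :: "nat \<Rightarrow> 'a::comm_monoid_add"
  shows "(\<Sum>k<N + m. f k) = (\<Sum>k<N. f k) + (\<Sum>k<m. f (N + k))"
  by (induction m) (simp_all add: ac_simps)

text \<open>
  Cutting a partition at \<open>c\<close> with \<open>min\<close> and \<open>max\<close> gives one inequality, concatenating a partition of
  each half gives the other.
\<close>

lemma variation_split:
  assumes bv: "bounded_variation g a b" and "a \<le> c" "c \<le> b"
  shows "variation g a b = variation g a c + variation g c b"
proof (rule antisym)
  have bv1: "bounded_variation g a c" and bv2: "bounded_variation g c b"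
    using bounded_variation_subinterval[OF bv] assms by auto
  show "variation g a b \<le> variation g a c + variation g c b"
  proof (rule variation_least)
    show "a \<le> b" using assms by simp
    fix p :: "nat \<Rightarrow> real" and n assume p: "mono p" "range p \<subseteq> {a..b}"
    have "(\<Sum>k<n. \<bar>g (p (Suc k)) - g (p k)\<bar>) \<le>
        (\<Sum>k<n. \<bar>g (min c (p (Suc k))) - g (min c (p k))\<bar> + \<bar>g (max c (p (Suc k))) - g (max c (p k))\<bar>)"
    proof (rule sum_mono)
      fix k
      have "p k \<le> p (Suc k)" using p(1) by (simp add: mono_def)
      then show "\<bar>g (p (Suc k)) - g (p k)\<bar> \<le>
        \<bar>g (min c (p (Suc k))) - g (min c (p k))\<bar> + \<bar>g (max c (p (Suc k))) - g (max c (p k))\<bar>"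
        by (auto simp: min_def max_def)
    qed
    also have "\<dots> = (\<Sum>k<n. \<bar>g (min c (p (Suc k))) - g (min c (p k))\<bar>) +
        (\<Sum>k<n. \<bar>g (max c (p (Suc k))) - g (max c (p k))\<bar>)"
      by (rule sum.distrib)
    also have "(\<Sum>k<n. \<bar>g (min c (p (Suc k))) - g (min c (p k))\<bar>) \<le> variation g a c"
      using p assms by (intro variation_upper[OF bv1, of "\<lambda>k. min c (p k)"])
        (auto simp: mono_def min_def image_subset_iff intro: order_trans)
    also have "(\<Sum>k<n. \<bar>g (max c (p (Suc k))) - g (max c (p k))\<bar>) \<le> variation g c b"
      using p assms by (intro variation_upper[OF bv2, of "\<lambda>k. max c (p k)"])
        (auto simp: mono_def max_def image_subset_iff intro: order_trans)
    finally show "(\<Sum>k<n. \<bar>g (p (Suc k)) - g (p k)\<bar>) \<le> variation g a c + variation g c b" by simp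
  qed
  have "(\<Sum>k<n. \<bar>g (p (Suc k)) - g (p k)\<bar>) + (\<Sum>k<m. \<bar>g (r (Suc k)) - g (r k)\<bar>) \<le> variation g a b"
    if p: "mono p" "range p \<subseteq> {a..c}" and r: "mono r" "range r \<subseteq> {c..b}" for p r n m
  proof -
    define z where "z k = (if k \<le> n then p k else r (k - Suc n))" for k
    have pr: "p i \<le> r j" for i j
    proof -
      have "p i \<in> {a..c}" "r j \<in> {c..b}" using p(2) r(2) by blast+
      then show ?thesis by simp
    qed
    have "mono z"
      unfolding mono_def z_def using p(1) r(1) pr by (auto simp: mono_def)
    moreover have "range z \<subseteq> {a..b}"
    proof (rule image_subsetI)
      fix k
      have "p k \<in> {a..c}" "r (k - Suc n) \<in> {c..b}" using p(2) r(2) by blast+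
      then show "z k \<in> {a..b}" unfolding z_def using assms by auto
    qed
    ultimately have le: "(\<Sum>k<Suc n + m. \<bar>g (z (Suc k)) - g (z k)\<bar>) \<le> variation g a b"
      by (rule variation_upper[OF bv])
    have "(\<Sum>k<Suc n + m. \<bar>g (z (Suc k)) - g (z k)\<bar>) =
       (\<Sum>k<Suc n. \<bar>g (z (Suc k)) - g (z k)\<bar>) + (\<Sum>k<m. \<bar>g (z (Suc (Suc n + k))) - g (z (Suc n + k))\<bar>)"
      by (rule sum_lessThan_add)
    moreover have "(\<Sum>k<m. \<bar>g (z (Suc (Suc n + k))) - g (z (Suc n + k))\<bar>) = (\<Sum>k<m. \<bar>g (r (Suc k)) - g (r k)\<bar>)"
      by (rule sum.cong) (auto simp: z_def)
    moreover have "(\<Sum>k<n. \<bar>g (z (Suc k)) - g (z k)\<bar>) \<le> (\<Sum>k<Suc n. \<bar>g (z (Suc k)) - g (z k)\<bar>)"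
      by simp
    moreover have "(\<Sum>k<n. \<bar>g (z (Suc k)) - g (z k)\<bar>) = (\<Sum>k<n. \<bar>g (p (Suc k)) - g (p k)\<bar>)"
      by (rule sum.cong) (auto simp: z_def)
    ultimately show ?thesis using le by linarith
  qed
  note both = this
  have "variation g a c \<le> variation g a b - variation g c b"
  proof (rule variation_least[OF \<open>a \<le> c\<close>])
    fix p :: "nat \<Rightarrow> real" and n assume p: "mono p" "range p \<subseteq> {a..c}"
    have "variation g c b \<le> variation g a b - (\<Sum>k<n. \<bar>g (p (Suc k)) - g (p k)\<bar>)"
    proof (rule variation_least[OF \<open>c \<le> b\<close>])
      fix r :: "nat \<Rightarrow> real" and m assume r: "mono r" "range r \<subseteq> {c..b}"
      show "(\<Sum>k<m. \<bar>g (r (Suc k)) - g (r k)\<bar>) \<le> variation g a b - (\<Sum>k<n. \<bar>g (p (Suc k)) - g (p k)\<bar>)"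
        using both[OF p r, of n m] by linarith
    qed
    then show "(\<Sum>k<n. \<bar>g (p (Suc k)) - g (p k)\<bar>) \<le> variation g a b - variation g c b"
      by linarith
  qed
  then show "variation g a c + variation g c b \<le> variation g a b" by simp
qed

lemma variation_ge_increment:
  assumes bv: "bounded_variation g a b" and "a \<le> b"
  shows "\<bar>g b - g a\<bar> \<le> variation g a b"
proof -
  define p where "p k = (if k = 0 then a else b)" for k :: nat
  have "(\<Sum>k<1. \<bar>g (p (Suc k)) - g (p k)\<bar>) \<le> variation g a b"
    by (rule variation_upper[OF bv]) (use assms in \<open>auto simp: mono_def p_def\<close>)
  then show ?thesis by (simp add: p_def)
qed

lemma variation_refl: "variation g a a = 0"
proof -
  have "variation_sums g a a = {0}"
  proof
    show "variation_sums g a a \<subseteq> {0}"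
    proof
      fix y assume "y \<in> variation_sums g a a"
      then obtain n :: nat and p where p: "range p \<subseteq> {a..a}" and
        y: "y = (\<Sum>k<n. \<bar>g (p (Suc k)) - g (p k)\<bar>)"
        unfolding variation_sums_def by blast
      have "p k = a" for k using p by (auto simp: image_subset_iff)
      then show "y \<in> {0}" using y by simp
    qed
    then show "{0} \<subseteq> variation_sums g a a" using variation_sums_nonempty[of a a g] by blast
  qed
  then show ?thesis unfolding variation_def by simp
qed

text \<open>
  For continuous \<open>g\<close> a variation sum depends continuously on the endpoint at which its partition
  is cut, so a supremum of such sums is lower semicontinuous in the endpoint. Additivity turns
  lower semicontinuity in one endpoint into upper semicontinuity in the other; the two together
  give continuity.
\<close>


lemma eventually_less_variation_left:
  fixes g :: "real \<Rightarrow> real"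
  assumes cont: "continuous_on {a..b} g" and bv: "bounded_variation g a b"
    and x: "x \<in> {a..b}" and y: "y < variation g a x"
  shows "eventually (\<lambda>u. y < variation g a u) (at x within {a..b})"
proof -
  obtain p n where p: "mono p" "range p \<subseteq> {a..x}" and less: "y < (\<Sum>k<n. \<bar>g (p (Suc k)) - g (p (k::nat))\<bar>)"
    using less_variationE[of a x y g] x y by auto
  have pk: "p k \<in> {a..x}" for k using p(2) by blast
  have "continuous_on {a..b} (\<lambda>u. g (min u (p k)))" for k
    by (rule continuous_on_compose2[OF cont]) (use pk[of k] x in \<open>auto intro!: continuous_intros\<close>)
  then have "continuous_on {a..b} (\<lambda>u. \<Sum>k<n. \<bar>g (min u (p (Suc k))) - g (min u (p k))\<bar>)"
    by (intro continuous_intros)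
  then have "((\<lambda>u. \<Sum>k<n. \<bar>g (min u (p (Suc k))) - g (min u (p k))\<bar>) \<longlongrightarrow>
      (\<Sum>k<n. \<bar>g (min x (p (Suc k))) - g (min x (p k))\<bar>)) (at x within {a..b})"
    using x by (simp add: continuous_on_def)
  moreover have "(\<Sum>k<n. \<bar>g (min x (p (Suc k))) - g (min x (p k))\<bar>) = (\<Sum>k<n. \<bar>g (p (Suc k)) - g (p k)\<bar>)"
    using pk by (intro sum.cong) (auto simp: min_absorb2)
  ultimately have "eventually (\<lambda>u. y < (\<Sum>k<n. \<bar>g (min u (p (Suc k))) - g (min u (p k))\<bar>)) (at x within {a..b})"
    using less by (simp add: order_tendsto_iff)
  moreover have "eventually (\<lambda>u. u \<in> {a..b}) (at x within {a..b})"
    by (simp add: eventually_at_filter)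
  ultimately show ?thesis
  proof eventually_elim
    case (elim u)
    have "(\<Sum>k<n. \<bar>g (min u (p (Suc k))) - g (min u (p k))\<bar>) \<le> variation g a u"
      using p pk elim(2)
      by (intro variation_upper[OF bounded_variation_subinterval[OF bv], of _ _ "\<lambda>k. min u (p k)"])
        (auto simp: mono_def min_def image_subset_iff intro: order_trans)
    with elim show ?case by simp
  qed
qed

lemma eventually_less_variation_right:
  fixes g :: "real \<Rightarrow> real"
  assumes cont: "continuous_on {a..b} g" and bv: "bounded_variation g a b"
    and x: "x \<in> {a..b}" and y: "y < variation g x b"
  shows "eventually (\<lambda>u. y < variation g u b) (at x within {a..b})"
proof -
  obtain p n where p: "mono p" "range p \<subseteq> {x..b}" and less: "y < (\<Sum>k<n. \<bar>g (p (Suc k)) - g (p (k::nat))\<bar>)"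
    using less_variationE[of x b y g] x y by auto
  have pk: "p k \<in> {x..b}" for k using p(2) by blast
  have "continuous_on {a..b} (\<lambda>u. g (max u (p k)))" for k
    by (rule continuous_on_compose2[OF cont]) (use pk[of k] x in \<open>auto intro!: continuous_intros\<close>)
  then have "continuous_on {a..b} (\<lambda>u. \<Sum>k<n. \<bar>g (max u (p (Suc k))) - g (max u (p k))\<bar>)"
    by (intro continuous_intros)
  then have "((\<lambda>u. \<Sum>k<n. \<bar>g (max u (p (Suc k))) - g (max u (p k))\<bar>) \<longlongrightarrow>
      (\<Sum>k<n. \<bar>g (max x (p (Suc k))) - g (max x (p k))\<bar>)) (at x within {a..b})"
    using x by (simp add: continuous_on_def)
  moreover have "(\<Sum>k<n. \<bar>g (max x (p (Suc k))) - g (max x (p k))\<bar>) = (\<Sum>k<n. \<bar>g (p (Suc k)) - g (p k)\<bar>)"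
    using pk by (intro sum.cong) (auto simp: max_absorb2)
  ultimately have "eventually (\<lambda>u. y < (\<Sum>k<n. \<bar>g (max u (p (Suc k))) - g (max u (p k))\<bar>)) (at x within {a..b})"
    using less by (simp add: order_tendsto_iff)
  moreover have "eventually (\<lambda>u. u \<in> {a..b}) (at x within {a..b})"
    by (simp add: eventually_at_filter)
  ultimately show ?thesis
  proof eventually_elim
    case (elim u)
    have "(\<Sum>k<n. \<bar>g (max u (p (Suc k))) - g (max u (p k))\<bar>) \<le> variation g u b"
      using p pk elim(2)
      by (intro variation_upper[OF bounded_variation_subinterval[OF bv], of _ _ "\<lambda>k. max u (p k)"])
        (auto simp: mono_def max_def image_subset_iff intro: order_trans)
    with elim show ?case by simp
  qed
qed

lemma continuous_on_variation:
  assumes cont: "continuous_on {a..b} g" and bv: "bounded_variation g a b"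
  shows "continuous_on {a..b} (variation g a)"
  unfolding continuous_on_def
proof (intro ballI order_tendstoI)
  fix x y assume x: "x \<in> {a..b}"
  show "eventually (\<lambda>u. y < variation g a u) (at x within {a..b})" if "y < variation g a x"
    by (rule eventually_less_variation_left[OF cont bv x that])
  assume y: "variation g a x < y"
  have split: "variation g a b = variation g a u + variation g u b" if "u \<in> {a..b}" for u
    using variation_split[OF bv, of u] that by simp
  have "variation g a b - y < variation g x b" using split[OF x] y by linarith
  from eventually_less_variation_right[OF cont bv x this]
  have "eventually (\<lambda>u. variation g a b - y < variation g u b) (at x within {a..b})" .
  moreover have "eventually (\<lambda>u. u \<in> {a..b}) (at x within {a..b})"
    by (simp add: eventually_at_filter)
  ultimately show "eventually (\<lambda>u. variation g a u < y) (at x within {a..b})"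
  proof eventually_elim
    case (elim u) then show ?case using split[of u] by linarith
  qed
qed

lemma variation_increment_bound:
  assumes bv: "bounded_variation g a b" and "a \<le> x" "x \<le> y" "y \<le> b"
  shows "\<bar>g y - g x\<bar> \<le> variation g a y - variation g a x"
proof -
  have "variation g a y = variation g a x + variation g x y"
    by (rule variation_split[OF bounded_variation_subinterval[OF bv]]) (use assms in auto)
  moreover have "\<bar>g y - g x\<bar> \<le> variation g x y"
    by (rule variation_ge_increment[OF bounded_variation_subinterval[OF bv]]) (use assms in auto)
  ultimately show ?thesis by simp
qed

lemma clip_continuous:
  fixes a b :: real
  assumes "a \<le> b" "continuous_on {a..b} h"
  shows "continuous_on UNIV (\<lambda>x. h (max a (min b x)))"
  by (rule continuous_on_compose2[OF assms(2)]) (use assms(1) in \<open>auto intro!: continuous_intros\<close>)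

lemma
  assumes "a \<le> b" and cont: "continuous_on {a..b} g" and bv: "bounded_variation g a b"
  shows mono_pos_variation: "mono (pos_variation g a b)"
    and mono_neg_variation: "mono (neg_variation g a b)"
    and continuous_pos_variation: "continuous_on UNIV (pos_variation g a b)"
    and continuous_neg_variation: "continuous_on UNIV (neg_variation g a b)"
proof -
  have *: "\<bar>g (max a (min b y)) - g (max a (min b x))\<bar> \<le>
      variation g a (max a (min b y)) - variation g a (max a (min b x))" if "x \<le> y" for x y
    by (rule variation_increment_bound[OF bv]) (use that \<open>a \<le> b\<close> in auto)
  show "mono (pos_variation g a b)"
    unfolding pos_variation_def Let_def
  proof (rule monoI)
    fix x y :: real assume "x \<le> y"
    from *[OF this] show
      "(variation g a (max a (min b x)) + (g (max a (min b x)) - g a)) / 2 \<le>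
       (variation g a (max a (min b y)) + (g (max a (min b y)) - g a)) / 2"
      by (auto simp: abs_le_iff)
  qed
  show "mono (neg_variation g a b)"
    unfolding neg_variation_def Let_def
  proof (rule monoI)
    fix x y :: real assume "x \<le> y"
    from *[OF this] show
      "(variation g a (max a (min b x)) - (g (max a (min b x)) - g a)) / 2 \<le>
       (variation g a (max a (min b y)) - (g (max a (min b y)) - g a)) / 2"
      by (auto simp: abs_le_iff)
  qed
  have "continuous_on {a..b} (\<lambda>y. (variation g a y + (g y - g a)) / 2)"
    "continuous_on {a..b} (\<lambda>y. (variation g a y - (g y - g a)) / 2)"
    using cont continuous_on_variation[OF cont bv] by (auto intro!: continuous_intros)
  from this[THEN clip_continuous[OF \<open>a \<le> b\<close>]]
  show "continuous_on UNIV (pos_variation g a b)" "continuous_on UNIV (neg_variation g a b)"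
    unfolding pos_variation_def neg_variation_def Let_def by simp_all
qed

lemma jordan_decomposition:
  "x \<in> {a..b} \<Longrightarrow> g x - g a = pos_variation g a b x - neg_variation g a b x"
  unfolding pos_variation_def neg_variation_def Let_def by (simp add: field_simps)

lemma pos_neg_variation_start [simp]:
  "a \<le> b \<Longrightarrow> pos_variation g a b a = 0" "a \<le> b \<Longrightarrow> neg_variation g a b a = 0"
  unfolding pos_variation_def neg_variation_def Let_def by (simp_all add: variation_refl)

lemma bounded_variation_combination:
  assumes "finite J" and mono: "\<And>j. j \<in> J \<Longrightarrow> mono (p j)"
    and g: "\<And>x. x \<in> {a..b} \<Longrightarrow> g x - g a = (\<Sum>j\<in>J. e j * (p j x - p j a))"
  shows "bounded_variation g a b"
  unfolding bounded_variation_def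
proof (rule bdd_aboveI)
  fix y assume "y \<in> variation_sums g a b"
  then obtain n :: nat and r where r: "mono r" "range r \<subseteq> {a..b}" and
    y: "y = (\<Sum>k<n. \<bar>g (r (Suc k)) - g (r k)\<bar>)"
    unfolding variation_sums_def by blast
  have "\<bar>g (r (Suc k)) - g (r k)\<bar> \<le> (\<Sum>j\<in>J. \<bar>e j\<bar> * (p j (r (Suc k)) - p j (r k)))" for k
  proof -
    have rk: "r i \<in> {a..b}" for i using r(2) by blast
    have "g (r (Suc k)) - g (r k) = (g (r (Suc k)) - g a) - (g (r k) - g a)" by simp
    also have "\<dots> = (\<Sum>j\<in>J. e j * (p j (r (Suc k)) - p j (r k)))"
      unfolding g[OF rk] sum_subtractf[symmetric] by (simp add: algebra_simps)
    also have "\<bar>\<dots>\<bar> \<le> (\<Sum>j\<in>J. \<bar>e j * (p j (r (Suc k)) - p j (r k))\<bar>)" by (rule sum_abs)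
    also have "\<dots> = (\<Sum>j\<in>J. \<bar>e j\<bar> * (p j (r (Suc k)) - p j (r k)))"
    proof (rule sum.cong)
      fix j assume "j \<in> J"
      have "p j (r k) \<le> p j (r (Suc k))"
        using mono[OF \<open>j \<in> J\<close>] r(1) by (simp add: mono_def)
      then show "\<bar>e j * (p j (r (Suc k)) - p j (r k))\<bar> = \<bar>e j\<bar> * (p j (r (Suc k)) - p j (r k))"
        by (simp add: abs_mult)
    qed simp
    finally show ?thesis .
  qed
  then have "y \<le> (\<Sum>k<n. \<Sum>j\<in>J. \<bar>e j\<bar> * (p j (r (Suc k)) - p j (r k)))"
    unfolding y by (intro sum_mono)
  also have "\<dots> = (\<Sum>j\<in>J. \<bar>e j\<bar> * (p j (r n) - p j (r 0)))"
    by (subst sum.swap) (simp add: sum_distrib_left[symmetric] sum_lessThan_telescope[where f = "\<lambda>i. p _ (r i)"])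
  also have "\<dots> \<le> (\<Sum>j\<in>J. \<bar>e j\<bar> * (p j b - p j a))"
    using mono r(2) by (intro sum_mono mult_left_mono diff_mono) (auto simp: mono_def image_subset_iff)
  finally show "y \<le> (\<Sum>j\<in>J. \<bar>e j\<bar> * (p j b - p j a))" .
qed

section \<open>Integration against combinations of monotone functions\<close>

context
  fixes F :: "real \<Rightarrow> real"
  assumes mono: "mono F" and cont: "continuous_on UNIV F"
begin

lemma emeasure_interval_measure_mono_Icc:
  "a \<le> b \<Longrightarrow> emeasure (interval_measure F) {a..b} = ennreal (F b - F a)"
  using mono cont by (intro emeasure_interval_measure_Icc) (auto simp: mono_def)

lemma measure_interval_measure_mono_Icc:
  "a \<le> b \<Longrightarrow> measure (interval_measure F) {a..b} = F b - F a"
  using mono by (simp add: measure_def emeasure_interval_measure_mono_Icc mono_def)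

lemma emeasure_interval_measure_mono_Ioc:
  assumes "a \<le> b"
  shows "emeasure (interval_measure F) {a<..b} = ennreal (F b - F a)"
proof (rule emeasure_interval_measure_Ioc[OF assms])
  show "F x \<le> F y" if "x \<le> y" for x y using mono that by (rule monoD)
  show "continuous (at_right x) F" for x
    using cont by (simp add: continuous_on_eq_continuous_within continuous_at_imp_continuous_at_within)
qed

lemma measure_interval_measure_mono_Ioc:
  "a \<le> b \<Longrightarrow> measure (interval_measure F) {a<..b} = F b - F a"
  using mono by (simp add: measure_def emeasure_interval_measure_mono_Ioc mono_def)

lemma emeasure_interval_measure_singleton: "emeasure (interval_measure F) {c} = 0"
  using emeasure_interval_measure_mono_Icc[of c c] by simp

lemma AE_interval_measure_neq: "AE x in interval_measure F. x \<noteq> c"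
proof (rule AE_I)
  show "{x \<in> space (interval_measure F). \<not> x \<noteq> c} \<subseteq> {c}" by auto
  show "emeasure (interval_measure F) {c} = 0" by (rule emeasure_interval_measure_singleton)
qed simp

lemma integrable_interval_measure_bounded:
  fixes f :: "real \<Rightarrow> real"
  assumes f: "f \<in> borel_measurable borel" and bd: "\<And>x. x \<in> {a..b} \<Longrightarrow> \<bar>f x\<bar> \<le> C"
  shows "integrable (interval_measure F) (\<lambda>x. indicator {a..b} x * f x)"
proof (cases "a \<le> b")
  case True
  show ?thesis
  proof (rule Bochner_Integration.integrable_bound[where f = "\<lambda>x. indicator {a..b} x * C"])
    show "integrable (interval_measure F) (\<lambda>x. indicator {a..b} x * C)"
      using emeasure_interval_measure_mono_Icc[OF True] by (intro integrable_mult_left integrable_real_indicator) auto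
    show "(\<lambda>x. indicator {a..b} x * f x) \<in> borel_measurable (interval_measure F)"
      using f by simp
    show "AE x in interval_measure F. norm (indicator {a..b} x * f x) \<le> norm (indicator {a..b} x * C)"
      using bd by (intro AE_I2) (force simp: indicator_def)
  qed
qed simp

end

lemma indicator_mult_measurable:
  fixes f :: "real \<Rightarrow> real"
  assumes "f \<in> borel_measurable (restrict_space borel {a..b})"
  shows "(\<lambda>x. indicator {a..b} x * f x) \<in> borel_measurable borel"
  using assms by (simp add: borel_measurable_restrict_space_iff)

text \<open>
  A linear relation between distribution functions passes to Stieltjes integrals: the relation
  says that the corresponding signed combination of measures vanishes on the half-lines cut down
  to \<open>[a,b]\<close>, hence on all Borel sets by Dynkin's lemma, hence on all integrable functions by
  monotone approximation.
\<close>

lemma interval_measure_combination_measure_zero: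
  assumes "finite I" and mono: "\<And>i. i \<in> I \<Longrightarrow> mono (F i)" and cont: "\<And>i. i \<in> I \<Longrightarrow> continuous_on UNIV (F i)"
    and zero: "\<And>x. x \<in> {a..b} \<Longrightarrow> (\<Sum>i\<in>I. c i * (F i x - F i a)) = 0"
    and "a \<le> b" and B: "B \<in> sets borel"
  shows "(\<Sum>i\<in>I. c i * measure (interval_measure (F i)) (B \<inter> {a..b})) = 0"
proof -
  have fin: "emeasure (interval_measure (F i)) (B \<inter> {a..b}) \<noteq> \<infinity>" if "i \<in> I" for i B
  proof -
    have "emeasure (interval_measure (F i)) (B \<inter> {a..b}) \<le> emeasure (interval_measure (F i)) {a..b}"
      by (rule emeasure_mono) auto
    also have "\<dots> < \<infinity>"
      using emeasure_interval_measure_mono_Icc[OF mono cont \<open>a \<le> b\<close>] that by simp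
    finally show ?thesis by simp
  qed
  have whole: "(\<Sum>i\<in>I. c i * measure (interval_measure (F i)) {a..b}) = 0"
    using zero[of b] \<open>a \<le> b\<close> measure_interval_measure_mono_Icc[OF mono cont] by (simp cong: sum.cong)
  have st: "Int_stable (range (\<lambda>x::real. {..x}))"
    by (auto simp: Int_stable_def)
  have B': "B \<in> sigma_sets UNIV (range (\<lambda>x. {..x}))"
    using B by (simp add: borel_eq_atMost)
  have sub: "range (\<lambda>x::real. {..x}) \<subseteq> Pow UNIV" by simp
  show ?thesis
    using st sub B'
  proof (induction rule: sigma_sets_induct_disjoint)
    case (basic A)
    then obtain x where A: "A = {..x}" by auto
    show ?case
    proof (cases "x < a")
      case True then have "A \<inter> {a..b} = {}" using A by auto
      then show ?thesis by simp
    next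
      case False
      then have "A \<inter> {a..b} = {a..min x b}" using A by auto
      then have "(\<Sum>i\<in>I. c i * measure (interval_measure (F i)) (A \<inter> {a..b})) =
          (\<Sum>i\<in>I. c i * (F i (min x b) - F i a))"
        using False \<open>a \<le> b\<close> measure_interval_measure_mono_Icc[OF mono cont] by (simp cong: sum.cong)
      then show ?thesis using zero[of "min x b"] False \<open>a \<le> b\<close> by simp
    qed
  next
    case empty then show ?case by simp
  next
    case (compl A)
    have A: "A \<in> sets borel" using compl(1) by (simp add: borel_eq_atMost)
    have "measure (interval_measure (F i)) ((UNIV - A) \<inter> {a..b}) =
        measure (interval_measure (F i)) {a..b} - measure (interval_measure (F i)) (A \<inter> {a..b})" if "i \<in> I" for i
    proof -
      have "(UNIV - A) \<inter> {a..b} = {a..b} - A \<inter> {a..b}" by auto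
      moreover have "measure (interval_measure (F i)) ({a..b} - A \<inter> {a..b}) =
          measure (interval_measure (F i)) {a..b} - measure (interval_measure (F i)) (A \<inter> {a..b})"
        using fin[OF that, of UNIV] A by (intro measure_Diff) auto
      ultimately show ?thesis by simp
    qed
    then have "(\<Sum>i\<in>I. c i * measure (interval_measure (F i)) ((UNIV - A) \<inter> {a..b})) =
       (\<Sum>i\<in>I. c i * measure (interval_measure (F i)) {a..b}) - (\<Sum>i\<in>I. c i * measure (interval_measure (F i)) (A \<inter> {a..b}))"
      unfolding sum_subtractf[symmetric] right_diff_distrib[symmetric] by (intro sum.cong) simp_all
    then show ?case using compl.IH whole by simp
  next
    case (union A)
    have A: "A k \<in> sets borel" for k using union(2) by (auto simp: borel_eq_atMost)
    have "(\<lambda>k. measure (interval_measure (F i)) (A k \<inter> {a..b})) sums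
        measure (interval_measure (F i)) (\<Union>k. A k \<inter> {a..b})" if "i \<in> I" for i
    proof (rule measure_UNION)
      show "range (\<lambda>k. A k \<inter> {a..b}) \<subseteq> sets (interval_measure (F i))" using A by auto
      show "disjoint_family (\<lambda>k. A k \<inter> {a..b})" using union(1) by (auto simp: disjoint_family_on_def)
      show "emeasure (interval_measure (F i)) (\<Union>k. A k \<inter> {a..b}) \<noteq> \<infinity>"
        using fin[OF that, of "\<Union>k. A k"] by simp
    qed
    then have "(\<lambda>k. \<Sum>i\<in>I. c i * measure (interval_measure (F i)) (A k \<inter> {a..b})) sums
        (\<Sum>i\<in>I. c i * measure (interval_measure (F i)) (\<Union>k. A k \<inter> {a..b}))"
      by (intro sums_sum sums_mult) auto
    then have "(\<lambda>k. 0) sums (\<Sum>i\<in>I. c i * measure (interval_measure (F i)) (\<Union>k. A k \<inter> {a..b}))"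
      using union.IH by simp
    then show ?case using sums_unique2[OF _ sums_zero] by (simp add: Int_UN_distrib2) blast
  qed
qed

lemma interval_measure_combination_integral_zero_nonneg:
  fixes f :: "real \<Rightarrow> real"
  assumes I: "finite I" and mono: "\<And>i. i \<in> I \<Longrightarrow> mono (F i)" and cont: "\<And>i. i \<in> I \<Longrightarrow> continuous_on UNIV (F i)"
    and zero: "\<And>x. x \<in> {a..b} \<Longrightarrow> (\<Sum>i\<in>I. c i * (F i x - F i a)) = 0"
    and "a \<le> b" and f: "f \<in> borel_measurable borel" "\<And>x. 0 \<le> f x"
    and int: "\<And>i. i \<in> I \<Longrightarrow> integrable (interval_measure (F i)) (\<lambda>x. indicator {a..b} x * f x)"
  shows "(\<Sum>i\<in>I. c i * (\<integral>x. indicator {a..b} x * f x \<partial>interval_measure (F i))) = 0"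
  using f int
proof (induction rule: borel_measurable_induct_real)
  case (set A)
  have "(\<integral>x. indicator {a..b} x * indicator A x \<partial>interval_measure (F i)) =
      measure (interval_measure (F i)) (A \<inter> {a..b})" for i
    using set(1) by (simp add: indicator_inter_arith[symmetric] Int_commute)
  then show ?case
    using interval_measure_combination_measure_zero[OF I mono cont zero \<open>a \<le> b\<close>] set(1) by simp
next
  case (mult u k)
  show ?case
  proof (cases "k = 0")
    case False
    have "integrable (interval_measure (F i)) (\<lambda>x. indicator {a..b} x * u x)" if "i \<in> I" for i
      using mult.prems[OF that] False by (simp add: mult.left_commute[of _ k])
    from mult.IH[OF this] have "k * (\<Sum>i\<in>I. c i * (\<integral>x. indicator {a..b} x * u x \<partial>interval_measure (F i))) = 0"
      by simp
    then show ?thesis by (simp add: mult.left_commute[of _ k] sum_distrib_left)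
  qed simp
next
  case (add u v)
  have iu: "integrable (interval_measure (F i)) (\<lambda>x. indicator {a..b} x * u x)"
    and iv: "integrable (interval_measure (F i)) (\<lambda>x. indicator {a..b} x * v x)" if "i \<in> I" for i
    by (rule Bochner_Integration.integrable_bound[OF add.prems[OF that]];
        use add in \<open>auto simp: indicator_def add_nonneg_nonneg\<close>)+
  have "(\<Sum>i\<in>I. c i * (\<integral>x. indicator {a..b} x * (v x + u x) \<partial>interval_measure (F i))) =
     (\<Sum>i\<in>I. c i * (\<integral>x. indicator {a..b} x * v x \<partial>interval_measure (F i))) +
     (\<Sum>i\<in>I. c i * (\<integral>x. indicator {a..b} x * u x \<partial>interval_measure (F i)))"
    using iu iv by (simp add: distrib_left sum.distrib[symmetric] cong: sum.cong)
  then show ?case using add.IH(1)[OF iu] add.IH(2)[OF iv] by simp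
next
  case (seq V)
  have le: "V k x \<le> f x" for k x
    using seq by (intro incseq_le[of "\<lambda>k. V k x"]) (auto simp: incseq_def le_fun_def)
  have iV: "integrable (interval_measure (F i)) (\<lambda>x. indicator {a..b} x * V k x)" if "i \<in> I" for i k
    by (rule Bochner_Integration.integrable_bound[OF seq.prems[OF that]])
      (use seq le f in \<open>auto simp: indicator_def\<close>)
  have "(\<lambda>k. \<integral>x. indicator {a..b} x * V k x \<partial>interval_measure (F i)) \<longlonglongrightarrow>
      (\<integral>x. indicator {a..b} x * f x \<partial>interval_measure (F i))" if "i \<in> I" for i
    by (rule integral_dominated_convergence[OF _ _ seq.prems[OF that]])
      (use seq le f in \<open>auto simp: indicator_def\<close>)
  then have "(\<lambda>k. \<Sum>i\<in>I. c i * (\<integral>x. indicator {a..b} x * V k x \<partial>interval_measure (F i))) \<longlonglongrightarrow>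
      (\<Sum>i\<in>I. c i * (\<integral>x. indicator {a..b} x * f x \<partial>interval_measure (F i)))"
    by (intro tendsto_sum tendsto_mult tendsto_const) auto
  moreover have "(\<Sum>i\<in>I. c i * (\<integral>x. indicator {a..b} x * V k x \<partial>interval_measure (F i))) = 0" for k
    using seq.IH[of k] iV by blast
  ultimately show ?case by (simp add: LIMSEQ_const_iff)
qed

lemma interval_measure_combination_integral_zero:
  fixes f :: "real \<Rightarrow> real"
  assumes I: "finite I" and mono: "\<And>i. i \<in> I \<Longrightarrow> mono (F i)" and cont: "\<And>i. i \<in> I \<Longrightarrow> continuous_on UNIV (F i)"
    and zero: "\<And>x. x \<in> {a..b} \<Longrightarrow> (\<Sum>i\<in>I. c i * (F i x - F i a)) = 0"
    and "a \<le> b" and f: "f \<in> borel_measurable borel" and bd: "\<And>x. x \<in> {a..b} \<Longrightarrow> \<bar>f x\<bar> \<le> C"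
  shows "(\<Sum>i\<in>I. c i * (\<integral>x. indicator {a..b} x * f x \<partial>interval_measure (F i))) = 0"
proof -
  define fp fn where "fp x = max 0 (f x)" and "fn x = max 0 (- f x)" for x
  have m: "fp \<in> borel_measurable borel" "fn \<in> borel_measurable borel"
    unfolding fp_def fn_def using f by measurable
  have int: "integrable (interval_measure (F i)) (\<lambda>x. indicator {a..b} x * fp x)"
    "integrable (interval_measure (F i)) (\<lambda>x. indicator {a..b} x * fn x)" if "i \<in> I" for i
    by (rule integrable_interval_measure_bounded[OF mono[OF that] cont[OF that] m(1), of _ _ C]
        integrable_interval_measure_bounded[OF mono[OF that] cont[OF that] m(2), of _ _ C];
        use bd in \<open>force simp: fp_def fn_def abs_le_iff\<close>)+
  have "(\<integral>x. indicator {a..b} x * f x \<partial>interval_measure (F i)) =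
     (\<integral>x. indicator {a..b} x * fp x \<partial>interval_measure (F i)) - (\<integral>x. indicator {a..b} x * fn x \<partial>interval_measure (F i))"
    if "i \<in> I" for i
    unfolding Bochner_Integration.integral_diff[OF int[OF that], symmetric]
    by (rule Bochner_Integration.integral_cong) (auto simp: fp_def fn_def indicator_def)
  then have "(\<Sum>i\<in>I. c i * (\<integral>x. indicator {a..b} x * f x \<partial>interval_measure (F i))) =
     (\<Sum>i\<in>I. c i * (\<integral>x. indicator {a..b} x * fp x \<partial>interval_measure (F i))) -
     (\<Sum>i\<in>I. c i * (\<integral>x. indicator {a..b} x * fn x \<partial>interval_measure (F i)))"
    by (simp add: sum_subtractf[symmetric] right_diff_distrib cong: sum.cong)
  also have "\<dots> = 0 - 0"
    by (intro arg_cong2[of _ _ _ _ "(-)"] interval_measure_combination_integral_zero_nonneg[OF I mono cont zero \<open>a \<le> b\<close>] m int)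
      (auto simp: fp_def fn_def)
  finally show ?thesis by simp
qed

text \<open>
  The Lebesgue--Stieltjes integral may be computed from any representation of the integrator by
  continuous monotone functions, not only from its Jordan decomposition. This gives additivity in
  the interval (keep the decomposition on the large interval) and linearity in the integrator.
\<close>

lemma LS_integral_combination:
  fixes f g :: "real \<Rightarrow> real"
  assumes "a \<le> b" and J: "finite J"
    and mono: "\<And>j. j \<in> J \<Longrightarrow> mono (p j)" and cont: "\<And>j. j \<in> J \<Longrightarrow> continuous_on UNIV (p j)"
    and g: "\<And>x. x \<in> {a..b} \<Longrightarrow> g x - g a = (\<Sum>j\<in>J. e j * (p j x - p j a))"
    and f: "f \<in> borel_measurable (restrict_space borel {a..b})"
    and bd: "\<And>x. x \<in> {a..b} \<Longrightarrow> \<bar>f x\<bar> \<le> C"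
  shows "LS_integrable a b f g"
    and "LS_integral a b f g = (\<Sum>j\<in>J. e j * (\<integral>x. indicator {a..b} x * f x \<partial>interval_measure (p j)))"
proof -
  have "continuous_on {a..b} (\<lambda>x. g a + (\<Sum>j\<in>J. e j * (p j x - p j a)))"
    using cont by (intro continuous_intros) (auto intro: continuous_on_subset)
  then have cg: "continuous_on {a..b} g"
    by (rule continuous_on_eq) (simp add: g[symmetric])
  have bv: "bounded_variation g a b"
    by (rule bounded_variation_combination[OF J mono g])
  note PM = mono_pos_variation[OF \<open>a \<le> b\<close> cg bv] mono_neg_variation[OF \<open>a \<le> b\<close> cg bv]
    continuous_pos_variation[OF \<open>a \<le> b\<close> cg bv] continuous_neg_variation[OF \<open>a \<le> b\<close> cg bv]
  let ?f = "\<lambda>x. indicator {a..b} x * f x"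
  have m: "?f \<in> borel_measurable borel" by (rule indicator_mult_measurable[OF f])
  have bd': "\<bar>?f x\<bar> \<le> C" if "x \<in> {a..b}" for x using bd that by simp
  have idem: "indicator {a..b} x * ?f x = ?f x" for x by (simp add: indicator_def)
  show "LS_integrable a b f g"
    unfolding LS_integrable_def set_integrable_def
    using cg bv integrable_interval_measure_bounded[OF PM(1,3) m bd', of a b]
      integrable_interval_measure_bounded[OF PM(2,4) m bd', of a b] by (simp add: idem)
  define F :: "bool + 'a \<Rightarrow> real \<Rightarrow> real" where
    "F i = (case i of Inl s \<Rightarrow> if s then pos_variation g a b else neg_variation g a b | Inr j \<Rightarrow> p j)" for i
  define c :: "bool + 'a \<Rightarrow> real" where
    "c i = (case i of Inl s \<Rightarrow> if s then 1 else - 1 | Inr j \<Rightarrow> - e j)" for i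
  have sumF: "(\<Sum>i\<in>UNIV <+> J. c i * h (F i)) =
      h (pos_variation g a b) - h (neg_variation g a b) - (\<Sum>j\<in>J. e j * h (p j))" for h :: "(real \<Rightarrow> real) \<Rightarrow> real"
    using J by (simp add: sum.Plus UNIV_bool F_def c_def sum_negf)
  have "(\<Sum>i\<in>UNIV <+> J. c i * (\<integral>x. indicator {a..b} x * ?f x \<partial>interval_measure (F i))) = 0"
  proof (rule interval_measure_combination_integral_zero[OF _ _ _ _ \<open>a \<le> b\<close> m bd'])
    show "finite (UNIV <+> J :: (bool + 'a) set)" using J by simp
    show "mono (F i)" "continuous_on UNIV (F i)" if "i \<in> UNIV <+> J" for i
      using that mono cont PM by (auto simp: F_def)
    show "(\<Sum>i\<in>UNIV <+> J. c i * (F i x - F i a)) = 0" if "x \<in> {a..b}" for x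
      using sumF[of "\<lambda>u. u x - u a"] g[OF that] jordan_decomposition[OF that, of g] \<open>a \<le> b\<close> by simp
  qed
  then show "LS_integral a b f g = (\<Sum>j\<in>J. e j * (\<integral>x. indicator {a..b} x * f x \<partial>interval_measure (p j)))"
    using sumF[of "\<lambda>u. \<integral>x. ?f x \<partial>interval_measure u"]
    by (simp add: idem LS_integral_def set_lebesgue_integral_def)
qed

section \<open>Weak convergence against left-uniformly convergent integrands\<close>

text \<open>
  Half-open intervals \<open>(l s, s]\<close> attached to the points of \<open>(0,T]\<close> need not have a finite subcover,
  but finitely many of them cover up to small mass of an atomless measure: by Lindelof countably
  many of the open intervals \<open>(l s, s)\<close> have the same union as all of them, and a point \<open>r\<close> that this
  union misses is the right end of an interval \<open>(l r, r)\<close> disjoint from those of the other missed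
  points, so only countably many points are missed.
\<close>

lemma finite_left_interval_cover:
  fixes l :: "real \<Rightarrow> real"
  assumes sets: "sets M = sets borel" and null: "\<And>x. emeasure M {x} = 0"
    and fin: "emeasure M {0<..T} \<noteq> \<infinity>" and "0 < T"
    and l: "\<And>s. s \<in> {0<..T} \<Longrightarrow> l s < s" and "0 < \<delta>"
  obtains J where "finite J" "J \<subseteq> {0<..T}" "measure M ({0<..T} - (\<Union>s\<in>J. {l s<..s})) < \<delta>"
proof -
  let ?I = "\<lambda>s. {l s<..<s}"
  obtain F where F: "F \<subseteq> ?I ` {0<..T}" "countable F" "\<Union>F = (\<Union>s\<in>{0<..T}. ?I s)"
    using Lindelof[of "?I ` {0<..T}"] by (metis (no_types, lifting) imageE open_greaterThanLessThan)
  obtain C where C: "C \<subseteq> {0<..T}" "countable C" "F = ?I ` C"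
    using countable_subset_image[of F ?I "{0<..T}"] F by blast
  define R where "R = {0<..T} - (\<Union>s\<in>{0<..T}. ?I s)"
  have disj: "r \<le> l r'" if "r \<in> R" "r' \<in> R" "r < r'" for r r'
    using that unfolding R_def by force
  have inj: "inj_on ?I R"
  proof (rule inj_onI, rule ccontr)
    fix r r' assume r: "r \<in> R" "r' \<in> R" "?I r = ?I r'" "r \<noteq> r'"
    have "l r < r" "l r' < r'" using r l unfolding R_def by auto
    then obtain x where "x \<in> ?I r" using dense[of "l r" r] by auto
    then have "x \<in> ?I r'" using r(3) by simp
    then show False using \<open>x \<in> ?I r\<close> disj[OF r(1,2)] disj[OF r(2,1)] r(4) by force
  qed
  have "countable (?I ` R)"
  proof (rule countable_disjoint_open_subsets)
    show "disjoint (?I ` R)"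
    proof (rule pairwise_imageI)
      fix r r' assume "r \<in> R" "r' \<in> R" "r \<noteq> r'"
      then show "disjnt (?I r) (?I r')"
        using disj[of r r'] disj[of r' r] by (cases "r < r'") (auto simp: disjnt_iff)
    qed
  qed auto
  then have R: "countable R" using inj by (rule countable_image_inj_on)
  have "(\<Union>r\<in>R. {r}) \<in> null_sets M"
    using R null sets by (intro null_sets_UN') (auto simp: null_sets_def)
  then have R0: "R \<in> null_sets M" by simp
  have "C \<noteq> {}"
  proof
    assume "C = {}"
    then have "(\<Union>s\<in>{0<..T}. ?I s) = {}" using F C by simp
    moreover have "?I T \<noteq> {}" using l[of T] \<open>0 < T\<close> by simp
    ultimately show False using \<open>0 < T\<close> by auto
  qed
  define e where "e = from_nat_into C"
  have e: "range e = C" unfolding e_def by (rule range_from_nat_into[OF \<open>C \<noteq> {}\<close> C(2)])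
  define D where "D k = {0<..T} - (\<Union>i<k. {l (e i)<..e i})" for k
  have "(\<lambda>k. measure M (D k)) \<longlonglongrightarrow> measure M (\<Inter>k. D k)"
  proof (rule Lim_measure_decseq)
    show "range D \<subseteq> sets M" unfolding D_def sets by auto
    show "decseq D" unfolding D_def decseq_def by force
    have "emeasure M (D k) \<le> emeasure M {0<..T}" for k
      unfolding D_def by (rule emeasure_mono) (auto simp: sets)
    then show "emeasure M (D k) \<noteq> \<infinity>" for k using fin by (metis infinity_ennreal_def neq_top_trans)
  qed
  moreover have "(\<Inter>k. D k) \<subseteq> R"
  proof
    fix x assume x: "x \<in> (\<Inter>k. D k)"
    have "x \<notin> ?I (e i)" for i
    proof -
      have "x \<in> D (Suc i)" using x by blast
      then show ?thesis unfolding D_def by auto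
    qed
    then have "x \<notin> (\<Union>s\<in>C. ?I s)" using e by blast
    moreover have "(\<Union>s\<in>C. ?I s) = (\<Union>s\<in>{0<..T}. ?I s)" using F(3) C(3) by simp
    ultimately have "x \<notin> (\<Union>s\<in>{0<..T}. ?I s)" by (simp only: not_False_eq_True)
    moreover have "x \<in> {0<..T}" using x unfolding D_def by auto
    ultimately show "x \<in> R" unfolding R_def by (rule DiffI[rotated])
  qed
  then have "measure M (\<Inter>k. D k) = 0"
    using R0 emeasure_mono[of "\<Inter>k. D k" R M] by (simp add: measure_def null_sets_def)
  ultimately have "eventually (\<lambda>k. measure M (D k) < \<delta>) sequentially"
    using \<open>0 < \<delta>\<close> by (metis order_tendstoD(2))
  then obtain k where "measure M (D k) < \<delta>" by (auto simp: eventually_sequentially)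
  moreover have "D k = {0<..T} - (\<Union>s\<in>e ` {..<k}. {l s<..s})" unfolding D_def by simp
  ultimately show thesis using that[of "e ` {..<k}"] e C(1) by auto
qed

text \<open>
  Discrete measures with weights \<open>w n\<close> on \<open>P n\<close>, converging weakly to the atomless measure with
  distribution function \<open>q\<close>, and integrands \<open>c n\<close> on \<open>P n\<close> that approach \<open>\<phi> s\<close> uniformly in left
  neighbourhoods of each \<open>s\<close>, with no uniformity in \<open>s\<close>.
\<close>

locale left_uniform_weak_limit =
  fixes T B :: real and P :: "nat \<Rightarrow> real set" and w c :: "nat \<Rightarrow> real \<Rightarrow> real" and q \<phi> :: "real \<Rightarrow> real"
  assumes T: "0 < T" and P: "\<And>n. finite (P n)" "\<And>n. P n \<subseteq> {0..T}" "\<And>n. 0 \<in> P n"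
    and dense_left: "\<And>s \<eta>. s \<in> {0<..T} \<Longrightarrow> 0 < \<eta> \<Longrightarrow>
      eventually (\<lambda>n. \<exists>t\<in>P n. s - \<eta> < t \<and> t \<le> s) sequentially"
    and w: "\<And>n s. s \<in> P n \<Longrightarrow> 0 \<le> w n s"
    and q: "mono q" "continuous_on UNIV q" "q 0 = 0"
    and w_lim: "\<And>t. t \<in> {0..T} \<Longrightarrow> (\<lambda>n. \<Sum>s | s \<in> P n \<and> s \<le> t. w n s) \<longlonglongrightarrow> q t"
    and c: "eventually (\<lambda>n. \<forall>s\<in>P n. \<bar>c n s\<bar> \<le> B) sequentially"
    and \<phi>: "\<And>s. s \<in> {0<..T} \<Longrightarrow> \<bar>\<phi> s\<bar> \<le> B"
    and left_uniform: "\<And>s \<epsilon>. s \<in> {0<..T} \<Longrightarrow> 0 < \<epsilon> \<Longrightarrow>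
      \<exists>\<eta>>0. eventually (\<lambda>n. \<forall>t\<in>P n. s - \<eta> < t \<and> t \<le> s \<longrightarrow> \<bar>c n t - \<phi> s\<bar> < \<epsilon>) sequentially"
begin

abbreviation "M \<equiv> interval_measure q"

lemmas emeasure_Ioc = emeasure_interval_measure_mono_Ioc[OF q(1,2)]
  and measure_Ioc = measure_interval_measure_mono_Ioc[OF q(1,2)]

lemma B_nonneg: "0 \<le> B"
  using \<phi>[of T] T by force

lemma integrable_Ioc:
  fixes f :: "real \<Rightarrow> real"
  assumes "f \<in> borel_measurable borel" "\<And>x. x \<in> {a<..b} \<Longrightarrow> \<bar>f x\<bar> \<le> K"
  shows "integrable M (\<lambda>x. indicator {a<..b} x * f x)"
proof -
  have "integrable M (\<lambda>x. indicator {a..b} x * (indicator {a<..b} x * f x))"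
    by (rule integrable_interval_measure_bounded[OF q(1,2), of _ _ _ "\<bar>K\<bar>"])
      (use assms in \<open>force simp: indicator_def\<close>)+
  moreover have "(\<lambda>x. indicator {a..b} x * (indicator {a<..b} x * f x)) = (\<lambda>x. indicator {a<..b} x * f x)"
    by (auto simp: indicator_def fun_eq_iff)
  ultimately show ?thesis by simp
qed

text \<open>
  The test functions for which the discrete integrals over all subintervals converge. They include
  the step functions on half-open intervals, because the distribution functions converge at every
  point.
\<close>

definition weak_test :: "(real \<Rightarrow> real) \<Rightarrow> bool" where
  "weak_test \<psi> \<longleftrightarrow> \<psi> \<in> borel_measurable borel \<and> (\<exists>K. \<forall>x. \<bar>\<psi> x\<bar> \<le> K) \<and>
     (\<forall>a b. 0 \<le> a \<and> a \<le> b \<and> b \<le> T \<longrightarrow>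
        (\<lambda>n. \<Sum>s\<in>P n. indicator {a<..b} s * \<psi> s * w n s) \<longlonglongrightarrow> (\<integral>x. indicator {a<..b} x * \<psi> x \<partial>M))"

lemma weak_testD:
  assumes "weak_test \<psi>" "0 \<le> a" "a \<le> b" "b \<le> T"
  shows "(\<lambda>n. \<Sum>s\<in>P n. indicator {a<..b} s * \<psi> s * w n s) \<longlonglongrightarrow> (\<integral>x. indicator {a<..b} x * \<psi> x \<partial>M)"
  using assms unfolding weak_test_def by blast

lemma weak_test_integrable: "weak_test \<psi> \<Longrightarrow> integrable M (\<lambda>x. indicator {a<..b} x * \<psi> x)"
  unfolding weak_test_def using integrable_Ioc by blast

lemma weak_test_1: "weak_test (\<lambda>_. 1)"
  unfolding weak_test_def
proof (intro conjI allI impI)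
  fix a b assume ab: "0 \<le> a \<and> a \<le> b \<and> b \<le> T"
  have "(\<Sum>s\<in>P n. indicator {a<..b} s * 1 * w n s) =
      (\<Sum>s | s \<in> P n \<and> s \<le> b. w n s) - (\<Sum>s | s \<in> P n \<and> s \<le> a. w n s)" for n
  proof -
    have "(\<Sum>s\<in>P n. indicator {a<..b} s * 1 * w n s) = (\<Sum>s\<in>P n. indicator {..b} s * w n s - indicator {..a} s * w n s)"
      using ab by (intro sum.cong) (auto simp: indicator_def)
    also have "\<dots> = (\<Sum>s\<in>P n. if s \<le> b then w n s else 0) - (\<Sum>s\<in>P n. if s \<le> a then w n s else 0)"
      unfolding sum_subtractf by (intro arg_cong2[of _ _ _ _ "(-)"] sum.cong) (auto simp: indicator_def)
    also have "\<dots> = (\<Sum>s | s \<in> P n \<and> s \<le> b. w n s) - (\<Sum>s | s \<in> P n \<and> s \<le> a. w n s)"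
      unfolding sum.inter_filter[OF P(1)] by simp
    finally show ?thesis .
  qed
  moreover have "(\<lambda>n. (\<Sum>s | s \<in> P n \<and> s \<le> b. w n s) - (\<Sum>s | s \<in> P n \<and> s \<le> a. w n s)) \<longlonglongrightarrow> q b - q a"
    using ab by (intro tendsto_diff w_lim) auto
  ultimately show "(\<lambda>n. \<Sum>s\<in>P n. indicator {a<..b} s * 1 * w n s) \<longlonglongrightarrow> (\<integral>x. indicator {a<..b} x * 1 \<partial>M)"
    using measure_Ioc ab by simp
qed auto

lemma weak_test_cmult: "weak_test \<psi> \<Longrightarrow> weak_test (\<lambda>x. k * \<psi> x)"
proof -
  assume \<psi>: "weak_test \<psi>"
  then obtain K where K: "\<And>x. \<bar>\<psi> x\<bar> \<le> K" unfolding weak_test_def by blast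
  have "\<bar>k * \<psi> x\<bar> \<le> \<bar>k\<bar> * K" for x using K by (simp add: abs_mult mult_left_mono)
  moreover have "(\<lambda>n. \<Sum>s\<in>P n. indicator {a<..b} s * (k * \<psi> s) * w n s) \<longlonglongrightarrow> (\<integral>x. indicator {a<..b} x * (k * \<psi> x) \<partial>M)"
    if "0 \<le> a \<and> a \<le> b \<and> b \<le> T" for a b
  proof -
    have "(\<lambda>n. k * (\<Sum>s\<in>P n. indicator {a<..b} s * \<psi> s * w n s)) \<longlonglongrightarrow> k * (\<integral>x. indicator {a<..b} x * \<psi> x \<partial>M)"
      using that by (intro tendsto_mult_left weak_testD[OF \<psi>]) auto
    then show ?thesis by (simp add: sum_distrib_left mult.left_commute[of _ k] mult.assoc)
  qed
  ultimately show ?thesis using \<psi> unfolding weak_test_def by auto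
qed

lemma weak_test_add: "weak_test \<psi> \<Longrightarrow> weak_test \<xi> \<Longrightarrow> weak_test (\<lambda>x. \<psi> x + \<xi> x)"
proof -
  assume \<psi>: "weak_test \<psi>" and \<xi>: "weak_test \<xi>"
  then obtain K L where K: "\<And>x. \<bar>\<psi> x\<bar> \<le> K" "\<And>x. \<bar>\<xi> x\<bar> \<le> L" unfolding weak_test_def by blast
  have "\<bar>\<psi> x + \<xi> x\<bar> \<le> K + L" for x using K[of x] by linarith
  moreover have "(\<lambda>n. \<Sum>s\<in>P n. indicator {a<..b} s * (\<psi> s + \<xi> s) * w n s) \<longlonglongrightarrow> (\<integral>x. indicator {a<..b} x * (\<psi> x + \<xi> x) \<partial>M)"
    if "0 \<le> a \<and> a \<le> b \<and> b \<le> T" for a b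
  proof -
    have "(\<lambda>n. (\<Sum>s\<in>P n. indicator {a<..b} s * \<psi> s * w n s) + (\<Sum>s\<in>P n. indicator {a<..b} s * \<xi> s * w n s))
        \<longlonglongrightarrow> (\<integral>x. indicator {a<..b} x * \<psi> x \<partial>M) + (\<integral>x. indicator {a<..b} x * \<xi> x \<partial>M)"
      using that by (intro tendsto_add weak_testD[OF \<psi>] weak_testD[OF \<xi>]) auto
    then show ?thesis
      using weak_test_integrable[OF \<psi>] weak_test_integrable[OF \<xi>]
      by (simp add: sum.distrib distrib_left distrib_right)
  qed
  ultimately show ?thesis using \<psi> \<xi> unfolding weak_test_def by auto
qed

lemma weak_test_mult_Ioc: "weak_test \<psi> \<Longrightarrow> weak_test (\<lambda>x. indicator {u<..v} x * \<psi> x)"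
proof -
  assume \<psi>: "weak_test \<psi>"
  then obtain K where K: "\<And>x. \<bar>\<psi> x\<bar> \<le> K" unfolding weak_test_def by blast
  have "\<bar>indicator {u<..v} x * \<psi> x\<bar> \<le> K" for x
    using K[of x] order_trans[OF abs_ge_zero K[of x]] by (simp add: indicator_def)
  moreover have "(\<lambda>n. \<Sum>s\<in>P n. indicator {a<..b} s * (indicator {u<..v} s * \<psi> s) * w n s) \<longlonglongrightarrow>
      (\<integral>x. indicator {a<..b} x * (indicator {u<..v} x * \<psi> x) \<partial>M)"
    if "0 \<le> a \<and> a \<le> b \<and> b \<le> T" for a b
  proof -
    have *: "indicator {a<..b} s * (indicator {u<..v} s * \<psi> s) = indicator {max a u<..min b v} s * \<psi> s" for s
      by (auto simp: indicator_def)
    show ?thesis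
    proof (cases "max a u \<le> min b v")
      case True
      show ?thesis unfolding * by (rule weak_testD[OF \<psi> _ True]) (use that in auto)
    next
      case False
      then have empty: "{max a u<..min b v} = {}" by auto
      show ?thesis unfolding * empty by simp
    qed
  qed
  ultimately show ?thesis using \<psi> unfolding weak_test_def by auto
qed

text \<open>
  Later intervals overwrite earlier ones, so on overlaps the test function takes one of the
  eligible values instead of their sum.
\<close>

lemma weak_test_selection:
  assumes "finite J"
  shows "\<exists>\<psi>. weak_test \<psi> \<and> (\<forall>x\<in>(\<Union>s\<in>J. {l s<..s}). \<exists>s\<in>J. x \<in> {l s<..s} \<and> \<psi> x = v s) \<and>
    (\<forall>x. x \<notin> (\<Union>s\<in>J. {l s<..s}) \<longrightarrow> \<psi> x = (0::real))"
  using assms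
proof (induction J)
  case empty
  have "weak_test (\<lambda>x. 0)" using weak_test_cmult[OF weak_test_1, of 0] by simp
  then show ?case by auto
next
  case (insert r J)
  then obtain \<psi> where \<psi>: "weak_test \<psi>" "\<forall>x\<in>(\<Union>s\<in>J. {l s<..s}). \<exists>s\<in>J. x \<in> {l s<..s} \<and> \<psi> x = v s"
    "\<forall>x. x \<notin> (\<Union>s\<in>J. {l s<..s}) \<longrightarrow> \<psi> x = 0" by blast
  define \<xi> where "\<xi> x = (\<psi> x + - 1 * (indicator {l r<..r} x * \<psi> x)) + v r * (indicator {l r<..r} x * 1)" for x
  have "weak_test \<xi>"
    unfolding \<xi>_def by (intro weak_test_add weak_test_cmult weak_test_mult_Ioc weak_test_1 \<psi>(1))
  moreover have \<xi>: "\<xi> x = (if x \<in> {l r<..r} then v r else \<psi> x)" for x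
    unfolding \<xi>_def by simp
  moreover have "\<exists>s\<in>insert r J. x \<in> {l s<..s} \<and> \<xi> x = v s" if "x \<in> (\<Union>s\<in>insert r J. {l s<..s})" for x
  proof (cases "x \<in> {l r<..r}")
    case False
    then have "x \<in> (\<Union>s\<in>J. {l s<..s})" using that by auto
    then obtain s where "s \<in> J" "x \<in> {l s<..s}" "\<psi> x = v s" using \<psi>(2) by blast
    then show ?thesis unfolding \<xi> using False by auto
  qed (simp add: \<xi>)
  moreover have "\<xi> x = 0" if "x \<notin> (\<Union>s\<in>insert r J. {l s<..s})" for x
    using that \<psi>(3) unfolding \<xi> by auto
  ultimately show ?case by blast
qed

text \<open>
  \<open>\<phi>\<close> is the pointwise limit of the step functions that take the value of \<open>c n\<close> at the last point of
  \<open>P n\<close> to the left.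
\<close>

lemma limit_integrand_measurable: "\<phi> \<in> borel_measurable (restrict_space borel {0..T})"
proof -
  define A where "A n t = {x. t \<le> x \<and> (\<forall>u\<in>P n. t < u \<longrightarrow> x < u)}" for n t
  have A: "A n t \<in> sets borel" for n t
  proof -
    have "A n t = {t..} \<inter> (\<Inter>u\<in>{u \<in> P n. t < u}. {..<u})"
      unfolding A_def by auto
    also have "\<dots> \<in> sets borel"
      using P(1)[of n] by (cases "{u \<in> P n. t < u} = {}") (auto intro!: sets.finite_INT simp del: INT_simps)
    finally show ?thesis .
  qed
  define g where "g n x = (\<Sum>t\<in>P n. indicator (A n t) x * c n t)" for n x
  have gm: "g n \<in> borel_measurable borel" for n
    unfolding g_def using A by (intro borel_measurable_sum borel_measurable_times borel_measurable_indicator) auto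
  have last: "\<exists>t\<in>P n. g n x = c n t \<and> t \<le> x \<and> (\<forall>u\<in>P n. u \<le> x \<longrightarrow> u \<le> t)" if "x \<in> {0<..T}" for n x
  proof -
    define t where "t = Max {u \<in> P n. u \<le> x}"
    have ne: "finite {u \<in> P n. u \<le> x}" "{u \<in> P n. u \<le> x} \<noteq> {}" using P[of n] that by auto
    have t: "t \<in> P n" "t \<le> x" using Max_in[OF ne] unfolding t_def by auto
    have t_max: "u \<le> t" if "u \<in> P n" "u \<le> x" for u using Max_ge[OF ne(1)] that unfolding t_def by auto
    have "indicator (A n s) x = (if s = t then 1 else 0 :: real)" if "s \<in> P n" for s
      using t t_max that unfolding A_def indicator_def by (force simp: not_le)
    then have "g n x = (\<Sum>s\<in>P n. if s = t then c n s else 0)"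
      unfolding g_def by (intro sum.cong) auto
    then have "g n x = c n t" using P(1)[of n] t(1) by simp
    then show ?thesis using t t_max by blast
  qed
  have "(\<lambda>n. indicator {0<..T} x * g n x) \<longlonglongrightarrow> indicator {0<..T} x * \<phi> x" for x
  proof (cases "x \<in> {0<..T}")
    case True
    have "(\<lambda>n. g n x) \<longlonglongrightarrow> \<phi> x"
    proof (rule LIMSEQ_I)
      fix \<epsilon> :: real assume "0 < \<epsilon>"
      then obtain \<eta> where \<eta>: "\<eta> > 0"
        "eventually (\<lambda>n. \<forall>t\<in>P n. x - \<eta> < t \<and> t \<le> x \<longrightarrow> \<bar>c n t - \<phi> x\<bar> < \<epsilon>) sequentially"
        using left_uniform[OF True] by blast
      have "eventually (\<lambda>n. \<bar>g n x - \<phi> x\<bar> < \<epsilon>) sequentially"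
        using \<eta>(2) dense_left[OF True \<eta>(1)]
      proof eventually_elim
        case (elim n)
        obtain t where t: "t \<in> P n" "g n x = c n t" "t \<le> x" "\<forall>u\<in>P n. u \<le> x \<longrightarrow> u \<le> t"
          using last[OF True] by blast
        obtain u where "u \<in> P n" "x - \<eta> < u" "u \<le> x" using elim(2) by blast
        then have "x - \<eta> < t" using t(4) by force
        then show ?case using elim(1) t by simp
      qed
      then show "\<exists>N. \<forall>n\<ge>N. norm (g n x - \<phi> x) < \<epsilon>" by (simp add: eventually_sequentially)
    qed
    then show ?thesis by (intro tendsto_mult_left)
  qed simp
  then have "(\<lambda>x. indicator {0<..T} x * \<phi> x) \<in> borel_measurable borel"
  proof (rule borel_measurable_LIMSEQ_real)
    show "(\<lambda>x. indicator {0<..T} x * g n x) \<in> borel_measurable borel" for n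
      using gm[of n] by simp
  qed
  then have "(\<lambda>x. indicator {0<..T} x * \<phi> x + indicator {0} x * \<phi> 0) \<in> borel_measurable borel" by simp
  also have "(\<lambda>x. indicator {0<..T} x * \<phi> x + indicator {0} x * \<phi> 0) = (\<lambda>x. indicator {0..T} x * \<phi> x)"
    using T by (auto simp: indicator_def fun_eq_iff)
  finally show ?thesis by (simp add: borel_measurable_restrict_space_iff)
qed

text \<open>
  Left-uniform convergence holds with error \<open>\<epsilon>\<close> on \<open>(l s, s]\<close> for finitely many \<open>s\<close>, which leave out
  little mass of the limit measure and therefore, in the limit, of the discrete measures. On these
  intervals both \<open>c n\<close> and \<open>\<phi>\<close> are close to a single step function, whose integrals converge.
\<close>

theorem left_uniform_integral_limit:
  "(\<lambda>n. \<Sum>s\<in>P n. c n s * w n s) \<longlonglongrightarrow> (\<integral>x. indicator {0..T} x * \<phi> x \<partial>M)"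
proof -
  define L where "L = (\<integral>x. indicator {0<..T} x * \<phi> x \<partial>M)"
  have qT: "0 \<le> q T" using q T by (metis less_imp_le monoD)
  have m: "(\<lambda>x. indicator {0<..T} x * \<phi> x) \<in> borel_measurable borel"
  proof -
    have "(\<lambda>x. indicator {0..T} x * \<phi> x) \<in> borel_measurable borel"
      using limit_integrand_measurable by (simp add: borel_measurable_restrict_space_iff)
    then have "(\<lambda>x. indicator {0<..T} x * (indicator {0..T} x * \<phi> x)) \<in> borel_measurable borel" by simp
    also have "(\<lambda>x. indicator {0<..T} x * (indicator {0..T} x * \<phi> x)) = (\<lambda>x. indicator {0<..T} x * \<phi> x)"
      by (auto simp: indicator_def)
    finally show ?thesis .
  qed
  have int\<phi>: "integrable M (\<lambda>x. indicator {0<..T} x * \<phi> x)"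
  proof -
    have "integrable M (\<lambda>x. indicator {0<..T} x * (indicator {0<..T} x * \<phi> x))"
      by (rule integrable_Ioc[OF m, of _ _ B]) (use \<phi> in auto)
    moreover have "(\<lambda>x. indicator {0<..T} x * (indicator {0<..T} x * \<phi> x)) = (\<lambda>x. indicator {0<..T} x * \<phi> x)"
      by (auto simp: indicator_def)
    ultimately show ?thesis by metis
  qed
  have "(\<integral>x. indicator {0..T} x * \<phi> x \<partial>M) = L"
    unfolding L_def
  proof (rule integral_cong_AE)
    have "AE x in M. x \<noteq> 0" by (rule AE_interval_measure_neq[OF q(1,2)])
    then show "AE x in M. indicator {0..T} x * \<phi> x = indicator {0<..T} x * \<phi> x"
      by eventually_elim (auto simp: indicator_def)
    show "(\<lambda>x. indicator {0..T} x * \<phi> x) \<in> borel_measurable M"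
      using limit_integrand_measurable by (simp add: borel_measurable_restrict_space_iff)
  qed (use m in simp)
  moreover have "(\<lambda>n. \<Sum>s\<in>P n. c n s * w n s) \<longlonglongrightarrow> L"
  proof (rule tendstoI)
    fix \<epsilon>' :: real assume "0 < \<epsilon>'"
    \<comment> \<open>The final estimate adds up to this multiple of \<open>\<epsilon>\<close>.\<close>
    define \<epsilon> where "\<epsilon> = \<epsilon>' / (3 * q T + 2 * B + 4)"
    have pos: "0 < 3 * q T + 2 * B + 4" using qT B_nonneg by simp
    have \<epsilon>: "0 < \<epsilon>" and \<epsilon>': "(3 * q T + 2 * B + 4) * \<epsilon> = \<epsilon>'"
      unfolding \<epsilon>_def using \<open>0 < \<epsilon>'\<close> pos by auto
    have "\<forall>s\<in>{0<..T}. \<exists>\<eta>>0. eventually (\<lambda>n. \<forall>t\<in>P n. s - \<eta> < t \<and> t \<le> s \<longrightarrow> \<bar>c n t - \<phi> s\<bar> < \<epsilon>) sequentially"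
      using left_uniform \<epsilon> by blast
    from bchoice[OF this] obtain \<eta> where \<eta>: "\<And>s. s \<in> {0<..T} \<Longrightarrow> \<eta> s > 0"
      "\<And>s. s \<in> {0<..T} \<Longrightarrow> eventually (\<lambda>n. \<forall>t\<in>P n. s - \<eta> s < t \<and> t \<le> s \<longrightarrow> \<bar>c n t - \<phi> s\<bar> < \<epsilon>) sequentially"
      by blast
    \<comment> \<open>The cut at \<open>0\<close> keeps the cover inside \<open>(0,T]\<close>, where \<open>\<phi>\<close> is controlled.\<close>
    define l where "l s = max 0 (s - \<eta> s)" for s
    have l: "l s < s" "s - \<eta> s \<le> l s" if "s \<in> {0<..T}" for s using \<eta>(1)[OF that] that unfolding l_def by auto
    have "emeasure M {0<..T} \<noteq> \<infinity>" using emeasure_Ioc[of 0 T] T by simp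
    then obtain J where J: "finite J" "J \<subseteq> {0<..T}" "measure M ({0<..T} - (\<Union>s\<in>J. {l s<..s})) < \<epsilon>"
      using finite_left_interval_cover[OF sets_interval_measure emeasure_interval_measure_singleton[OF q(1,2)] _ T, of l \<epsilon>] l(1) \<epsilon> by blast
    let ?V = "\<Union>s\<in>J. {l s<..s}"
    obtain \<psi> where \<psi>: "weak_test \<psi>" "\<And>x. x \<in> ?V \<Longrightarrow> \<exists>s\<in>J. x \<in> {l s<..s} \<and> \<psi> x = \<phi> s" "\<And>x. x \<notin> ?V \<Longrightarrow> \<psi> x = 0"
      using weak_test_selection[OF J(1), of l \<phi>] by blast
    obtain \<xi> where \<xi>: "weak_test \<xi>" "\<And>x. x \<in> ?V \<Longrightarrow> \<exists>s\<in>J. x \<in> {l s<..s} \<and> \<xi> x = 1" "\<And>x. x \<notin> ?V \<Longrightarrow> \<xi> x = 0"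
      using weak_test_selection[OF J(1), of l "\<lambda>_. 1"] by blast
    define \<zeta> where "\<zeta> x = 1 + (- 1) * \<xi> x" for x
    have \<zeta>: "weak_test \<zeta>" unfolding \<zeta>_def by (intro weak_test_add weak_test_cmult weak_test_1 \<xi>(1))
    have \<zeta>_ind: "\<zeta> x = indicator (- ?V) x" for x
      unfolding \<zeta>_def using \<xi>(2,3)[of x] by (auto simp: indicator_def)
    have int\<zeta>: "(\<integral>x. indicator {0<..T} x * \<zeta> x \<partial>M) < \<epsilon>"
    proof -
      have "(\<lambda>x. indicator {0<..T} x * \<zeta> x) = indicator ({0<..T} - ?V)"
        unfolding \<zeta>_ind by (auto simp: indicator_def fun_eq_iff)
      then show ?thesis using J(3) by simp
    qed
    have near: "eventually (\<lambda>n. \<forall>s\<in>J. \<forall>t\<in>P n. t \<in> {l s<..s} \<longrightarrow> \<bar>c n t - \<phi> s\<bar> < \<epsilon>) sequentially"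
    proof (rule eventually_ball_finite[OF J(1)], intro ballI)
      fix s assume "s \<in> J"
      then have s: "s \<in> {0<..T}" using J(2) by auto
      show "eventually (\<lambda>n. \<forall>t\<in>P n. t \<in> {l s<..s} \<longrightarrow> \<bar>c n t - \<phi> s\<bar> < \<epsilon>) sequentially"
        using \<eta>(2)[OF s] l(2)[OF s] by (auto elim!: eventually_mono)
    qed
    \<comment> \<open>Any partition point just left of \<open>x\<close> lies in \<open>(l s, s]\<close> as well; there \<open>c n\<close> is close to both values.\<close>
    have \<phi>_near: "\<bar>\<phi> x - \<phi> s\<bar> \<le> 2 * \<epsilon>" if "s \<in> J" "x \<in> {l s<..s}" for x s
    proof -
      have "0 \<le> l s" unfolding l_def by simp
      then have x: "x \<in> {0<..T}" using that J(2) by force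
      obtain \<theta> where \<theta>: "\<theta> > 0" "eventually (\<lambda>n. \<forall>t\<in>P n. x - \<theta> < t \<and> t \<le> x \<longrightarrow> \<bar>c n t - \<phi> x\<bar> < \<epsilon>) sequentially"
        using left_uniform[OF x \<epsilon>] by blast
      have "0 < min \<theta> (x - l s)" using \<theta>(1) that by auto
      from dense_left[OF x this] \<theta>(2) near
      have "eventually (\<lambda>n. \<bar>\<phi> x - \<phi> s\<bar> \<le> 2 * \<epsilon>) sequentially"
      proof eventually_elim
        case (elim n)
        then obtain t where t: "t \<in> P n" "x - min \<theta> (x - l s) < t" "t \<le> x" by blast
        have "\<bar>c n t - \<phi> x\<bar> < \<epsilon>" using elim(2) t by auto
        moreover have "\<bar>c n t - \<phi> s\<bar> < \<epsilon>" using elim(3) t that by auto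
        ultimately show ?case by linarith
      qed
      then show ?thesis by simp
    qed
    \<comment> \<open>Off the chosen intervals \<open>\<psi>\<close> vanishes, and \<open>\<zeta>\<close> indicates their complement, of mass below \<open>\<epsilon>\<close>.\<close>
    have c\<psi>: "eventually (\<lambda>n. \<forall>s\<in>P n. \<bar>c n s - \<psi> s\<bar> \<le> \<epsilon> + B * \<zeta> s) sequentially"
      using near c
    proof eventually_elim
      case (elim n)
      show ?case
      proof
        fix s assume s: "s \<in> P n"
        show "\<bar>c n s - \<psi> s\<bar> \<le> \<epsilon> + B * \<zeta> s"
        proof (cases "s \<in> ?V")
          case True
          then obtain r where "r \<in> J" "s \<in> {l r<..r}" "\<psi> s = \<phi> r" using \<psi>(2) by blast
          then have "\<bar>c n s - \<psi> s\<bar> < \<epsilon>" using elim(1) s by simp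
          moreover have "\<zeta> s = 0" unfolding \<zeta>_ind using True by simp
          ultimately show ?thesis by simp
        next
          case False
          then show ?thesis using elim(2) s \<psi>(3)[OF False] \<epsilon> unfolding \<zeta>_ind by (simp add: indicator_def) force
        qed
      qed
    qed
    have \<phi>\<psi>: "\<bar>\<phi> x - \<psi> x\<bar> \<le> 2 * \<epsilon> + B * \<zeta> x" if "x \<in> {0<..T}" for x
    proof (cases "x \<in> ?V")
      case True
      then obtain r where "r \<in> J" "x \<in> {l r<..r}" "\<psi> x = \<phi> r" using \<psi>(2) by blast
      then have "\<bar>\<phi> x - \<psi> x\<bar> \<le> 2 * \<epsilon>" using \<phi>_near by simp
      moreover have "\<zeta> x = 0" unfolding \<zeta>_ind using True by simp
      ultimately show ?thesis by simp
    next
      case False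
      then show ?thesis using \<phi>[OF that] \<psi>(3)[OF False] \<epsilon> unfolding \<zeta>_ind by (simp add: indicator_def)
    qed
    let ?S = "\<lambda>\<psi> n. \<Sum>s\<in>P n. indicator {0<..T} s * \<psi> s * w n s"
    let ?L = "\<lambda>\<psi>. \<integral>x. indicator {0<..T} x * \<psi> x \<partial>M"
    have lim: "(\<lambda>n. ?S \<psi> n) \<longlonglongrightarrow> ?L \<psi>" if "weak_test \<psi>" for \<psi>
      using weak_testD[OF that, of 0 T] T by simp
    have L1: "?L (\<lambda>_. 1) = q T" using measure_Ioc[of 0 T] T q(3) by simp
    have "\<bar>L - ?L \<psi>\<bar> \<le> 2 * \<epsilon> * q T + B * \<epsilon>"
    proof -
      have "\<bar>L - ?L \<psi>\<bar> = \<bar>\<integral>x. indicator {0<..T} x * \<phi> x - indicator {0<..T} x * \<psi> x \<partial>M\<bar>"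
        unfolding L_def by (subst Bochner_Integration.integral_diff[OF int\<phi> weak_test_integrable[OF \<psi>(1)]]) simp
      also have "\<dots> \<le> (\<integral>x. indicator {0<..T} x * (2 * \<epsilon> * 1 + B * \<zeta> x) \<partial>M)"
      proof (rule order_trans[OF integral_abs_bound integral_mono])
        show "integrable M (\<lambda>x. \<bar>indicator {0<..T} x * \<phi> x - indicator {0<..T} x * \<psi> x\<bar>)"
          using int\<phi> weak_test_integrable[OF \<psi>(1)] by auto
        show "integrable M (\<lambda>x. indicator {0<..T} x * (2 * \<epsilon> * 1 + B * \<zeta> x))"
          by (intro weak_test_integrable weak_test_add weak_test_cmult weak_test_1 \<zeta>)
        show "\<bar>indicator {0<..T} x * \<phi> x - indicator {0<..T} x * \<psi> x\<bar> \<le> indicator {0<..T} x * (2 * \<epsilon> * 1 + B * \<zeta> x)" for x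
          using \<phi>\<psi>[of x] by (simp add: indicator_def)
      qed
      also have "\<dots> = 2 * \<epsilon> * ?L (\<lambda>_. 1) + B * ?L \<zeta>"
      proof -
        have "(\<integral>x. indicator {0<..T} x * (2 * \<epsilon> * 1 + B * \<zeta> x) \<partial>M) =
            (\<integral>x. 2 * \<epsilon> * (indicator {0<..T} x * 1) + B * (indicator {0<..T} x * \<zeta> x) \<partial>M)"
          by (rule Bochner_Integration.integral_cong) (auto simp: algebra_simps)
        also have "\<dots> = 2 * \<epsilon> * ?L (\<lambda>_. 1) + B * ?L \<zeta>"
          using weak_test_integrable[OF weak_test_1, of 0 T] weak_test_integrable[OF \<zeta>, of 0 T] by simp
        finally show ?thesis .
      qed
      also have "\<dots> \<le> 2 * \<epsilon> * q T + B * \<epsilon>"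
        unfolding L1 using int\<zeta> B_nonneg by (intro add_left_mono mult_left_mono) auto
      finally show ?thesis .
    qed
    note L\<psi> = this
    \<comment> \<open>The test functions live on \<open>(0,T]\<close>; the atom at \<open>0\<close> vanishes in the limit because \<open>q 0 = 0\<close>.\<close>
    have w0: "(\<lambda>n. B * w n 0) \<longlonglongrightarrow> 0"
    proof -
      have "{s \<in> P n. s \<le> 0} = {0}" for n using P[of n] by force
      then have "(\<lambda>n. w n 0) \<longlonglongrightarrow> 0" using w_lim[of 0] T q(3) by simp
      from tendsto_mult_left[OF this, of B] show ?thesis by simp
    qed
    have "eventually (\<lambda>n. ?S (\<lambda>_. 1) n < q T + 1) sequentially"
      using order_tendstoD(2)[OF lim[OF weak_test_1]] L1 by simp
    moreover have "eventually (\<lambda>n. ?S \<zeta> n < \<epsilon>) sequentially"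
      using order_tendstoD(2)[OF lim[OF \<zeta>]] int\<zeta> by simp
    moreover have "eventually (\<lambda>n. B * w n 0 < \<epsilon>) sequentially"
      using order_tendstoD(2)[OF w0 \<epsilon>] .
    moreover have "eventually (\<lambda>n. dist (?S \<psi> n) (?L \<psi>) < \<epsilon>) sequentially"
      using tendstoD[OF lim[OF \<psi>(1)] \<epsilon>] .
    ultimately show "eventually (\<lambda>n. dist (\<Sum>s\<in>P n. c n s * w n s) L < \<epsilon>') sequentially"
      using c\<psi> c
    proof eventually_elim
      case (elim n)
      have "\<bar>(\<Sum>s\<in>P n. c n s * w n s) - ?S \<psi> n\<bar> \<le>
          (\<Sum>s\<in>P n. (\<epsilon> * (indicator {0<..T} s * 1 * w n s) + B * (indicator {0<..T} s * \<zeta> s * w n s)) + (if s = 0 then B * w n s else 0))"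
        unfolding sum_subtractf[symmetric]
      proof (rule order_trans[OF sum_abs sum_mono])
        fix s assume s: "s \<in> P n"
        show "\<bar>c n s * w n s - indicator {0<..T} s * \<psi> s * w n s\<bar> \<le>
          (\<epsilon> * (indicator {0<..T} s * 1 * w n s) + B * (indicator {0<..T} s * \<zeta> s * w n s)) + (if s = 0 then B * w n s else 0)"
        proof (cases "s = 0")
          case True
          then show ?thesis using elim(6) s w[OF s] by (simp add: abs_mult mult_right_mono)
        next
          case False
          then have "s \<in> {0<..T}" using P(2)[of n] s by force
          moreover have "\<bar>(c n s - \<psi> s) * w n s\<bar> \<le> (\<epsilon> + B * \<zeta> s) * w n s"
            using elim(5) s w[OF s] by (simp add: abs_mult mult_right_mono)
          ultimately show ?thesis using False by (simp add: algebra_simps)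
        qed
      qed
      also have "\<dots> = \<epsilon> * ?S (\<lambda>_. 1) n + B * ?S \<zeta> n + B * w n 0"
        using P(1,3)[of n] unfolding sum.distrib sum_distrib_left[symmetric] by simp
      also have "\<dots> \<le> \<epsilon> * (q T + 1) + B * \<epsilon> + \<epsilon>"
        using elim(1-3) \<epsilon> B_nonneg by (intro add_mono mult_left_mono) auto
      finally have "\<bar>(\<Sum>s\<in>P n. c n s * w n s) - L\<bar> < (\<epsilon> * (q T + 1) + B * \<epsilon> + \<epsilon>) + \<epsilon> + (2 * \<epsilon> * q T + B * \<epsilon>) + \<epsilon>"
        using elim(4) L\<psi> \<epsilon> unfolding dist_real_def by linarith
      also have "\<dots> = \<epsilon>'" unfolding \<epsilon>'[symmetric] by (simp add: algebra_simps)
      finally show ?case by (simp add: dist_real_def)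
    qed
  qed
  ultimately show ?thesis by simp
qed

end

section \<open>Partitions and approximating paths\<close>

locale time_partition =
  fixes T :: real and P :: "real set"
  assumes T: "0 < T" and P: "finite P" "P \<subseteq> {0..T}" "0 \<in> P" "T \<in> P"
begin

abbreviation nxt :: "real \<Rightarrow> real" where "nxt \<equiv> succ_in T P"

lemma nxt_T [simp]: "nxt T = T"
  by (simp add: succ_in_def)

lemma P_bounds: "s \<in> P \<Longrightarrow> 0 \<le> s \<and> s \<le> T"
  using P(2) by auto

lemma
  assumes "s \<in> P" "s < T"
  shows nxt_mem: "nxt s \<in> P" and nxt_gt: "s < nxt s" and nxt_least: "\<And>u. u \<in> P \<Longrightarrow> s < u \<Longrightarrow> nxt s \<le> u"
proof -
  have *: "finite {u \<in> P. s < u}" "{u \<in> P. s < u} \<noteq> {}" using P assms by auto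
  show "nxt s \<in> P" "s < nxt s" using Min_in[OF *] assms by (auto simp: succ_in_def)
  show "nxt s \<le> u" if "u \<in> P" "s < u" for u
    using Min_le[OF *(1)] that assms by (auto simp: succ_in_def)
qed

lemma nxt_bounds: "s \<in> P \<Longrightarrow> s \<le> nxt s \<and> nxt s \<le> T \<and> nxt s \<in> P"
  using nxt_mem[of s] nxt_gt[of s] P_bounds[of s] P_bounds[of "nxt s"] P(4) by (cases "s < T") auto

lemma nxt_diff_le_mesh: "s \<in> P \<Longrightarrow> nxt s - s \<le> mesh T P"
  unfolding mesh_def using P(1) by (intro Max_ge) auto

lemma cell_right:
  assumes "0 \<le> x" "x < T"
  obtains s where "s \<in> P" "s < T" "s \<le> x" "x < nxt s"
proof -
  define s where "s = Max {u \<in> P. u \<le> x}"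
  have *: "finite {u \<in> P. u \<le> x}" "{u \<in> P. u \<le> x} \<noteq> {}" using P assms by auto
  have s: "s \<in> P" "s \<le> x" using Max_in[OF *] unfolding s_def by auto
  then have "s < T" using assms by simp
  have "x < nxt s"
  proof (rule ccontr)
    assume "\<not> x < nxt s"
    then have "nxt s \<le> s" using Max_ge[OF *(1), of "nxt s"] nxt_mem[OF s(1) \<open>s < T\<close>] unfolding s_def by simp
    then show False using nxt_gt[OF s(1) \<open>s < T\<close>] by simp
  qed
  then show thesis using that s \<open>s < T\<close> by blast
qed

lemma cell_left:
  assumes "0 < x" "x \<le> T"
  obtains s where "s \<in> P" "s < T" "s < x" "x \<le> nxt s"
proof -
  define s where "s = Max {u \<in> P. u < x}"
  have *: "finite {u \<in> P. u < x}" "{u \<in> P. u < x} \<noteq> {}" using P assms by auto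
  have s: "s \<in> P" "s < x" using Max_in[OF *] unfolding s_def by auto
  then have "s < T" using assms by simp
  have "x \<le> nxt s"
  proof (rule ccontr)
    assume "\<not> x \<le> nxt s"
    then have "nxt s \<le> s" using Max_ge[OF *(1), of "nxt s"] nxt_mem[OF s(1) \<open>s < T\<close>] unfolding s_def by simp
    then show False using nxt_gt[OF s(1) \<open>s < T\<close>] by simp
  qed
  then show thesis using that s \<open>s < T\<close> by blast
qed

lemma cell_unique:
  assumes "s \<in> P" "r \<in> P" "s \<le> x" "x < nxt s" "r \<le> x" "x < nxt r"
  shows "r = s"
proof (rule ccontr)
  assume "r \<noteq> s"
  then consider "r < s" | "s < r" by linarith
  then show False
  proof cases
    case 1
    then have "nxt r \<le> s" using nxt_least[of r s] assms P_bounds[of s] by auto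
    then show False using assms by simp
  next
    case 2
    then have "nxt s \<le> r" using nxt_least[of s r] assms P_bounds[of r] by auto
    then show False using assms by simp
  qed
qed

text \<open>The successor is a bijection from the points before \<open>T\<close> to the points after \<open>0\<close>.\<close>

lemma telescope:
  fixes g :: "real \<Rightarrow> 'b::ab_group_add"
  shows "(\<Sum>s\<in>P - {T}. g (nxt s) - g s) = g T - g 0"
proof -
  have less_T: "s < T" if "s \<in> P - {T}" for s using P_bounds[of s] that by auto
  have inj: "inj_on nxt (P - {T})"
  proof (rule linorder_inj_onI)
    fix s r assume "s < r" "s \<in> P - {T}" "r \<in> P - {T}"
    then show "nxt s \<noteq> nxt r"
      using nxt_least[of s r] nxt_gt[of r] less_T[of s] less_T[of r] by auto
  qed auto
  have "nxt ` (P - {T}) = P - {0}"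
  proof (intro equalityI subsetI)
    fix r assume "r \<in> nxt ` (P - {T})"
    then obtain s where "s \<in> P - {T}" "r = nxt s" by blast
    then show "r \<in> P - {0}" using nxt_mem[of s] nxt_gt[of s] less_T[of s] P_bounds[of s] by auto
  next
    fix r assume r: "r \<in> P - {0}"
    then have "0 < r" "r \<le> T" using P_bounds[of r] by auto
    then obtain s where s: "s \<in> P" "s < T" "s < r" "r \<le> nxt s" by (rule cell_left)
    then have "r = nxt s" using nxt_least[of s r] r by auto
    then show "r \<in> nxt ` (P - {T})" using s by auto
  qed
  then have "(\<Sum>s\<in>P - {T}. g (nxt s)) = (\<Sum>s\<in>P - {0}. g s)"
    using sum.reindex[OF inj, of g] by simp
  moreover have "(\<Sum>s\<in>P - {0}. g s) = sum g P - g 0" "(\<Sum>s\<in>P - {T}. g s) = sum g P - g T"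
    using P by (simp_all add: sum_diff1)
  ultimately show ?thesis by (simp add: sum_subtractf)
qed

lemma approx_path_cell:
  fixes X :: "real \<Rightarrow> 'a::real_vector"
  assumes "s \<in> P" "s \<le> x" "x < nxt s"
  shows "approx_path T P X x = X (nxt s)"
proof -
  have x: "0 \<le> x" "x < T" using assms P_bounds[OF assms(1)] nxt_bounds[OF assms(1)] by auto
  have "(\<Sum>r\<in>P. indicator {r..<nxt r} x *\<^sub>R X (nxt r)) = (\<Sum>r\<in>P. if r = s then X (nxt s) else 0)"
  proof (intro sum.cong refl)
    fix r assume "r \<in> P"
    then show "indicator {r..<nxt r} x *\<^sub>R X (nxt r) = (if r = s then X (nxt s) else 0)"
    proof (cases "r = s")
      case False
      then have "x \<notin> {r..<nxt r}" using cell_unique[OF assms(1) \<open>r \<in> P\<close> assms(2,3)] by auto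
      then show ?thesis using False by simp
    qed (use assms in simp)
  qed
  then show ?thesis using x P(1) assms(1) by (simp add: approx_path_def)
qed

text \<open>
  The path \<open>X\<^bsup>n,s-\<^esup>\<close> bumped by \<open>v\<close> at the partition point \<open>s\<close>. For \<open>v = 0\<close> it is
  \<open>X\<^bsup>n,s-\<^esup>\<close> itself, and for the increment \<open>v\<close> of \<open>X\<close> over the cell it is \<open>X\<^bsup>n,s\<^esup>\<close>.
\<close>

definition bumped :: "(real \<Rightarrow> real ^ 'd::finite) \<Rightarrow> real \<Rightarrow> real ^ 'd \<Rightarrow> real \<Rightarrow> real ^ 'd" where
  "bumped X s v = bump T s v (approx_path_left T P X s)"

lemma approx_path_left_apply:
  fixes X :: "real \<Rightarrow> real ^ 'd::finite"
  assumes "s \<in> P" "x \<in> {0..T}"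
  shows "approx_path_left T P X s x = (if x < s then approx_path T P X x else X s)"
proof (cases "s = 0")
  case False
  then have "0 < s" "s \<le> T" using P_bounds[OF assms(1)] by auto
  then obtain r where r: "r \<in> P" "r < T" "r < s" "s \<le> nxt r" by (rule cell_left)
  then have s: "s = nxt r" using nxt_least[of r s] assms(1) by auto
  have "eventually (\<lambda>u. u \<in> {r<..<s}) (at_left s)" using r(3) by (rule eventually_at_left_real)
  then have "eventually (\<lambda>u. approx_path T P X u = X s) (at_left s)"
    by eventually_elim (use approx_path_cell[OF r(1), where X = X] s in auto)
  then have "(approx_path T P X \<longlongrightarrow> X s) (at_left s)" by (rule tendsto_eventually)
  then have "Lim (at_left s) (approx_path T P X) = X s" by (intro tendsto_Lim) auto
  then show ?thesis using False assms(2) by (simp add: approx_path_left_def stop_left_def)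
qed (use assms in \<open>auto simp: approx_path_left_def\<close>)

lemma bumped_apply:
  assumes "s \<in> P" "x \<in> {0..T}"
  shows "bumped X s v x = (if x < s then approx_path T P X x else X s + v)"
  using assms by (simp add: bumped_def bump_def approx_path_left_apply)

lemma bumped_outside: "x \<notin> {0..T} \<Longrightarrow> bumped X s v x = undefined"
  by (simp add: bumped_def bump_def del: atLeastAtMost_iff)

lemma approx_path_left_outside: "x \<notin> {0..T} \<Longrightarrow> approx_path_left T P X s x = undefined"
  by (simp add: approx_path_left_def stop_left_def del: atLeastAtMost_iff)

lemma approx_path_left_eq_bumped:
  assumes "s \<in> P"
  shows "approx_path_left T P X s = bumped X s 0"
proof
  fix x show "approx_path_left T P X s x = bumped X s 0 x"
    by (cases "x \<in> {0..T}")
      (simp_all add: bumped_apply[OF assms] approx_path_left_apply[OF assms]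
        bumped_outside approx_path_left_outside del: atLeastAtMost_iff)
qed

text \<open>The jump of \<open>X\<^bsup>n\<^esup>\<close> at \<open>s\<close> is the only change between consecutive stopped paths.\<close>

lemma approx_path_left_next:
  assumes "s \<in> P" "s < T"
  shows "approx_path_left T P X (nxt s) = bumped X s (X (nxt s) - X s)"
proof
  fix x show "approx_path_left T P X (nxt s) x = bumped X s (X (nxt s) - X s) x"
  proof (cases "x \<in> {0..T}")
    case True
    then show ?thesis
      using approx_path_cell[OF assms(1), of x X] nxt_gt[OF assms]
      by (auto simp: bumped_apply[OF assms(1)] approx_path_left_apply[OF nxt_mem[OF assms]])
  qed (simp add: bumped_outside approx_path_left_outside del: atLeastAtMost_iff)
qed

lemma stop_bumped:
  assumes "s \<in> P"
  shows "stop T s (bumped X s v) = bumped X s v"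
proof
  fix x show "stop T s (bumped X s v) x = bumped X s v x"
    using P_bounds[OF assms]
    by (cases "x \<in> {0..T}") (auto simp: stop_def bumped_apply[OF assms] bumped_outside min_def)
qed

lemma approx_path_range:
  assumes "0 \<le> x" "x < T"
  shows "approx_path T P X x \<in> X ` {0..T}"
proof -
  obtain s where s: "s \<in> P" "s < T" "s \<le> x" "x < nxt s" using cell_right[OF assms] .
  then have "nxt s \<in> {0..T}" using P_bounds[OF s(1)] nxt_bounds[OF s(1)] by auto
  then show ?thesis using approx_path_cell[OF s(1,3,4), of X] by blast
qed

lemma bumped_cadlag:
  assumes s: "s \<in> P" and K: "X ` {0..T} \<subseteq> K" "X s + v \<in> K"
  shows "bumped X s v \<in> cadlag_paths T K"
proof -
  have sT: "0 \<le> s" "s \<le> T" using P_bounds[OF s] by auto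
  have "bumped X s v \<in> {0..T} \<rightarrow>\<^sub>E K"
  proof (intro PiE_I)
    show "bumped X s v x \<in> K" if "x \<in> {0..T}" for x
      using that K approx_path_range[of x X] sT by (auto simp: bumped_apply[OF s])
  qed (rule bumped_outside)
  moreover have "(bumped X s v \<longlongrightarrow> bumped X s v t) (at_right t)" if t: "t \<in> {0..<T}" for t
  proof (cases "t < s")
    case True
    obtain r where r: "r \<in> P" "r < T" "r \<le> t" "t < nxt r" using cell_right[of t] t by auto
    have "eventually (\<lambda>u. u \<in> {t<..<min s (nxt r)}) (at_right t)"
      using True r by (intro eventually_at_right_real) auto
    then have "eventually (\<lambda>u. bumped X s v u = bumped X s v t) (at_right t)"
      by eventually_elim (use True r sT t in \<open>auto simp: bumped_apply[OF s] approx_path_cell[OF r(1), where X = X]\<close>)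
    then show ?thesis by (rule tendsto_eventually)
  next
    case False
    have "eventually (\<lambda>u. u \<in> {t<..<T}) (at_right t)"
      using t by (intro eventually_at_right_real) auto
    then have "eventually (\<lambda>u. bumped X s v u = bumped X s v t) (at_right t)"
      by eventually_elim (use False t in \<open>auto simp: bumped_apply[OF s]\<close>)
    then show ?thesis by (rule tendsto_eventually)
  qed
  moreover have "\<exists>l\<in>K. (bumped X s v \<longlongrightarrow> l) (at_left t)" if t: "t \<in> {0<..T}" for t
  proof (cases "t \<le> s")
    case True
    obtain r where r: "r \<in> P" "r < T" "r < t" "t \<le> nxt r" using cell_left[of t] t by auto
    have r0: "0 \<le> r" "nxt r \<in> {0..T}" using P_bounds[OF r(1)] nxt_bounds[OF r(1)] by auto
    have "eventually (\<lambda>u. u \<in> {r<..<t}) (at_left t)"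
      using r by (intro eventually_at_left_real) auto
    then have "eventually (\<lambda>u. bumped X s v u = X (nxt r)) (at_left t)"
      by eventually_elim (use True r r0 sT t in \<open>auto simp: bumped_apply[OF s] approx_path_cell[OF r(1), where X = X]\<close>)
    then have "(bumped X s v \<longlongrightarrow> X (nxt r)) (at_left t)" by (rule tendsto_eventually)
    then show ?thesis using K r0 by blast
  next
    case False
    have "eventually (\<lambda>u. u \<in> {s<..<t}) (at_left t)"
      using False by (intro eventually_at_left_real) auto
    then have "eventually (\<lambda>u. bumped X s v u = X s + v) (at_left t)"
      by eventually_elim (use False t sT in \<open>auto simp: bumped_apply[OF s]\<close>)
    then have "(bumped X s v \<longlongrightarrow> X s + v) (at_left t)" by (rule tendsto_eventually)
    then show ?thesis using K by blast
  qed
  ultimately show ?thesis unfolding cadlag_paths_def by auto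
qed

text \<open>
  Uniform estimates from the modulus of continuity of \<open>X\<close>, as needed to apply left-continuity at
  \<open>t\<close> to a path stopped at an earlier partition point, and continuity at a fixed time inside a cell.
\<close>

context
  fixes X :: "real \<Rightarrow> real ^ 'd::finite" and \<rho> e :: real
  assumes modulus_all: "\<forall>x\<in>{0..T}. \<forall>y\<in>{0..T}. \<bar>x - y\<bar> \<le> \<rho> \<longrightarrow> norm (X x - X y) \<le> e"
    and mesh: "mesh T P \<le> \<rho>"
begin

lemmas modulus = modulus_all[rule_format]

lemma nxt_close: "s \<in> P \<Longrightarrow> norm (X (nxt s) - X s) \<le> e"
  using nxt_diff_le_mesh[of s] nxt_bounds[of s] P_bounds[of s] mesh by (intro modulus) auto

lemma approx_path_close:
  assumes "0 \<le> x" "x < T"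
  shows "norm (X x - approx_path T P X x) \<le> e"
proof -
  obtain s where s: "s \<in> P" "s < T" "s \<le> x" "x < nxt s" using cell_right[OF assms] .
  then show ?thesis
    using approx_path_cell[OF s(1,3,4), of X] nxt_diff_le_mesh[of s] nxt_bounds[of s] P_bounds[of s] mesh assms
    by (auto intro!: modulus)
qed

lemma sup_norm_stop_bumped_le:
  assumes s: "s \<in> P" and t: "s \<le> t" "t \<le> T" "t - s \<le> \<rho>"
  shows "sup_norm T (\<lambda>u. stop T t X u - stop T s (bumped X s v) u) \<le> e + norm v"
  unfolding sup_norm_def
proof (rule cSUP_least)
  show "{0..T} \<noteq> {}" using T by simp
  fix u assume u: "u \<in> {0..T}"
  have s0: "0 \<le> s" using P_bounds[OF s] by simp
  show "norm (stop T t X u - stop T s (bumped X s v) u) \<le> e + norm v"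
  proof (cases "u < s")
    case True
    then have "norm (X u - approx_path T P X u) \<le> e" using u t by (intro approx_path_close) auto
    then have "norm (X u - approx_path T P X u) \<le> e + norm v" using norm_ge_zero[of v] by linarith
    then show ?thesis using True u t by (simp add: stop_def bumped_apply[OF s])
  next
    case False
    have "norm (X (min t u) - X s) \<le> e" using False u t s0 by (intro modulus) auto
    then have "norm ((X (min t u) - X s) - v) \<le> e + norm v"
      using norm_triangle_ineq4[of "X (min t u) - X s" v] by linarith
    moreover have "min s u = s" using False by simp
    ultimately show ?thesis using u t s0 by (simp add: stop_def bumped_apply[OF s] algebra_simps)
  qed
qed

lemma sup_norm_stop_cell_le:
  assumes s: "s \<in> P" "s < T" and t: "s \<le> t" "t < nxt s"
  shows "sup_norm T (\<lambda>u. stop T t X u - stop T t (approx_path_left T P X (nxt s)) u) \<le> e"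
  unfolding sup_norm_def
proof (rule cSUP_least)
  show "{0..T} \<noteq> {}" using T by simp
  fix u assume u: "u \<in> {0..T}"
  have b: "0 \<le> s" "nxt s \<le> T" using P_bounds[OF s(1)] nxt_bounds[OF s(1)] by auto
  have m: "min t u \<in> {0..T}" "min t u < nxt s" using u t b by auto
  then have "approx_path_left T P X (nxt s) (min t u) = approx_path T P X (min t u)"
    by (simp only: approx_path_left_apply[OF nxt_mem[OF s]] if_True)
  moreover have "norm (X (min t u) - approx_path T P X (min t u)) \<le> e"
    using m b by (intro approx_path_close) auto
  ultimately show "norm (stop T t X u - stop T t (approx_path_left T P X (nxt s)) u) \<le> e"
    using u by (simp add: stop_def)
qed

end

end

lemma cont_paths_cadlag:
  assumes "X \<in> cont_paths T U" "X ` {0..T} \<subseteq> K"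
  shows "X \<in> cadlag_paths T K"
proof -
  have X: "X \<in> {0..T} \<rightarrow>\<^sub>E U" "continuous_on {0..T} X" using assms(1) unfolding cont_paths_def by auto
  have lim: "(X \<longlongrightarrow> X t) (at t within S)" if "t \<in> {0..T}" "S \<subseteq> {0..T}" for t S
    using X(2) that by (auto simp: continuous_on_def intro: tendsto_within_subset)
  have "(X \<longlongrightarrow> X t) (at_right t)" if "t \<in> {0..<T}" for t
    using lim[of t "{t..T}"] that at_within_Icc_at_right[of t T] by simp
  moreover have "\<exists>l\<in>K. (X \<longlongrightarrow> l) (at_left t)" if "t \<in> {0<..T}" for t
    using lim[of t "{0..t}"] that at_within_Icc_at_left[of 0 t] assms(2) by (intro bexI[of _ "X t"]) auto
  moreover have "X \<in> {0..T} \<rightarrow>\<^sub>E K" using X(1) assms(2) by (auto simp: PiE_def Pi_def extensional_def)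
  ultimately show ?thesis unfolding cadlag_paths_def by auto
qed

lemma continuous_modulus:
  fixes X :: "real \<Rightarrow> 'a::real_normed_vector"
  assumes "continuous_on {0..T} X" "0 < e"
  obtains \<rho> where "0 < \<rho>" "\<forall>x\<in>{0..T}. \<forall>y\<in>{0..T}. \<bar>x - y\<bar> \<le> \<rho> \<longrightarrow> norm (X x - X y) \<le> e"
proof -
  have "uniformly_continuous_on {0..T} X" using assms(1) by (intro compact_uniformly_continuous) auto
  then obtain d where d: "d > 0" "\<And>x y. x \<in> {0..T} \<Longrightarrow> y \<in> {0..T} \<Longrightarrow> dist y x < d \<Longrightarrow> dist (X y) (X x) < e"
    using assms(2) unfolding uniformly_continuous_on_def by metis
  show thesis
  proof
    show "0 < d / 2" using d(1) by simp
    show "\<forall>x\<in>{0..T}. \<forall>y\<in>{0..T}. \<bar>x - y\<bar> \<le> d / 2 \<longrightarrow> norm (X x - X y) \<le> e"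
    proof (intro ballI impI)
      fix x y assume xy: "x \<in> {0..T}" "y \<in> {0..T}" "\<bar>x - y\<bar> \<le> d / 2"
      have "dist (X x) (X y) < e"
        using d(1) xy by (intro d(2)) (auto simp: dist_real_def)
      then show "norm (X x - X y) \<le> e" by (simp add: dist_norm)
    qed
  qed
qed

section \<open>Quadratic variation\<close>

locale partition_sequence =
  fixes T :: real and P :: "nat \<Rightarrow> real set"
  assumes T: "0 < T" and refining: "refining_partitions T P"
begin

sublocale tp: time_partition T "P n" for n
  using T refining by unfold_locales (auto simp: refining_partitions_def)

lemma eventually_mesh_le: "0 < \<rho> \<Longrightarrow> eventually (\<lambda>n. mesh T (P n) \<le> \<rho>) sequentially"
  using refining order_tendstoD(2)[of "\<lambda>n. mesh T (P n)" 0 sequentially \<rho>]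
  by (auto simp: refining_partitions_def elim: eventually_mono)

lemma partition_dense_left:
  assumes "s \<in> {0<..T}" "0 < \<eta>"
  shows "eventually (\<lambda>n. \<exists>t\<in>P n. s - \<eta> < t \<and> t \<le> s) sequentially"
proof -
  have "eventually (\<lambda>n. mesh T (P n) \<le> \<eta> / 2) sequentially" using assms(2) by (intro eventually_mesh_le) simp
  then show ?thesis
  proof eventually_elim
    case (elim n)
    obtain t where t: "t \<in> P n" "t < T" "t < s" "s \<le> succ_in T (P n) t" using tp.cell_left[of s n] assms by auto
    then have "s - \<eta> < t" using tp.nxt_diff_le_mesh[OF t(1)] elim assms(2) by linarith
    then show ?case using t by auto
  qed
qed

lemma qv_sum_scale: "qv_sum T p (\<lambda>t. k * x t) t = k\<^sup>2 * qv_sum T p x t"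
  unfolding qv_sum_def by (simp add: sum_distrib_left power_mult_distrib right_diff_distrib[symmetric])

lemma admits_continuous_qv_scale:
  assumes x: "admits_continuous_qv T P x"
  shows "admits_continuous_qv T P (\<lambda>t. k * x t)"
proof -
  have conv: "convergent (\<lambda>n. qv_sum T (P n) x t)" if "t \<in> {0<..T}" for t
    using x that unfolding admits_continuous_qv_def by blast
  have eq: "qv T P (\<lambda>t. k * x t) t = k\<^sup>2 * qv T P x t" if "t \<in> {0..T}" for t
  proof (cases "t = 0")
    case False
    then have "(\<lambda>n. qv_sum T (P n) x t) \<longlonglongrightarrow> lim (\<lambda>n. qv_sum T (P n) x t)"
      using conv[of t] that by (simp add: convergent_LIMSEQ_iff)
    then have "(\<lambda>n. k\<^sup>2 * qv_sum T (P n) x t) \<longlonglongrightarrow> k\<^sup>2 * lim (\<lambda>n. qv_sum T (P n) x t)"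
      by (rule tendsto_mult_left)
    then show ?thesis using False by (simp add: qv_def qv_sum_scale limI)
  qed (simp add: qv_def)
  have "continuous_on {0..T} (\<lambda>t. k\<^sup>2 * qv T P x t)"
    using x unfolding admits_continuous_qv_def by (intro continuous_intros) auto
  then have "continuous_on {0..T} (qv T P (\<lambda>t. k * x t))"
    by (rule continuous_on_eq) (simp only: eq)
  moreover have "continuous_on {0..T} (\<lambda>t. k * x t)"
    using x unfolding admits_continuous_qv_def by (intro continuous_intros) auto
  moreover have "convergent (\<lambda>n. qv_sum T (P n) (\<lambda>t. k * x t) t)" if "t \<in> {0<..T}" for t
    unfolding qv_sum_scale using conv[OF that] by (intro convergent_mult convergent_const)
  ultimately show ?thesis unfolding admits_continuous_qv_def by auto
qed

text \<open>The definition speaks of sums \<open>X\<^sub>i + X\<^sub>j\<close>; the components are halves of the diagonal sums.\<close>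

lemma admits_continuous_qv_component:
  assumes "admits_continuous_qv_vec T P X"
  shows "admits_continuous_qv T P (\<lambda>t. X t $ i)"
proof -
  have "admits_continuous_qv T P (\<lambda>t. X t $ i + X t $ i)"
    using assms unfolding admits_continuous_qv_vec_def by blast
  from admits_continuous_qv_scale[OF this, of "1 / 2"] show ?thesis by simp
qed

context
  fixes x :: "real \<Rightarrow> real"
  assumes x: "admits_continuous_qv T P x"
begin

text \<open>
  At \<open>t = 0\<close>, where \<open>qv\<close> is \<open>0\<close> by convention, the sum is the square of the first increment,
  which vanishes with the mesh.
\<close>

lemma qv_sum_tendsto:
  assumes t: "t \<in> {0..T}"
  shows "(\<lambda>n. qv_sum T (P n) x t) \<longlonglongrightarrow> qv T P x t"
proof (cases "t = 0")
  case False
  then show ?thesis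
    using x t unfolding admits_continuous_qv_def by (simp add: qv_def convergent_LIMSEQ_iff)
next
  case True
  have sum0: "qv_sum T (P n) x 0 = (x (succ_in T (P n) 0) - x 0)\<^sup>2" for n
  proof -
    have "{s. s \<in> P n \<and> s \<le> 0} = {0}" using tp.P_bounds[of _ n] tp.P(3)[of n] by force
    then show ?thesis by (simp add: qv_sum_def)
  qed
  have "(\<lambda>n. x (succ_in T (P n) 0) - x 0) \<longlonglongrightarrow> 0"
  proof (rule LIMSEQ_I)
    fix e :: real assume "0 < e"
    have "continuous_on {0..T} x" using x unfolding admits_continuous_qv_def by blast
    then obtain \<rho> where \<rho>: "0 < \<rho>"
      "\<forall>u\<in>{0..T}. \<forall>v\<in>{0..T}. \<bar>u - v\<bar> \<le> \<rho> \<longrightarrow> norm (x u - x v) \<le> e / 2"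
      using continuous_modulus[of T x "e / 2"] \<open>0 < e\<close> by auto
    have "eventually (\<lambda>n. norm (x (succ_in T (P n) 0) - x 0 - 0) < e) sequentially"
      using eventually_mesh_le[OF \<rho>(1)]
    proof eventually_elim
      case (elim n)
      have "norm (x (succ_in T (P n) 0) - x 0) \<le> e / 2"
        using tp.nxt_bounds[OF tp.P(3), of n] tp.nxt_diff_le_mesh[OF tp.P(3), of n] elim T by (intro \<rho>(2)[rule_format]) auto
      then show ?case using \<open>0 < e\<close> by simp
    qed
    then show "\<exists>N. \<forall>n\<ge>N. norm (x (succ_in T (P n) 0) - x 0 - 0) < e" by (simp add: eventually_sequentially)
  qed
  from tendsto_power[OF this, of 2] show ?thesis unfolding True sum0 by (simp add: qv_def)
qed

text \<open>
  The extension, constant outside \<open>[0,T]\<close>, makes the quadratic variation a distribution function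
  on the line, as \<open>interval_measure\<close> expects.
\<close>

definition qv_ext :: "real \<Rightarrow> real" where
  "qv_ext t = qv T P x (max 0 (min T t))"

lemma qv_ext_eq: "t \<in> {0..T} \<Longrightarrow> qv_ext t = qv T P x t"
  by (simp add: qv_ext_def)

lemma mono_qv_ext: "mono qv_ext"
proof (rule monoI)
  fix s t :: real assume "s \<le> t"
  then have st: "max 0 (min T s) \<le> max 0 (min T t)" "max 0 (min T s) \<in> {0..T}" "max 0 (min T t) \<in> {0..T}"
    using T by auto
  have "qv_sum T (P n) x (max 0 (min T s)) \<le> qv_sum T (P n) x (max 0 (min T t))" for n
    unfolding qv_sum_def using tp.P(1)[of n] st(1) by (intro sum_mono2) auto
  then show "qv_ext s \<le> qv_ext t"
    unfolding qv_ext_def using st by (intro LIMSEQ_le[OF qv_sum_tendsto qv_sum_tendsto]) auto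
qed

lemma continuous_qv_ext: "continuous_on UNIV qv_ext"
proof -
  have "continuous_on {0..T} (qv T P x)" using x unfolding admits_continuous_qv_def by blast
  from this show ?thesis unfolding qv_ext_def
    by (rule continuous_on_compose2) (use T in \<open>auto intro!: continuous_intros\<close>)
qed

lemma qv_ext_0 [simp]: "qv_ext 0 = 0"
  using T by (simp add: qv_ext_def qv_def)

end

end

section \<open>Vertical Taylor expansion\<close>

lemma bump_bump: "bump T s v (bump T s w Y) = bump T s (v + w) Y"
  by (auto simp: bump_def fun_eq_iff indicator_def)

lemma linear_eq_sum_axis:
  fixes D :: "real ^ 'd::finite \<Rightarrow> real"
  assumes "linear D"
  shows "D h = (\<Sum>j\<in>UNIV. h $ j * D (axis j 1))"
proof -
  have "D h = D (\<Sum>j\<in>UNIV. h $ j *\<^sub>R axis j 1)"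
    by (simp add: basis_expansion[of h, unfolded scalar_mult_eq_scaleR])
  also have "\<dots> = (\<Sum>j\<in>UNIV. h $ j * D (axis j 1))"
    using assms by (simp add: linear_sum linear_cmul)
  finally show ?thesis .
qed

text \<open>Differentiability at every bumped path makes the bump size a differentiable parameter.\<close>

lemma vertical_has_derivative:
  assumes G: "vertically_differentiable T U S G" and t: "t \<in> {0..T}"
    and Y: "bump T t w Y \<in> cadlag_paths T U" and A: "A \<in> cbv_paths T S"
  shows "((\<lambda>v. G t (bump T t v Y) A) has_derivative (\<lambda>h. \<Sum>j\<in>UNIV. h $ j * vpartial T j G t (bump T t w Y) A)) (at w)"
proof -
  let ?g = "\<lambda>v. G t (bump T t v (bump T t w Y)) A"
  define D where "D = frechet_derivative ?g (at 0)"
  have "?g differentiable (at 0)"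
    using G t Y A unfolding vertically_differentiable_def vertically_differentiable_at_def by blast
  then have D: "(?g has_derivative D) (at 0)" unfolding D_def by (simp add: frechet_derivative_works)
  have "((\<lambda>v. v - w) has_derivative (\<lambda>h. h)) (at w)" by (auto intro!: derivative_eq_intros)
  moreover have "(?g has_derivative D) (at (w - w))" using D by simp
  ultimately have "((\<lambda>v. ?g (v - w)) has_derivative (\<lambda>h. D h)) (at w)" by (rule has_derivative_compose)
  moreover have "D h = (\<Sum>j\<in>UNIV. h $ j * vpartial T j G t (bump T t w Y) A)" for h
    unfolding vpartial_def D_def[symmetric]
    using linear_eq_sum_axis[OF has_derivative_linear[OF D]] .
  ultimately show ?thesis by (simp add: bump_bump)
qed

lemma vertical_DERIV:
  assumes "vertically_differentiable T U S G" "t \<in> {0..T}"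
    and "bump T t (\<theta> *\<^sub>R \<delta>) Y \<in> cadlag_paths T U" "A \<in> cbv_paths T S"
  shows "((\<lambda>\<theta>. G t (bump T t (\<theta> *\<^sub>R \<delta>) Y) A) has_real_derivative
    (\<Sum>j\<in>UNIV. \<delta> $ j * vpartial T j G t (bump T t (\<theta> *\<^sub>R \<delta>) Y) A)) (at \<theta>)"
proof -
  have "((\<lambda>\<theta>. \<theta> *\<^sub>R \<delta>) has_derivative (\<lambda>h. h *\<^sub>R \<delta>)) (at \<theta>)" by (auto intro!: derivative_eq_intros)
  from has_derivative_compose[OF this vertical_has_derivative[OF assms]]
  show ?thesis by (rule has_derivative_imp_has_field_derivative) (simp add: sum_distrib_left mult_ac)
qed

text \<open>
  Along the segment \<open>\<theta> \<delta>\<close> the functional is twice differentiable in the real variable \<open>\<theta>\<close>. The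
  Lagrange form of the remainder uses the mere existence of the second derivative, which is what
  twice vertical differentiability provides.
\<close>

lemma vertical_taylor:
  assumes F: "twice_vertically_differentiable T U S F" and t: "t \<in> {0..T}" and A: "A \<in> cbv_paths T S"
    and Y: "\<And>\<theta>. 0 \<le> \<theta> \<Longrightarrow> \<theta> \<le> 1 \<Longrightarrow> bump T t (\<theta> *\<^sub>R \<delta>) Y \<in> cadlag_paths T U"
  obtains \<theta> where "0 < \<theta>" "\<theta> < 1"
    "F t (bump T t \<delta> Y) A = F t (bump T t 0 Y) A + (\<Sum>j\<in>UNIV. \<delta> $ j * vpartial T j F t (bump T t 0 Y) A) +
      1 / 2 * (\<Sum>i\<in>UNIV. \<Sum>j\<in>UNIV. vpartial T i (vpartial T j F) t (bump T t (\<theta> *\<^sub>R \<delta>) Y) A * (\<delta> $ i * \<delta> $ j))"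
proof -
  define g where "g \<theta> = F t (bump T t (\<theta> *\<^sub>R \<delta>) Y) A" for \<theta>
  define g1 where "g1 \<theta> = (\<Sum>j\<in>UNIV. \<delta> $ j * vpartial T j F t (bump T t (\<theta> *\<^sub>R \<delta>) Y) A)" for \<theta>
  define g2 where "g2 \<theta> = (\<Sum>j\<in>UNIV. \<delta> $ j * (\<Sum>i\<in>UNIV. \<delta> $ i * vpartial T i (vpartial T j F) t (bump T t (\<theta> *\<^sub>R \<delta>) Y) A))" for \<theta>
  define diff where "diff m = (if m = 0 then g else if m = 1 then g1 else g2)" for m :: nat
  have "\<exists>\<theta>. 0 < \<theta> \<and> \<theta> < 1 \<and> g 1 = (\<Sum>m<2. diff m 0 / fact m * 1 ^ m) + diff 2 \<theta> / fact 2 * 1 ^ 2"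
  proof (rule Maclaurin)
    show "\<forall>m \<theta>. m < 2 \<and> 0 \<le> \<theta> \<and> \<theta> \<le> 1 \<longrightarrow> (diff m has_real_derivative diff (Suc m) \<theta>) (at \<theta>)"
    proof (intro allI impI)
      fix m :: nat and \<theta> :: real assume m: "m < 2 \<and> 0 \<le> \<theta> \<and> \<theta> \<le> 1"
      have b: "bump T t (\<theta> *\<^sub>R \<delta>) Y \<in> cadlag_paths T U" using Y m by blast
      have v: "vertically_differentiable T U S F" "\<And>j. vertically_differentiable T U S (vpartial T j F)"
        using F unfolding twice_vertically_differentiable_def by auto
      have "(g has_real_derivative g1 \<theta>) (at \<theta>)"
        unfolding g_def g1_def by (rule vertical_DERIV[OF v(1) t b A])
      moreover have "(g1 has_real_derivative g2 \<theta>) (at \<theta>)"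
        unfolding g1_def g2_def by (intro DERIV_sum DERIV_cmult vertical_DERIV[OF v(2) t b A])
      ultimately show "(diff m has_real_derivative diff (Suc m) \<theta>) (at \<theta>)"
        using m unfolding diff_def by (cases "m = 0") (auto simp: less_2_cases_iff)
    qed
  qed (auto simp: diff_def)
  then obtain \<theta> where \<theta>: "0 < \<theta>" "\<theta> < 1" "g 1 = g 0 + g1 0 + g2 \<theta> / 2"
    by (auto simp: diff_def numeral_2_eq_2)
  have "g2 \<theta> = (\<Sum>i\<in>UNIV. \<Sum>j\<in>UNIV. vpartial T i (vpartial T j F) t (bump T t (\<theta> *\<^sub>R \<delta>) Y) A * (\<delta> $ i * \<delta> $ j))"
    unfolding g2_def sum_distrib_left by (subst sum.swap) (simp add: mult_ac)
  then show thesis using that[OF \<theta>(1,2)] \<theta>(3) by (simp add: g_def g1_def)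
qed

section \<open>Convergence of the horizontal and second-order terms\<close>

lemma cadlag_paths_mono: "K \<subseteq> L \<Longrightarrow> cadlag_paths T K \<subseteq> cadlag_paths T L"
  unfolding cadlag_paths_def using PiE_mono[of "{0..T}" "\<lambda>_. K" "\<lambda>_. L"] by blast

locale ito_setting = partition_sequence T P for T :: real and P +
  fixes U :: "(real ^ 'd::finite) set" and S :: "(real ^ 'm::finite) set"
    and X :: "real \<Rightarrow> real ^ 'd" and A :: "real \<Rightarrow> real ^ 'm"
  assumes U: "open U" and X: "X \<in> cont_paths T U" and A: "A \<in> cbv_paths T S"
begin

lemma X_continuous: "continuous_on {0..T} X" and X_range: "X ` {0..T} \<subseteq> U"
  using X unfolding cont_paths_def by auto

lemma X_range_compact: "compact (X ` {0..T})"
  using X_continuous by (intro compact_continuous_image) auto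

lemma X_cadlag: "X ` {0..T} \<subseteq> K \<Longrightarrow> X \<in> cadlag_paths T K"
  by (rule cont_paths_cadlag[OF X])

abbreviation incr :: "nat \<Rightarrow> real \<Rightarrow> real ^ 'd" where
  "incr n s \<equiv> X (succ_in T (P n) s) - X s"

lemma boundedness_preservingE:
  assumes "boundedness_preserving T U S G" "compact K" "K \<subseteq> U"
  obtains C where "\<And>t Y. t \<in> {0..T} \<Longrightarrow> Y \<in> cadlag_paths T K \<Longrightarrow> \<bar>G t Y A\<bar> \<le> C"
proof -
  have "\<forall>A\<in>cbv_paths T S. \<forall>K. compact K \<and> K \<subseteq> U \<longrightarrow>
      (\<exists>C. \<forall>t\<in>{0..T}. \<forall>Y\<in>cadlag_paths T K. \<bar>G t Y A\<bar> \<le> C)"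
    using assms(1) unfolding boundedness_preserving_def by (rule conjunct2)
  from this[rule_format, OF A, OF conjI[OF assms(2,3)]] show thesis using that by blast
qed

lemma approx_path_left_cadlag:
  assumes "s \<in> P n" "X ` {0..T} \<subseteq> K"
  shows "approx_path_left T (P n) X s \<in> cadlag_paths T K"
proof -
  have "X s \<in> K" using assms tp.P_bounds[OF assms(1)] by auto
  then show ?thesis
    using tp.bumped_cadlag[OF assms, of 0] by (simp add: tp.approx_path_left_eq_bumped[OF assms(1)])
qed

text \<open>
  \<open>U\<close> need not be convex, so the segment between two consecutive values of \<open>X\<close> lies in \<open>U\<close> only for
  fine partitions; then all interpolated paths even take values in one compact subset of \<open>U\<close>.
\<close>

lemma compact_range_of_bumped:
  obtains K where "compact K" "K \<subseteq> U" "X ` {0..T} \<subseteq> K"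
    "eventually (\<lambda>n. \<forall>s\<in>P n. \<forall>\<theta>. 0 \<le> \<theta> \<and> \<theta> \<le> 1 \<longrightarrow> tp.bumped n X s (\<theta> *\<^sub>R incr n s) \<in> cadlag_paths T K) sequentially"
proof -
  have ne: "X ` {0..T} \<noteq> {}" using T by simp
  obtain r where r: "r > 0" "{x. infdist x (X ` {0..T}) \<le> r} \<subseteq> U"
    using compact_in_open_separated[OF ne X_range_compact U X_range] .
  define K where "K = {x. infdist x (X ` {0..T}) \<le> r}"
  have XK: "X ` {0..T} \<subseteq> K" unfolding K_def using r(1) by (auto simp: infdist_zero)
  obtain \<rho> where \<rho>: "0 < \<rho>" "\<forall>x\<in>{0..T}. \<forall>y\<in>{0..T}. \<bar>x - y\<bar> \<le> \<rho> \<longrightarrow> norm (X x - X y) \<le> r"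
    using continuous_modulus[OF X_continuous r(1)] .
  have "eventually (\<lambda>n. \<forall>s\<in>P n. \<forall>\<theta>. 0 \<le> \<theta> \<and> \<theta> \<le> 1 \<longrightarrow>
      tp.bumped n X s (\<theta> *\<^sub>R incr n s) \<in> cadlag_paths T K) sequentially"
    using eventually_mesh_le[OF \<rho>(1)]
  proof eventually_elim
    case (elim n)
    show ?case
    proof (intro ballI allI impI)
      fix s \<theta> assume s: "s \<in> P n" and \<theta>: "0 \<le> \<theta> \<and> \<theta> \<le> (1::real)"
      have "norm (incr n s) \<le> r" by (rule tp.nxt_close[OF \<rho>(2) elim s])
      then have "norm (\<theta> *\<^sub>R incr n s) \<le> r"
        using \<theta> mult_left_le_one_le[of "norm (incr n s)" \<theta>] by simp
      moreover have "infdist (X s + \<theta> *\<^sub>R incr n s) (X ` {0..T}) \<le> dist (X s + \<theta> *\<^sub>R incr n s) (X s)"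
        using tp.P_bounds[OF s] by (intro infdist_le) auto
      ultimately have "X s + \<theta> *\<^sub>R incr n s \<in> K" unfolding K_def by (simp add: dist_norm)
      then show "tp.bumped n X s (\<theta> *\<^sub>R incr n s) \<in> cadlag_paths T K"
        by (rule tp.bumped_cadlag[OF s XK])
    qed
  qed
  moreover have "compact K" unfolding K_def by (rule compact_infdist_le[OF ne X_range_compact r(1)])
  ultimately show thesis using that XK r(2) unfolding K_def by blast
qed

text \<open>
  For a partition point \<open>s\<close> slightly before \<open>t\<close>, the bumped path stopped at \<open>s\<close> is uniformly close to
  \<open>X\<close> stopped at \<open>t\<close>, so left-continuity at \<open>t\<close> applies with \<open>h = t - s\<close>. The width of the left
  neighbourhood depends on \<open>t\<close>.
\<close>

lemma left_continuous_limit: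
  assumes G: "left_continuous T U S G"
    and v: "\<And>n s. s \<in> P n \<Longrightarrow> norm (v n s) \<le> norm (incr n s)"
    and cadlag: "eventually (\<lambda>n. \<forall>s\<in>P n. tp.bumped n X s (v n s) \<in> cadlag_paths T U) sequentially"
    and t: "t \<in> {0<..T}" and \<epsilon>: "0 < \<epsilon>"
  shows "\<exists>\<eta>>0. eventually (\<lambda>n. \<forall>s\<in>P n. t - \<eta> < s \<and> s \<le> t \<longrightarrow>
    \<bar>G s (tp.bumped n X s (v n s)) A - G t X A\<bar> < \<epsilon>) sequentially"
proof -
  have "\<forall>\<epsilon>>0. \<forall>X\<in>cadlag_paths T U. \<forall>A\<in>cbv_paths T S. \<exists>\<eta>>0.
      \<forall>h. 0 \<le> h \<and> h < \<eta> \<and> h \<le> t \<longrightarrow> (\<forall>Y\<in>cadlag_paths T U.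
        sup_norm T (\<lambda>u. stop T t X u - stop T (t - h) Y u) < \<eta> \<longrightarrow> \<bar>G t X A - G (t - h) Y A\<bar> < \<epsilon>)"
    using G t unfolding left_continuous_def by blast
  from this[rule_format, OF \<epsilon> X_cadlag[OF X_range] A]
  obtain \<eta> where \<eta>: "\<eta> > 0" "\<And>h Y. 0 \<le> h \<Longrightarrow> h < \<eta> \<Longrightarrow> h \<le> t \<Longrightarrow> Y \<in> cadlag_paths T U \<Longrightarrow>
      sup_norm T (\<lambda>u. stop T t X u - stop T (t - h) Y u) < \<eta> \<Longrightarrow> \<bar>G t X A - G (t - h) Y A\<bar> < \<epsilon>"
    by blast
  have "0 < \<eta> / 3" using \<eta>(1) by simp
  then obtain \<rho> where \<rho>: "0 < \<rho>"
    "\<forall>x\<in>{0..T}. \<forall>y\<in>{0..T}. \<bar>x - y\<bar> \<le> \<rho> \<longrightarrow> norm (X x - X y) \<le> \<eta> / 3"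
    using continuous_modulus[OF X_continuous] by blast
  have "eventually (\<lambda>n. \<forall>s\<in>P n. t - min \<eta> \<rho> < s \<and> s \<le> t \<longrightarrow>
    \<bar>G s (tp.bumped n X s (v n s)) A - G t X A\<bar> < \<epsilon>) sequentially"
    using eventually_mesh_le[OF \<rho>(1)] cadlag
  proof eventually_elim
    case (elim n)
    show ?case
    proof (intro ballI impI)
      fix s assume s: "s \<in> P n" and st: "t - min \<eta> \<rho> < s \<and> s \<le> t"
      have "sup_norm T (\<lambda>u. stop T t X u - stop T s (tp.bumped n X s (v n s)) u) \<le> \<eta> / 3 + norm (v n s)"
        using st t by (intro tp.sup_norm_stop_bumped_le[OF \<rho>(2) elim(1) s]) auto
      also have "norm (v n s) \<le> \<eta> / 3"
        using v[OF s] tp.nxt_close[OF \<rho>(2) elim(1) s] by linarith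
      finally have "sup_norm T (\<lambda>u. stop T t X u - stop T (t - (t - s)) (tp.bumped n X s (v n s)) u) < \<eta>"
        using \<eta>(1) by simp
      then have "\<bar>G t X A - G (t - (t - s)) (tp.bumped n X s (v n s)) A\<bar> < \<epsilon>"
        using st elim(2) s tp.P_bounds[OF s] by (intro \<eta>(2)) auto
      then show "\<bar>G s (tp.bumped n X s (v n s)) A - G t X A\<bar> < \<epsilon>" by (simp add: abs_minus_commute)
    qed
  qed
  then show ?thesis using \<eta>(1) \<rho>(1) by (intro exI[of _ "min \<eta> \<rho>"]) auto
qed

lemma terminal_value_limit:
  assumes G: "left_continuous T U S G"
  shows "(\<lambda>n. G T (approx_path_left T (P n) X T) A) \<longlonglongrightarrow> G T X A"
proof (rule LIMSEQ_I)
  fix \<epsilon> :: real assume \<epsilon>: "0 < \<epsilon>"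
  have "tp.bumped n X s 0 \<in> cadlag_paths T U" if "s \<in> P n" for n s
    using approx_path_left_cadlag[OF that X_range] by (simp add: tp.approx_path_left_eq_bumped[OF that])
  then have "\<exists>\<eta>>0. eventually (\<lambda>n. \<forall>s\<in>P n. T - \<eta> < s \<and> s \<le> T \<longrightarrow>
    \<bar>G s (tp.bumped n X s 0) A - G T X A\<bar> < \<epsilon>) sequentially"
    using T \<epsilon> by (intro left_continuous_limit[OF G]) auto
  then obtain \<eta> where \<eta>: "\<eta> > 0" "eventually (\<lambda>n. \<forall>s\<in>P n. T - \<eta> < s \<and> s \<le> T \<longrightarrow>
    \<bar>G s (tp.bumped n X s 0) A - G T X A\<bar> < \<epsilon>) sequentially" by blast
  have "eventually (\<lambda>n. norm (G T (approx_path_left T (P n) X T) A - G T X A) < \<epsilon>) sequentially"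
    using \<eta>(2)
  proof eventually_elim
    case (elim n)
    then have "\<bar>G T (tp.bumped n X T 0) A - G T X A\<bar> < \<epsilon>" using tp.P(4)[of n] \<eta>(1) by auto
    then show ?case by (simp add: tp.approx_path_left_eq_bumped[OF tp.P(4)])
  qed
  then show "\<exists>N. \<forall>n\<ge>N. norm (G T (approx_path_left T (P n) X T) A - G T X A) < \<epsilon>"
    by (simp add: eventually_sequentially)
qed

text \<open>At time \<open>0\<close> the approximating paths start from the constant path \<open>X 0\<close>, which is \<open>X\<close> stopped there.\<close>

lemma initial_value:
  assumes G: "non_anticipative T U S G"
  shows "G 0 (approx_path_left T (P n) X 0) A = G 0 X A"
proof -
  have "stop T 0 (approx_path_left T (P n) X 0) = stop T 0 X"
    using T by (auto simp: stop_def approx_path_left_def fun_eq_iff)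
  moreover have "0 \<in> {0..T}" using T by simp
  ultimately show ?thesis
    using G X_cadlag[OF X_range] approx_path_left_cadlag[OF tp.P(3) X_range, of n] A
    unfolding non_anticipative_def by metis
qed

text \<open>
  The squared increments of \<open>x\<close> are the weights of discrete measures whose distribution functions
  \<open>qv_sum\<close> converge to the quadratic variation of \<open>x\<close>.
\<close>

lemma squared_increment_limit:
  assumes x: "admits_continuous_qv T P x"
    and G: "left_continuous T U S G" "boundedness_preserving T U S G"
    and \<theta>: "\<And>n s. 0 \<le> \<theta> n s \<and> \<theta> n s \<le> 1"
  defines "c n s \<equiv> G s (tp.bumped n X s (\<theta> n s *\<^sub>R incr n s)) A"
  shows "(\<lambda>n. \<Sum>s\<in>P n. c n s * (x (succ_in T (P n) s) - x s)\<^sup>2) \<longlonglongrightarrow>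
      (\<integral>t. indicator {0..T} t * G t X A \<partial>interval_measure (qv_ext x))"
    and "(\<lambda>t. G t X A) \<in> borel_measurable (restrict_space borel {0..T})"
    and "\<exists>C. \<forall>t\<in>{0..T}. \<bar>G t X A\<bar> \<le> C"
proof -
  obtain K where K: "compact K" "K \<subseteq> U" "X ` {0..T} \<subseteq> K"
    "eventually (\<lambda>n. \<forall>s\<in>P n. \<forall>\<theta>. 0 \<le> \<theta> \<and> \<theta> \<le> 1 \<longrightarrow> tp.bumped n X s (\<theta> *\<^sub>R incr n s) \<in> cadlag_paths T K) sequentially"
    by (rule compact_range_of_bumped)
  obtain C where C: "\<And>t Y. t \<in> {0..T} \<Longrightarrow> Y \<in> cadlag_paths T K \<Longrightarrow> \<bar>G t Y A\<bar> \<le> C"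
    using boundedness_preservingE[OF G(2) K(1,2)] by blast
  have \<phi>C: "\<bar>G t X A\<bar> \<le> C" if "t \<in> {0..T}" for t
    using C[OF that X_cadlag[OF K(3)]] .
  have cadlag: "eventually (\<lambda>n. \<forall>s\<in>P n. tp.bumped n X s (\<theta> n s *\<^sub>R incr n s) \<in> cadlag_paths T K) sequentially"
    using K(4) \<theta> by (auto elim!: eventually_mono)
  then have cadlagU: "eventually (\<lambda>n. \<forall>s\<in>P n. tp.bumped n X s (\<theta> n s *\<^sub>R incr n s) \<in> cadlag_paths T U) sequentially"
    using cadlag_paths_mono[OF K(2)] by (auto elim!: eventually_mono)
  have small: "norm (\<theta> n s *\<^sub>R incr n s) \<le> norm (incr n s)" for n s
    using \<theta>[of n s] by (simp add: mult_left_le_one_le)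
  interpret left_uniform_weak_limit T C P "\<lambda>n s. (x (succ_in T (P n) s) - x s)\<^sup>2" c "qv_ext x" "\<lambda>t. G t X A"
  proof
    show "eventually (\<lambda>n. \<exists>t\<in>P n. s - \<eta> < t \<and> t \<le> s) sequentially" if "s \<in> {0<..T}" "0 < \<eta>" for s \<eta>
      by (rule partition_dense_left[OF that])
    show "mono (qv_ext x)" "continuous_on UNIV (qv_ext x)" "qv_ext x 0 = 0"
      using mono_qv_ext[OF x] continuous_qv_ext[OF x] qv_ext_0[OF x] by auto
    show "(\<lambda>n. \<Sum>s | s \<in> P n \<and> s \<le> t. (x (succ_in T (P n) s) - x s)\<^sup>2) \<longlonglongrightarrow> qv_ext x t" if "t \<in> {0..T}" for t
      using qv_sum_tendsto[OF x that] qv_ext_eq[OF x that] by (simp add: qv_sum_def)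
    show "eventually (\<lambda>n. \<forall>s\<in>P n. \<bar>c n s\<bar> \<le> C) sequentially"
      using cadlag
    proof eventually_elim
      case (elim n) then show ?case unfolding c_def using C tp.P(2)[of n] by blast
    qed
    show "\<exists>\<eta>>0. eventually (\<lambda>n. \<forall>s\<in>P n. t - \<eta> < s \<and> s \<le> t \<longrightarrow> \<bar>c n s - G t X A\<bar> < \<epsilon>) sequentially"
      if "t \<in> {0<..T}" "0 < \<epsilon>" for t \<epsilon>
      unfolding c_def by (rule left_continuous_limit[OF G(1) small cadlagU that])
  qed (use T tp.P \<phi>C in auto)
  show "(\<lambda>n. \<Sum>s\<in>P n. c n s * (x (succ_in T (P n) s) - x s)\<^sup>2) \<longlonglongrightarrow>
      (\<integral>t. indicator {0..T} t * G t X A \<partial>interval_measure (qv_ext x))"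
    by (rule left_uniform_integral_limit)
  show "(\<lambda>t. G t X A) \<in> borel_measurable (restrict_space borel {0..T})"
    by (rule limit_integrand_measurable)
  show "\<exists>C. \<forall>t\<in>{0..T}. \<bar>G t X A\<bar> \<le> C" using \<phi>C by blast
qed

text \<open>
  Polarisation: products of increments are combinations of the squared increments of
  \<open>X\<^sub>i + X\<^sub>j\<close>, \<open>X\<^sub>i\<close> and \<open>X\<^sub>j\<close>, and \<open>qcov\<close> is the same combination of their quadratic variations.
\<close>

lemma mixed_increment_limit:
  assumes qv: "admits_continuous_qv_vec T P X"
    and G: "left_continuous T U S G" "boundedness_preserving T U S G"
    and \<theta>: "\<And>n s. 0 \<le> \<theta> n s \<and> \<theta> n s \<le> 1"
  shows "LS_integrable 0 T (\<lambda>t. G t X A) (qcov T P X i j)"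
    and "(\<lambda>n. \<Sum>s\<in>P n. G s (tp.bumped n X s (\<theta> n s *\<^sub>R incr n s)) A * (incr n s $ i * incr n s $ j)) \<longlonglongrightarrow>
      LS_integral 0 T (\<lambda>t. G t X A) (qcov T P X i j)"
proof -
  define x where "x k = (if k = 0 then (\<lambda>t. X t $ i + X t $ j) else if k = 1 then (\<lambda>t. X t $ i) else (\<lambda>t. X t $ j))" for k :: nat
  define e :: "nat \<Rightarrow> real" where "e k = (if k = 0 then 1 / 2 else - 1 / 2)" for k
  have x: "admits_continuous_qv T P (x k)" for k
    using qv admits_continuous_qv_component[OF qv] unfolding x_def admits_continuous_qv_vec_def by simp
  note lim = squared_increment_limit[OF x G \<theta>]
  obtain C where C: "\<And>t. t \<in> {0..T} \<Longrightarrow> \<bar>G t X A\<bar> \<le> C" using lim(3) by blast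
  have sum3: "(\<Sum>k\<in>{..<3}. h k) = h 0 + h 1 + h 2" for h :: "nat \<Rightarrow> real"
    by (simp add: numeral_3_eq_3 numeral_2_eq_2)
  have decomp: "qcov T P X i j t - qcov T P X i j 0 = (\<Sum>k\<in>{..<3}. e k * (qv_ext (x k) t - qv_ext (x k) 0))"
    if "t \<in> {0..T}" for t
    using qv_ext_eq[OF x that] qv_ext_0[OF x]
    by (simp add: sum3 e_def qcov_def qv_def x_def diff_divide_distrib)
  note LS = LS_integral_combination[OF less_imp_le[OF T] _ mono_qv_ext[OF x] continuous_qv_ext[OF x] decomp lim(2) C, simplified]
  show "LS_integrable 0 T (\<lambda>t. G t X A) (qcov T P X i j)" by (rule LS(1))
  have "G s (tp.bumped n X s (\<theta> n s *\<^sub>R incr n s)) A * (incr n s $ i * incr n s $ j) =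
    (\<Sum>k\<in>{..<3}. e k * (G s (tp.bumped n X s (\<theta> n s *\<^sub>R incr n s)) A * (x k (succ_in T (P n) s) - x k s)\<^sup>2))" for n s
    unfolding sum3 by (simp add: x_def e_def power2_eq_square algebra_simps)
  then have "(\<Sum>s\<in>P n. G s (tp.bumped n X s (\<theta> n s *\<^sub>R incr n s)) A * (incr n s $ i * incr n s $ j)) =
    (\<Sum>k\<in>{..<3}. e k * (\<Sum>s\<in>P n. G s (tp.bumped n X s (\<theta> n s *\<^sub>R incr n s)) A * (x k (succ_in T (P n) s) - x k s)\<^sup>2))" for n
    by (simp only: sum_distrib_left) (rule sum.swap)
  moreover have "(\<lambda>n. \<Sum>k\<in>{..<3}. e k * (\<Sum>s\<in>P n. G s (tp.bumped n X s (\<theta> n s *\<^sub>R incr n s)) A * (x k (succ_in T (P n) s) - x k s)\<^sup>2))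
     \<longlonglongrightarrow> (\<Sum>k\<in>{..<3}. e k * (\<integral>t. indicator {0..T} t * G t X A \<partial>interval_measure (qv_ext (x k))))"
    by (intro tendsto_sum tendsto_mult_left lim(1))
  ultimately show "(\<lambda>n. \<Sum>s\<in>P n. G s (tp.bumped n X s (\<theta> n s *\<^sub>R incr n s)) A * (incr n s $ i * incr n s $ j)) \<longlonglongrightarrow>
      LS_integral 0 T (\<lambda>t. G t X A) (qcov T P X i j)"
    using LS(2) by simp
qed

lemma integrator_continuous: "continuous_on {0..T} (integrator A i)"
proof (cases i)
  case None
  then have "integrator A i = (\<lambda>r. r)" by (simp add: fun_eq_iff)
  then show ?thesis by simp
next
  case (Some k)
  then have "integrator A i = (\<lambda>r. A r $ k)" by (simp add: fun_eq_iff)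
  then show ?thesis using A unfolding cbv_paths_def cont_paths_def by (auto intro!: continuous_intros)
qed

lemma integrator_bounded_variation: "bounded_variation (integrator A i) 0 T"
proof (cases i)
  case None
  have "bounded_variation (\<lambda>r. r) 0 T"
    by (rule bounded_variation_combination[where J = "{()}" and p = "\<lambda>_ r. r" and e = "\<lambda>_. 1"]) (auto simp: mono_def)
  moreover have "integrator A i = (\<lambda>r. r)" using None by (simp add: fun_eq_iff)
  ultimately show ?thesis by simp
next
  case (Some k)
  then have "integrator A i = (\<lambda>r. A r $ k)" by (simp add: fun_eq_iff)
  then show ?thesis using A unfolding cbv_paths_def by auto
qed

text \<open>
  Written with one Jordan decomposition of the integrator on \<open>[0,T]\<close>, the integrals over the cells
  add up to a single integral of a function that converges pointwise and boundedly.
\<close>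

lemma horizontal_limit:
  fixes D :: "('d, 'm) path_functional"
  assumes bp: "boundedness_preserving T U S D" and cft: "continuous_at_fixed_times T U S D"
    and meas: "\<And>s t Y. 0 \<le> s \<Longrightarrow> s < t \<Longrightarrow> t \<le> T \<Longrightarrow> Y \<in> cadlag_paths T U \<Longrightarrow>
      (\<lambda>r. D r (stop T s Y) A) \<in> borel_measurable (restrict_space borel {s..t})"
  shows "LS_integrable 0 T (\<lambda>r. D r X A) (integrator A i)"
    and "(\<lambda>n. \<Sum>s\<in>P n - {T}. LS_integral s (succ_in T (P n) s)
        (\<lambda>r. D r (approx_path_left T (P n) X (succ_in T (P n) s)) A) (integrator A i)) \<longlonglongrightarrow>
      LS_integral 0 T (\<lambda>r. D r X A) (integrator A i)"
proof -
  let ?N = "\<lambda>n s. succ_in T (P n) s"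
  let ?Y = "\<lambda>n s. approx_path_left T (P n) X (succ_in T (P n) s)"
  let ?g = "integrator A i"
  define p where "p b = (if b then pos_variation ?g 0 T else neg_variation ?g 0 T)" for b
  define e :: "bool \<Rightarrow> real" where "e b = (if b then 1 else - 1)" for b
  have T0: "0 \<le> T" using T by simp
  have p: "mono (p b)" "continuous_on UNIV (p b)" for b
    using mono_pos_variation[OF T0 integrator_continuous integrator_bounded_variation]
      mono_neg_variation[OF T0 integrator_continuous integrator_bounded_variation]
      continuous_pos_variation[OF T0 integrator_continuous integrator_bounded_variation]
      continuous_neg_variation[OF T0 integrator_continuous integrator_bounded_variation]
    unfolding p_def by auto
  have decomp: "?g x - ?g a = (\<Sum>b\<in>UNIV. e b * (p b x - p b a))" if "x \<in> {0..T}" "a \<in> {0..T}" for x a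
    using jordan_decomposition[OF that(1), of ?g] jordan_decomposition[OF that(2), of ?g]
    by (simp add: UNIV_bool e_def p_def)
  obtain C where C: "\<And>t Y. t \<in> {0..T} \<Longrightarrow> Y \<in> cadlag_paths T (X ` {0..T}) \<Longrightarrow> \<bar>D t Y A\<bar> \<le> C"
    using boundedness_preservingE[OF bp X_range_compact X_range] by blast
  have C0: "0 \<le> C" using C[of 0 X] X_cadlag[OF order_refl] T by force
  have less_T: "s < T" if "s \<in> P n - {T}" for n s using tp.P_bounds[of s n] that by auto
  have cell: "s \<in> P n" "s < T" "0 \<le> s" "s < ?N n s" "?N n s \<le> T" "?N n s \<in> P n" if "s \<in> P n - {T}" for n s
    using that less_T[OF that] tp.P_bounds[of s n] tp.nxt_gt[of s n] tp.nxt_bounds[of s n] by auto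
  have YK: "?Y n s \<in> cadlag_paths T (X ` {0..T})" and YU: "?Y n s \<in> cadlag_paths T U" if "s \<in> P n - {T}" for n s
    using approx_path_left_cadlag[OF cell(6)[OF that]] X_range by auto
  \<comment> \<open>On the cell the path is frozen at its left end, the form in which horizontal derivatives are integrated.\<close>
  have stopY: "stop T s (?Y n s) = ?Y n s" if "s \<in> P n - {T}" for n s
    using cell[OF that] by (simp add: tp.approx_path_left_next tp.stop_bumped)
  have measY: "(\<lambda>r. D r (?Y n s) A) \<in> borel_measurable (restrict_space borel {s..?N n s})" if "s \<in> P n - {T}" for n s
    using meas[OF cell(3,4,5)[OF that] YU[OF that]] stopY[OF that] by simp
  have boundY: "\<bar>D r (?Y n s) A\<bar> \<le> C" if "s \<in> P n - {T}" "r \<in> {s..?N n s}" for n s r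
    using C[OF _ YK[OF that(1)], of r] cell[OF that(1)] that(2) by auto
  \<comment> \<open>Half-open cells make the integrands add up without overlap; the endpoints are null sets.\<close>
  define H where "H n r = (\<Sum>s\<in>P n - {T}. indicator {s..<?N n s} r * D r (?Y n s) A)" for n r
  have term_meas: "(\<lambda>r. indicator {s..<?N n s} r * D r (?Y n s) A) \<in> borel_measurable borel" if "s \<in> P n - {T}" for n s
  proof -
    have "(\<lambda>r. indicator {s..<?N n s} r * (indicator {s..?N n s} r * D r (?Y n s) A)) \<in> borel_measurable borel"
      using indicator_mult_measurable[OF measY[OF that]] by simp
    also have "(\<lambda>r. indicator {s..<?N n s} r * (indicator {s..?N n s} r * D r (?Y n s) A)) =
        (\<lambda>r. indicator {s..<?N n s} r * D r (?Y n s) A)"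
      by (auto simp: indicator_def fun_eq_iff)
    finally show ?thesis .
  qed
  have H_meas: "H n \<in> borel_measurable borel" for n
    unfolding H_def by (intro borel_measurable_sum term_meas)
  have H_cell: "H n r = D r (?Y n s) A" if "s \<in> P n - {T}" "s \<le> r" "r < ?N n s" for n s r
  proof -
    have "H n r = (\<Sum>q\<in>P n - {T}. if q = s then D r (?Y n s) A else 0)"
      unfolding H_def
    proof (intro sum.cong refl)
      fix q assume q: "q \<in> P n - {T}"
      show "indicator {q..<?N n q} r * D r (?Y n q) A = (if q = s then D r (?Y n s) A else 0)"
      proof (cases "q = s")
        case False
        then have "r \<notin> {q..<?N n q}" using tp.cell_unique[of s n q r] that q by auto
        then show ?thesis using False by simp
      qed (use that in simp)
    qed
    then show ?thesis using that(1) tp.P(1)[of n] by simp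
  qed
  have H_outside: "H n r = 0" if "r \<notin> {0..<T}" for n r
    unfolding H_def
  proof (intro sum.neutral ballI)
    fix s assume "s \<in> P n - {T}"
    then have "r \<notin> {s..<?N n s}" using that cell[of s n] by auto
    then show "indicator {s..<?N n s} r * D r (?Y n s) A = 0" by simp
  qed
  have H_bound: "\<bar>H n r\<bar> \<le> indicator {0..T} r * C" for n r
  proof (cases "r \<in> {0..<T}")
    case True
    then obtain s where s: "s \<in> P n" "s < T" "s \<le> r" "r < ?N n s" using tp.cell_right[of r n] by auto
    then have "\<bar>D r (?Y n s) A\<bar> \<le> C" by (intro boundY) auto
    then show ?thesis using H_cell[of s n r] s True by simp
  qed (use H_outside C0 in simp)
  have H_lim: "(\<lambda>n. H n r) \<longlonglongrightarrow> indicator {0..<T} r * D r X A" for r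
  proof (cases "r \<in> {0..<T}")
    case r: True
    have "(\<lambda>n. H n r) \<longlonglongrightarrow> D r X A"
    proof (rule LIMSEQ_I)
      fix \<epsilon> :: real assume "0 < \<epsilon>"
      have "\<forall>\<epsilon>>0. \<forall>t\<in>{0..T}. \<forall>X\<in>cadlag_paths T U. \<forall>A\<in>cbv_paths T S. \<exists>\<eta>>0. \<forall>Y\<in>cadlag_paths T U.
          sup_norm T (\<lambda>u. stop T t X u - stop T t Y u) < \<eta> \<longrightarrow> \<bar>D t X A - D t Y A\<bar> < \<epsilon>"
        using cft unfolding continuous_at_fixed_times_def by blast
      moreover have "r \<in> {0..T}" using r by simp
      ultimately have "\<exists>\<eta>>0. \<forall>Y\<in>cadlag_paths T U.
          sup_norm T (\<lambda>u. stop T r X u - stop T r Y u) < \<eta> \<longrightarrow> \<bar>D r X A - D r Y A\<bar> < \<epsilon>"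
        using X_cadlag[OF X_range] A \<open>0 < \<epsilon>\<close> by blast
      then obtain \<eta> where \<eta>: "\<eta> > 0" "\<And>Y. Y \<in> cadlag_paths T U \<Longrightarrow>
          sup_norm T (\<lambda>u. stop T r X u - stop T r Y u) < \<eta> \<Longrightarrow> \<bar>D r X A - D r Y A\<bar> < \<epsilon>"
        by blast
      obtain \<rho> where \<rho>: "0 < \<rho>" "\<forall>x\<in>{0..T}. \<forall>y\<in>{0..T}. \<bar>x - y\<bar> \<le> \<rho> \<longrightarrow> norm (X x - X y) \<le> \<eta> / 2"
        using continuous_modulus[OF X_continuous, of "\<eta> / 2"] \<eta>(1) by auto
      have "eventually (\<lambda>n. norm (H n r - D r X A) < \<epsilon>) sequentially"
        using eventually_mesh_le[OF \<rho>(1)]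
      proof eventually_elim
        case (elim n)
        obtain s where s: "s \<in> P n" "s < T" "s \<le> r" "r < ?N n s" using tp.cell_right[of r n] r by auto
        have "sup_norm T (\<lambda>u. stop T r X u - stop T r (?Y n s) u) \<le> \<eta> / 2"
          by (rule tp.sup_norm_stop_cell_le[OF \<rho>(2) elim s])
        then have "\<bar>D r X A - D r (?Y n s) A\<bar> < \<epsilon>" using \<eta>(1) YU[of s n] s by (intro \<eta>(2)) auto
        then show ?case using H_cell[of s n r] s by (simp add: abs_minus_commute)
      qed
      then show "\<exists>N. \<forall>n\<ge>N. norm (H n r - D r X A) < \<epsilon>" by (simp add: eventually_sequentially)
    qed
    then show ?thesis using r by simp
  qed (use H_outside in simp)
  have lim_meas: "(\<lambda>r. indicator {0..<T} r * D r X A) \<in> borel_measurable borel"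
    by (rule borel_measurable_LIMSEQ_real[OF H_lim H_meas])
  then have "(\<lambda>r. indicator {0..<T} r * D r X A + indicator {T} r * D T X A) \<in> borel_measurable borel" by simp
  also have "(\<lambda>r. indicator {0..<T} r * D r X A + indicator {T} r * D T X A) = (\<lambda>r. indicator {0..T} r * D r X A)"
    using T by (auto simp: indicator_def fun_eq_iff)
  finally have X_meas: "(\<lambda>r. D r X A) \<in> borel_measurable (restrict_space borel {0..T})"
    by (simp add: borel_measurable_restrict_space_iff)
  have XC: "\<bar>D r X A\<bar> \<le> C" if "r \<in> {0..T}" for r using C[OF that X_cadlag[OF order_refl]] .
  have decomp0: "?g x - ?g 0 = (\<Sum>b\<in>UNIV. e b * (p b x - p b 0))" if "x \<in> {0..T}" for x
    using decomp[OF that] T by simp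
  note LS = LS_integral_combination[OF T0 finite p decomp0 X_meas XC]
  show "LS_integrable 0 T (\<lambda>r. D r X A) ?g" by (rule LS(1))
  have LS_X: "LS_integral 0 T (\<lambda>r. D r X A) ?g = (\<Sum>b\<in>UNIV. e b * (\<integral>r. indicator {0..T} r * D r X A \<partial>interval_measure (p b)))"
    by (rule LS(2))
  have term_int: "integrable (interval_measure (p b)) (\<lambda>r. indicator {s..<?N n s} r * D r (?Y n s) A)" if "s \<in> P n - {T}" for n s b
  proof -
    have "integrable (interval_measure (p b)) (\<lambda>r. indicator {s..?N n s} r * (indicator {s..<?N n s} r * D r (?Y n s) A))"
      using boundY[OF that] C0 by (intro integrable_interval_measure_bounded[OF p term_meas[OF that], of _ _ C]) (auto simp: indicator_def)
    also have "(\<lambda>r. indicator {s..?N n s} r * (indicator {s..<?N n s} r * D r (?Y n s) A)) =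
        (\<lambda>r. indicator {s..<?N n s} r * D r (?Y n s) A)"
      by (auto simp: indicator_def fun_eq_iff)
    finally show ?thesis .
  qed
  have half_open: "(\<integral>r. indicator {a..c} r * f r \<partial>interval_measure (p b)) = (\<integral>r. indicator {a..<c} r * f r \<partial>interval_measure (p b))"
    if "(\<lambda>r. indicator {a..c} r * f r) \<in> borel_measurable borel" "(\<lambda>r. indicator {a..<c} r * f r) \<in> borel_measurable borel"
    for a c b and f :: "real \<Rightarrow> real"
  proof (rule integral_cong_AE)
    show "AE r in interval_measure (p b). indicator {a..c} r * f r = indicator {a..<c} r * f r"
      using AE_interval_measure_neq[OF p, of c] by eventually_elim (auto simp: indicator_def)
  qed (use that in simp_all)
  have sum_eq: "(\<Sum>s\<in>P n - {T}. LS_integral s (?N n s) (\<lambda>r. D r (?Y n s) A) ?g) =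
      (\<Sum>b\<in>UNIV. e b * (\<integral>r. H n r \<partial>interval_measure (p b)))" for n
  proof -
    have "LS_integral s (?N n s) (\<lambda>r. D r (?Y n s) A) ?g =
        (\<Sum>b\<in>UNIV. e b * (\<integral>r. indicator {s..<?N n s} r * D r (?Y n s) A \<partial>interval_measure (p b)))" if s: "s \<in> P n - {T}" for s
    proof -
      have "LS_integral s (?N n s) (\<lambda>r. D r (?Y n s) A) ?g =
        (\<Sum>b\<in>UNIV. e b * (\<integral>r. indicator {s..?N n s} r * D r (?Y n s) A \<partial>interval_measure (p b)))"
      proof (rule LS_integral_combination(2)[OF _ finite p _ measY[OF s] boundY[OF s]])
        show "s \<le> ?N n s" using cell[OF s] by simp
        show "?g x - ?g s = (\<Sum>b\<in>UNIV. e b * (p b x - p b s))" if "x \<in> {s..?N n s}" for x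
          using that cell[OF s] by (intro decomp) auto
      qed
      then show ?thesis
        using half_open[OF indicator_mult_measurable[OF measY[OF s]] term_meas[OF s]] by simp
    qed
    then have "(\<Sum>s\<in>P n - {T}. LS_integral s (?N n s) (\<lambda>r. D r (?Y n s) A) ?g) =
      (\<Sum>b\<in>UNIV. e b * (\<Sum>s\<in>P n - {T}. \<integral>r. indicator {s..<?N n s} r * D r (?Y n s) A \<partial>interval_measure (p b)))"
      by (simp only: sum_distrib_left cong: sum.cong) (rule sum.swap)
    then show ?thesis
      unfolding H_def using term_int by (subst Bochner_Integration.integral_sum) auto
  qed
  have "(\<lambda>n. \<integral>r. H n r \<partial>interval_measure (p b)) \<longlonglongrightarrow> (\<integral>r. indicator {0..<T} r * D r X A \<partial>interval_measure (p b))" for b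
  proof (rule integral_dominated_convergence)
    show "integrable (interval_measure (p b)) (\<lambda>r. indicator {0..T} r * C)"
      by (rule integrable_interval_measure_bounded[OF p, of _ _ _ C]) (use C0 in auto)
  qed (use lim_meas H_meas H_lim H_bound in auto)
  moreover have "(\<integral>r. indicator {0..<T} r * D r X A \<partial>interval_measure (p b)) = (\<integral>r. indicator {0..T} r * D r X A \<partial>interval_measure (p b))" for b
    by (rule half_open[OF indicator_mult_measurable[OF X_meas] lim_meas, symmetric])
  ultimately have "(\<lambda>n. \<Sum>b\<in>UNIV. e b * (\<integral>r. H n r \<partial>interval_measure (p b))) \<longlonglongrightarrow>
      (\<Sum>b\<in>UNIV. e b * (\<integral>r. indicator {0..T} r * D r X A \<partial>interval_measure (p b)))"
    by (intro tendsto_sum tendsto_mult_left) simp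
  then show "(\<lambda>n. \<Sum>s\<in>P n - {T}. LS_integral s (?N n s) (\<lambda>r. D r (?Y n s) A) ?g) \<longlonglongrightarrow> LS_integral 0 T (\<lambda>r. D r X A) ?g"
    unfolding sum_eq LS_X .
qed

end

section \<open>The change of variables formula\<close>

theorem theorem2p1:
  fixes T :: real
    and U :: "(real ^ 'd) set"
    and S :: "(real ^ 'm) set"
    and P :: "nat \<Rightarrow> real set"
    and X :: "real \<Rightarrow> real ^ 'd"
    and A :: "real \<Rightarrow> real ^ 'm"
    and F :: "('d::finite, 'm::finite) path_functional"
    and DF :: "'m::finite option \<Rightarrow> ('d::finite, 'm::finite) path_functional"
  assumes "T > 0" and "open U" and "open S"
    and "refining_partitions T P"
    and "X \<in> cont_paths T U"
    and "admits_continuous_qv_vec T P X"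
    and "A \<in> cbv_paths T S"
    and "F \<in> C12b T U S"
    and "is_horizontal_derivative T U S F DF"
    and "\<forall>i. continuous_at_fixed_times T U S (DF i)"
  shows "convergent (\<lambda>n. ito_sum T (P n) F X A) \<and>
    (\<forall>i. LS_integrable 0 T (\<lambda>s. DF i s X A) (integrator A i)) \<and>
    (\<forall>i j. LS_integrable 0 T (\<lambda>s. vpartial T i (vpartial T j F) s X A) (qcov T P X i j)) \<and>
    F T X A - F 0 X A =
      pathwise_ito_integral T P F X A +
      (\<Sum>i\<in>UNIV. LS_integral 0 T (\<lambda>s. DF i s X A) (integrator A i)) +
      1 / 2 * (\<Sum>i\<in>UNIV. \<Sum>j\<in>UNIV.
        LS_integral 0 T (\<lambda>s. vpartial T i (vpartial T j F) s X A) (qcov T P X i j))"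
proof -
  interpret ito_setting T P U S X A
    using assms by unfold_locales
  note qv = assms(6)
  have F: "non_anticipative T U S F" "left_continuous T U S F" "twice_vertically_differentiable T U S F"
    and F2: "\<And>i j. left_continuous T U S (vpartial T i (vpartial T j F))"
      "\<And>i j. boundedness_preserving T U S (vpartial T i (vpartial T j F))"
    using assms(8) unfolding C12b_def by auto
  have hor: "F t (stop T s Y) A - F s (stop T s Y) A =
      (\<Sum>i\<in>UNIV. LS_integral s t (\<lambda>r. DF i r (stop T s Y) A) (integrator A i))"
    and hor_meas: "\<And>i. (\<lambda>r. DF i r (stop T s Y) A) \<in> borel_measurable (restrict_space borel {s..t})"
    if "0 \<le> s" "s < t" "t \<le> T" "Y \<in> cadlag_paths T U" for s t Y
    using assms(9) that A unfolding is_horizontal_derivative_def by blast+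
  have hor_bp: "boundedness_preserving T U S (DF i)" for i
    using assms(9) unfolding is_horizontal_derivative_def by blast
  have hor_cft: "continuous_at_fixed_times T U S (DF i)" for i
    using assms(10) by blast
  note H = horizontal_limit[OF hor_bp hor_cft hor_meas]
  let ?N = "\<lambda>n s. succ_in T (P n) s"
  let ?Y = "\<lambda>n s. approx_path_left T (P n) X s"
  let ?V = "\<lambda>i j. vpartial T i (vpartial T j F)"
  let ?second = "\<lambda>n s v. \<Sum>i\<in>UNIV. \<Sum>j\<in>UNIV. ?V i j s (tp.bumped n X s v) A * (incr n s $ i * incr n s $ j)"
  let ?vert = "\<lambda>n s \<theta>. F s (?Y n (?N n s)) A - F s (?Y n s) A =
      vgrad T F s (?Y n s) A \<bullet> incr n s + 1 / 2 * ?second n s (\<theta> *\<^sub>R incr n s)"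
  obtain K where K: "compact K" "K \<subseteq> U" "X ` {0..T} \<subseteq> K"
    "eventually (\<lambda>n. \<forall>s\<in>P n. \<forall>\<theta>. 0 \<le> \<theta> \<and> \<theta> \<le> 1 \<longrightarrow> tp.bumped n X s (\<theta> *\<^sub>R incr n s) \<in> cadlag_paths T K) sequentially"
    by (rule compact_range_of_bumped)
  define small_mesh where "small_mesh n \<longleftrightarrow> (\<forall>s\<in>P n. \<forall>\<theta>. 0 \<le> \<theta> \<and> \<theta> \<le> 1 \<longrightarrow>
      tp.bumped n X s (\<theta> *\<^sub>R incr n s) \<in> cadlag_paths T U)" for n
  have small_mesh: "eventually small_mesh sequentially"
    using K(4)
  proof eventually_elim
    case (elim n)
    then show ?case unfolding small_mesh_def using cadlag_paths_mono[OF K(2)] by blast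
  qed
  have ex: "\<exists>\<theta>. 0 \<le> \<theta> \<and> \<theta> \<le> 1 \<and> (small_mesh n \<and> s \<in> P n - {T} \<longrightarrow> ?vert n s \<theta>)" for n s
  proof (cases "small_mesh n \<and> s \<in> P n - {T}")
    case True
    then have s: "s \<in> P n" "s < T" "s \<in> {0..T}" using tp.P_bounds[of s n] by auto
    have b: "bump T s v (?Y n s) = tp.bumped n X s v" for v by (simp add: tp.bumped_def)
    obtain \<theta> where \<theta>: "0 < \<theta>" "\<theta> < 1"
      "F s (bump T s (incr n s) (?Y n s)) A = F s (bump T s 0 (?Y n s)) A +
        (\<Sum>j\<in>UNIV. incr n s $ j * vpartial T j F s (bump T s 0 (?Y n s)) A) +
        1 / 2 * (\<Sum>i\<in>UNIV. \<Sum>j\<in>UNIV. ?V i j s (bump T s (\<theta> *\<^sub>R incr n s) (?Y n s)) A * (incr n s $ i * incr n s $ j))"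
      by (rule vertical_taylor[OF F(3) s(3) A, of "incr n s" "?Y n s"])
        (use True s(1) in \<open>auto simp: b small_mesh_def\<close>)
    have "?vert n s \<theta>"
      using \<theta>(3) unfolding b tp.approx_path_left_next[OF s(1,2)] tp.approx_path_left_eq_bumped[OF s(1), symmetric]
      by (simp add: vgrad_def inner_vec_def mult.commute)
    then show ?thesis using \<theta>(1,2) by (intro exI[of _ \<theta>]) auto
  qed (auto intro: exI[of _ 0])
  \<comment> \<open>The limit lemmas want one function \<open>\<theta>\<close> for all \<open>n\<close>; on coarse partitions its values are arbitrary in \<open>[0,1]\<close>.\<close>
  define \<theta> where "\<theta> n s = (SOME \<theta>. 0 \<le> \<theta> \<and> \<theta> \<le> 1 \<and> (small_mesh n \<and> s \<in> P n - {T} \<longrightarrow> ?vert n s \<theta>))" for n s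
  have \<theta>: "0 \<le> \<theta> n s \<and> \<theta> n s \<le> 1"
    and vert: "small_mesh n \<Longrightarrow> s \<in> P n - {T} \<Longrightarrow> ?vert n s (\<theta> n s)" for n s
    using someI_ex[OF ex[of n s]] unfolding \<theta>_def by blast+
  note M = mixed_increment_limit[OF qv F2 \<theta>]
  define h where "h n = (\<Sum>i\<in>UNIV. \<Sum>s\<in>P n - {T}. LS_integral s (?N n s) (\<lambda>r. DF i r (?Y n (?N n s)) A) (integrator A i))" for n
  define q where "q n = (\<Sum>i\<in>UNIV. \<Sum>j\<in>UNIV. \<Sum>s\<in>P n. ?V i j s (tp.bumped n X s (\<theta> n s *\<^sub>R incr n s)) A * (incr n s $ i * incr n s $ j))" for n
  have h: "h \<longlonglongrightarrow> (\<Sum>i\<in>UNIV. LS_integral 0 T (\<lambda>s. DF i s X A) (integrator A i))"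
    unfolding h_def by (intro tendsto_sum H(2))
  have q: "q \<longlonglongrightarrow> (\<Sum>i\<in>UNIV. \<Sum>j\<in>UNIV. LS_integral 0 T (\<lambda>s. ?V i j s X A) (qcov T P X i j))"
    unfolding q_def by (intro tendsto_sum M(2))
  have "F T (?Y n T) A - F 0 X A = ito_sum T (P n) F X A + h n + 1 / 2 * q n" if "small_mesh n" for n
  proof -
    \<comment> \<open>The intermediate value is at time \<open>s\<close> on the path of the next point, which is already constant from \<open>s\<close> on.\<close>
    have step: "F (?N n s) (?Y n (?N n s)) A - F s (?Y n s) A =
        (\<Sum>i\<in>UNIV. LS_integral s (?N n s) (\<lambda>r. DF i r (?Y n (?N n s)) A) (integrator A i)) +
        (vgrad T F s (?Y n s) A \<bullet> incr n s + 1 / 2 * ?second n s (\<theta> n s *\<^sub>R incr n s))" if s: "s \<in> P n - {T}" for s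
    proof -
      have sP: "s \<in> P n" "s < T" using s tp.P_bounds[of s n] by auto
      have "?Y n (?N n s) \<in> cadlag_paths T U"
        by (rule approx_path_left_cadlag[OF tp.nxt_mem[OF sP] X_range])
      from hor[OF _ tp.nxt_gt[OF sP] _ this]
      have "F (?N n s) (?Y n (?N n s)) A - F s (?Y n (?N n s)) A =
        (\<Sum>i\<in>UNIV. LS_integral s (?N n s) (\<lambda>r. DF i r (?Y n (?N n s)) A) (integrator A i))"
        using tp.P_bounds[OF sP(1)] tp.nxt_bounds[OF sP(1)]
        by (simp add: tp.approx_path_left_next[OF sP] tp.stop_bumped[OF sP(1)])
      then show ?thesis using vert[OF \<open>small_mesh n\<close> s] by linarith
    qed
    \<comment> \<open>At \<open>T\<close> the successor is \<open>T\<close> itself, so the increment of \<open>X\<close> vanishes.\<close>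
    have noT: "(\<Sum>s\<in>P n - {T}. g s) = (\<Sum>s\<in>P n. g s)" if "g T = 0" for g :: "real \<Rightarrow> real"
      using tp.P(1,4)[of n] that by (simp add: sum_diff1)
    have "F T (?Y n T) A - F 0 (?Y n 0) A = (\<Sum>s\<in>P n - {T}. F (?N n s) (?Y n (?N n s)) A - F s (?Y n s) A)"
      using tp.telescope[of "\<lambda>s. F s (?Y n s) A" n] by simp
    also have "\<dots> = (\<Sum>s\<in>P n - {T}. \<Sum>i\<in>UNIV. LS_integral s (?N n s) (\<lambda>r. DF i r (?Y n (?N n s)) A) (integrator A i)) +
       ((\<Sum>s\<in>P n - {T}. vgrad T F s (?Y n s) A \<bullet> incr n s) + 1 / 2 * (\<Sum>s\<in>P n - {T}. ?second n s (\<theta> n s *\<^sub>R incr n s)))"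
      by (subst sum.cong[OF refl step]) (assumption, simp only: sum.distrib sum_distrib_left)
    also have "(\<Sum>s\<in>P n - {T}. vgrad T F s (?Y n s) A \<bullet> incr n s) = ito_sum T (P n) F X A"
      unfolding ito_sum_def by (rule noT) simp
    also have "(\<Sum>s\<in>P n - {T}. ?second n s (\<theta> n s *\<^sub>R incr n s)) = (\<Sum>s\<in>P n. ?second n s (\<theta> n s *\<^sub>R incr n s))"
      by (rule noT) simp
    also have "\<dots> = q n"
      unfolding q_def by (subst sum.swap) (intro sum.cong refl sum.swap)
    also have "(\<Sum>s\<in>P n - {T}. \<Sum>i\<in>UNIV. LS_integral s (?N n s) (\<lambda>r. DF i r (?Y n (?N n s)) A) (integrator A i)) = h n"
      unfolding h_def by (rule sum.swap)
    finally show ?thesis using initial_value[OF F(1), of n] by simp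
  qed
  then have eq: "eventually (\<lambda>n. F T (?Y n T) A - F 0 X A - h n - 1 / 2 * q n = ito_sum T (P n) F X A) sequentially"
    using small_mesh by (auto elim!: eventually_mono)
  let ?L = "F T X A - F 0 X A - (\<Sum>i\<in>UNIV. LS_integral 0 T (\<lambda>s. DF i s X A) (integrator A i)) -
      1 / 2 * (\<Sum>i\<in>UNIV. \<Sum>j\<in>UNIV. LS_integral 0 T (\<lambda>s. ?V i j s X A) (qcov T P X i j))"
  have "(\<lambda>n. F T (?Y n T) A - F 0 X A - h n - 1 / 2 * q n) \<longlonglongrightarrow> ?L"
    by (intro tendsto_diff tendsto_mult_left tendsto_const terminal_value_limit[OF F(2)] h q)
  then have lim: "(\<lambda>n. ito_sum T (P n) F X A) \<longlonglongrightarrow> ?L"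
    by (rule Lim_transform_eventually[OF _ eq])
  then have ito: "pathwise_ito_integral T P F X A = ?L"
    unfolding pathwise_ito_integral_def by (rule limI)
  show ?thesis
  proof (intro conjI allI)
    show "convergent (\<lambda>n. ito_sum T (P n) F X A)" using lim by (rule convergentI)
    show "LS_integrable 0 T (\<lambda>s. DF i s X A) (integrator A i)" for i by (rule H(1))
    show "LS_integrable 0 T (\<lambda>s. ?V i j s X A) (qcov T P X i j)" for i j by (rule M(1))
  qed (use ito in linarith)
qed

end
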